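(* Let $V$ be the ground model, let $\mathbb{P}\in V$ be a notion of forcing adding a Cohen real over $V$, and let $\mathcal{A}\in V$ be an infinite Boolean algebra. Then for every $\mathbb{P}$-generic filter $G$ over $V$, the Stone space $St(\mathcal{A})$ as computed in $V[G]$ contains a non-trivial convergent sequence.
   Context: A real $x\in 2^\omega\cap V[G]$ is Cohen over $V$ if for every dense subset $D\in V$ of the poset $Fn(\omega,2)$ of finite partial functions $\omega\to2$ ordered by reverse inclusion, there is $p\in D$ with $p\subseteq x$. $St(\mathcal{A})$ is the space of ultrafilters on $\mathcal{A}$ with the Stone topology. A sequence $(x_n)$ in a space is non-trivial if its terms are pairwise distinct and, if it converges, no term equals its limit. *)

theory Defs
  imports Main
begin

section \<open>The ambient universe of sets\<close>

text \<open>
  The sets of the background set theory in which transitive models and their generic extensions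
  live. \<open>elts x\<close> is the collection of members of \<open>x\<close>. Replacement is second order and
  contains separation. Neither power sets nor an infinite set are required, so that, for instance,
  the hereditarily countable sets qualify.
\<close>

class set_universe =
  fixes elts :: "'a \<Rightarrow> 'a set"
  assumes elts_ext: "elts x = elts y \<Longrightarrow> x = y"
    and wf_elts: "wf {(x, y). x \<in> elts y}"
    and pairing: "\<exists>z. elts z = {x, y}"
    and union: "\<exists>z. elts z = (\<Union>y \<in> elts x. elts y)"
    and replacement: "\<exists>z. elts z = f ` (elts x \<inter> X)"

text \<open>Meaningful only when \<open>X\<close> is the collection of members of some set.\<close>

definition set_of :: "'a::set_universe set \<Rightarrow> 'a" where
  "set_of X = (THE x. elts x = X)"

lemma elts_set_of: "elts x = X \<Longrightarrow> elts (set_of X) = X"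
  unfolding set_of_def by (rule theI2[where a = x]) (auto intro: elts_ext)

definition opair :: "'a::set_universe \<Rightarrow> 'a \<Rightarrow> 'a" where
  "opair x y = set_of {set_of {x, x}, set_of {x, y}}"

lemma elts_set_of_pair: "elts (set_of {x, y}) = {x, y}"
  using pairing[of x y] elts_set_of by blast

lemma opair_eq_iff: "opair x y = opair u v \<longleftrightarrow> x = u \<and> y = v"
proof
  assume "opair x y = opair u v"
  then have "{set_of {x, x}, set_of {x, y}} = {set_of {u, u}, set_of {u, v}}"
    unfolding opair_def by (metis elts_set_of_pair)
  then have "elts ` {set_of {x, x}, set_of {x, y}} = elts ` {set_of {u, u}, set_of {u, v}}"
    by (rule arg_cong)
  then have "{{x, x}, {x, y}} = {{u, u}, {u, v}}"
    by (simp only: image_insert image_empty elts_set_of_pair)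
  then show "x = u \<and> y = v"
    by (auto simp: doubleton_eq_iff)
qed simp

lemma opair_fst_below:
  assumes "opair x y \<in> elts t"
  shows "(x, t) \<in> {(x, y). x \<in> elts y}\<^sup>+"
proof -
  have "x \<in> elts (set_of {x, x})" "set_of {x, x} \<in> elts (opair x y)"
    by (simp_all add: opair_def elts_set_of_pair del: insert_absorb2)
  then have "(x, set_of {x, x}) \<in> {(x, y). x \<in> elts y}"
      "(set_of {x, x}, opair x y) \<in> {(x, y). x \<in> elts y}"
      "(opair x y, t) \<in> {(x, y). x \<in> elts y}"
    using assms by simp_all
  then show ?thesis
    by (rule trancl_into_trancl[OF trancl_into_trancl[OF r_into_trancl]])
qed

text \<open>The von Neumann numerals.\<close>

primrec num :: "nat \<Rightarrow> 'a::set_universe" where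
  "num 0 = set_of {}"
| "num (Suc n) = set_of (insert (num n) (elts (num n)))"

lemma elts_num: "elts (num n) = num ` {..<n}"
proof (induction n)
  case 0
  have "\<exists>z. elts z = (id :: 'a \<Rightarrow> 'a) ` (elts undefined \<inter> {})"
    by (rule replacement)
  then obtain z :: 'a where "elts z = {}"
    by auto
  then show ?case
    using elts_set_of[of z "{}"] by simp
next
  case (Suc n)
  obtain s :: 'a where s: "elts s = {num n, num n}"
    using pairing by blast
  obtain p where p: "elts p = {s, num n}"
    using pairing by blast
  have "\<exists>z. elts z = (\<Union>y \<in> elts p. elts y)"
    by (rule union)
  then obtain z :: 'a where "elts z = insert (num n) (elts (num n))"
    using s p by auto
  then have "elts (num (Suc n) :: 'a) = insert (num n) (elts (num n))"
    unfolding num.simps by (rule elts_set_of)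
  then show ?case
    by (simp add: Suc lessThan_Suc)
qed

definition is_fun :: "'a::set_universe \<Rightarrow> 'a set \<Rightarrow> 'a set \<Rightarrow> bool" where
  "is_fun f X Y \<longleftrightarrow>
     (\<forall>z \<in> elts f. \<exists>x \<in> X. \<exists>y \<in> Y. z = opair x y) \<and> (\<forall>x \<in> X. \<exists>!y. opair x y \<in> elts f)"

definition app :: "'a::set_universe \<Rightarrow> 'a \<Rightarrow> 'a" where
  "app f x = (THE y. opair x y \<in> elts f)"


section \<open>Transitive models of ZFC\<close>

text \<open>First-order formulas of the language of set theory, with de Bruijn indices.\<close>

datatype fm = Mem nat nat | Eq nat nat | Neg fm | Conj fm fm | All fm

primrec sat :: "'a::set_universe set \<Rightarrow> (nat \<Rightarrow> 'a) \<Rightarrow> fm \<Rightarrow> bool" where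
  "sat M e (Mem i j) \<longleftrightarrow> e i \<in> elts (e j)"
| "sat M e (Eq i j) \<longleftrightarrow> e i = e j"
| "sat M e (Neg \<phi>) \<longleftrightarrow> \<not> sat M e \<phi>"
| "sat M e (Conj \<phi> \<psi>) \<longleftrightarrow> sat M e \<phi> \<and> sat M e \<psi>"
| "sat M e (All \<phi>) \<longleftrightarrow> (\<forall>x \<in> M. sat M (case_nat x e) \<phi>)"

text \<open>
  The finitely many single axioms are written out as their relativizations to \<open>M\<close>; the schemes
  range over all formulas, with parameters from \<open>M\<close>.
\<close>

definition models_ZFC :: "'a::set_universe set \<Rightarrow> bool" where
  "models_ZFC M \<longleftrightarrow>
     \<comment> \<open>extensionality\<close>
     (\<forall>x \<in> M. \<forall>y \<in> M. (\<forall>z \<in> M. z \<in> elts x \<longleftrightarrow> z \<in> elts y) \<longrightarrow> x = y) \<and>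
     \<comment> \<open>foundation\<close>
     (\<forall>x \<in> M. (\<exists>y \<in> M. y \<in> elts x) \<longrightarrow>
        (\<exists>y \<in> M. y \<in> elts x \<and> \<not> (\<exists>z \<in> M. z \<in> elts x \<and> z \<in> elts y))) \<and>
     \<comment> \<open>pairing\<close>
     (\<forall>x \<in> M. \<forall>y \<in> M. \<exists>z \<in> M. \<forall>w \<in> M. w \<in> elts z \<longleftrightarrow> w = x \<or> w = y) \<and>
     \<comment> \<open>union\<close>
     (\<forall>x \<in> M. \<exists>z \<in> M. \<forall>w \<in> M. w \<in> elts z \<longleftrightarrow> (\<exists>y \<in> M. y \<in> elts x \<and> w \<in> elts y)) \<and>
     \<comment> \<open>power set\<close>
     (\<forall>x \<in> M. \<exists>z \<in> M. \<forall>w \<in> M. w \<in> elts z \<longleftrightarrow> (\<forall>v \<in> M. v \<in> elts w \<longrightarrow> v \<in> elts x)) \<and>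
     \<comment> \<open>infinity\<close>
     (\<exists>x \<in> M. (\<exists>z \<in> M. z \<in> elts x \<and> (\<forall>w \<in> M. w \<notin> elts z)) \<and>
        (\<forall>y \<in> M. y \<in> elts x \<longrightarrow>
           (\<exists>z \<in> M. z \<in> elts x \<and> (\<forall>w \<in> M. w \<in> elts z \<longleftrightarrow> w \<in> elts y \<or> w = y)))) \<and>
     \<comment> \<open>choice\<close>
     (\<forall>x \<in> M.
        (\<forall>y \<in> M. y \<in> elts x \<longrightarrow> (\<exists>w \<in> M. w \<in> elts y)) \<and>
        (\<forall>y \<in> M. \<forall>z \<in> M. y \<in> elts x \<and> z \<in> elts x \<and> y \<noteq> z \<longrightarrow>
           \<not> (\<exists>w \<in> M. w \<in> elts y \<and> w \<in> elts z)) \<longrightarrow>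
        (\<exists>c \<in> M. \<forall>y \<in> M. y \<in> elts x \<longrightarrow> (\<exists>!w. w \<in> M \<and> w \<in> elts y \<and> w \<in> elts c))) \<and>
     \<comment> \<open>separation\<close>
     (\<forall>\<phi> e. range e \<subseteq> M \<longrightarrow>
        (\<forall>x \<in> M. \<exists>z \<in> M. \<forall>w \<in> M. w \<in> elts z \<longleftrightarrow> w \<in> elts x \<and> sat M (case_nat w e) \<phi>)) \<and>
     \<comment> \<open>replacement\<close>
     (\<forall>\<phi> e. range e \<subseteq> M \<longrightarrow>
        (\<forall>x \<in> M.
           (\<forall>u \<in> M. u \<in> elts x \<longrightarrow> (\<exists>!v. v \<in> M \<and> sat M (case_nat u (case_nat v e)) \<phi>)) \<longrightarrow>
           (\<exists>z \<in> M. \<forall>v \<in> M. v \<in> elts z \<longleftrightarrow>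
              (\<exists>u \<in> M. u \<in> elts x \<and> sat M (case_nat u (case_nat v e)) \<phi>))))"

definition transitive_model_ZFC :: "'a::set_universe set \<Rightarrow> bool" where
  "transitive_model_ZFC M \<longleftrightarrow> (\<forall>x \<in> M. elts x \<subseteq> M) \<and> models_ZFC M"


section \<open>Forcing and generic extensions\<close>

text \<open>
  A notion of forcing is a nonempty preorder; \<open>P\<close> is its set of conditions and \<open>R\<close> the set of
  pairs \<open>opair q p\<close> with \<open>q\<close> stronger than \<open>p\<close>.
\<close>

definition forcing_le :: "'a::set_universe \<Rightarrow> 'a \<Rightarrow> 'a \<Rightarrow> bool" where
  "forcing_le R q p \<longleftrightarrow> opair q p \<in> elts R"

definition forcing_notion :: "'a::set_universe \<Rightarrow> 'a \<Rightarrow> bool" where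
  "forcing_notion P R \<longleftrightarrow>
     elts P \<noteq> {} \<and>
     (\<forall>z \<in> elts R. \<exists>p \<in> elts P. \<exists>q \<in> elts P. z = opair p q) \<and>
     (\<forall>p \<in> elts P. forcing_le R p p) \<and>
     (\<forall>p \<in> elts P. \<forall>q \<in> elts P. \<forall>r \<in> elts P.
        forcing_le R p q \<longrightarrow> forcing_le R q r \<longrightarrow> forcing_le R p r)"

definition forcing_dense :: "'a::set_universe \<Rightarrow> 'a \<Rightarrow> 'a set \<Rightarrow> bool" where
  "forcing_dense P R D \<longleftrightarrow>
     D \<subseteq> elts P \<and> (\<forall>p \<in> elts P. \<exists>q \<in> D. forcing_le R q p)"

definition forcing_filter :: "'a::set_universe \<Rightarrow> 'a \<Rightarrow> 'a set \<Rightarrow> bool" where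
  "forcing_filter P R G \<longleftrightarrow>
     G \<subseteq> elts P \<and> G \<noteq> {} \<and>
     (\<forall>p \<in> G. \<forall>q \<in> elts P. forcing_le R p q \<longrightarrow> q \<in> G) \<and>
     (\<forall>p \<in> G. \<forall>q \<in> G. \<exists>r \<in> G. forcing_le R r p \<and> forcing_le R r q)"

definition generic_filter :: "'a::set_universe set \<Rightarrow> 'a \<Rightarrow> 'a \<Rightarrow> 'a set \<Rightarrow> bool" where
  "generic_filter V P R G \<longleftrightarrow>
     forcing_filter P R G \<and> (\<forall>D \<in> V. forcing_dense P R (elts D) \<longrightarrow> G \<inter> elts D \<noteq> {})"

inductive forcing_name :: "'a::set_universe \<Rightarrow> 'a \<Rightarrow> bool" for P where
  "(\<And>z. z \<in> elts t \<Longrightarrow> \<exists>s p. z = opair s p \<and> p \<in> elts P \<and> forcing_name P s)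
   \<Longrightarrow> forcing_name P t"

function name_val :: "'a::set_universe set \<Rightarrow> 'a \<Rightarrow> 'a" where
  "name_val G t = set_of (name_val G ` {s. \<exists>p \<in> G. opair s p \<in> elts t})"
  by auto
termination
proof (relation "inv_image ({(x, y). x \<in> elts y}\<^sup>+) snd")
  show "wf (inv_image ({(x, y). x \<in> elts (y::'a)}\<^sup>+) snd)"
    by (intro wf_inv_image wf_trancl wf_elts)
qed (auto dest: opair_fst_below)

declare name_val.simps [simp del]

lemma elts_name_val: "elts (name_val G t) = {name_val G s | s p. p \<in> G \<and> opair s p \<in> elts t}"
proof -
  define first where "first = (\<lambda>z::'a. THE s. \<exists>p. z = opair s p)"
  have first: "first (opair s p) = s" for s p
    unfolding first_def by (auto simp: opair_eq_iff)
  have "\<exists>z. elts z = (name_val G \<circ> first) ` (elts t \<inter> {opair s p | s p. p \<in> G})"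
    by (rule replacement)
  also have "(name_val G \<circ> first) ` (elts t \<inter> {opair s p | s p. p \<in> G})
      = name_val G ` {s. \<exists>p \<in> G. opair s p \<in> elts t}"
    by (force simp: first image_iff)
  finally obtain z where "elts z = name_val G ` {s. \<exists>p \<in> G. opair s p \<in> elts t}"
    by blast
  then have "elts (name_val G t) = name_val G ` {s. \<exists>p \<in> G. opair s p \<in> elts t}"
    unfolding name_val.simps[of G t] by (rule elts_set_of)
  then show ?thesis
    by auto
qed

definition generic_extension :: "'a::set_universe set \<Rightarrow> 'a \<Rightarrow> 'a set \<Rightarrow> 'a set" where
  "generic_extension V P G = {name_val G t | t. t \<in> V \<and> forcing_name P t}"


section \<open>Cohen reals\<close>

definition Fn_omega_2 :: "'a::set_universe set" where
  "Fn_omega_2 = {p. finite (elts p) \<and> (\<exists>X \<subseteq> range num. is_fun p X {num 0, num 1})}"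

definition Cohen_real :: "'a::set_universe set \<Rightarrow> 'a \<Rightarrow> bool" where
  "Cohen_real V x \<longleftrightarrow>
     is_fun x (range num) {num 0, num 1} \<and>
     (\<forall>D \<in> V. elts D \<subseteq> Fn_omega_2 \<and> (\<forall>p \<in> Fn_omega_2. \<exists>q \<in> elts D. elts p \<subseteq> elts q) \<longrightarrow>
        (\<exists>p \<in> elts D. elts p \<subseteq> elts x))"

definition adds_Cohen_real :: "'a::set_universe set \<Rightarrow> 'a \<Rightarrow> 'a \<Rightarrow> bool" where
  "adds_Cohen_real V P R \<longleftrightarrow>
     (\<forall>G. generic_filter V P R G \<longrightarrow> (\<exists>x \<in> generic_extension V P G. Cohen_real V x))"


section \<open>Boolean algebras and their Stone spaces\<close>

text \<open>
  The components of a Boolean algebra as a structure inside the universe of sets: the operations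
  are sets of ordered pairs.
\<close>

record 'a ba =
  carr :: 'a
  meet_fun :: 'a
  join_fun :: 'a
  compl_fun :: 'a
  bot_elt :: 'a
  top_elt :: 'a

definition ba_meet :: "'a::set_universe ba \<Rightarrow> 'a \<Rightarrow> 'a \<Rightarrow> 'a" where
  "ba_meet A a b = app (meet_fun A) (opair a b)"

definition ba_join :: "'a::set_universe ba \<Rightarrow> 'a \<Rightarrow> 'a \<Rightarrow> 'a" where
  "ba_join A a b = app (join_fun A) (opair a b)"

definition ba_compl :: "'a::set_universe ba \<Rightarrow> 'a \<Rightarrow> 'a" where
  "ba_compl A a = app (compl_fun A) a"

definition is_boolean_algebra :: "'a::set_universe ba \<Rightarrow> bool" where
  "is_boolean_algebra A \<longleftrightarrow>
     (let B = elts (carr A); BB = {opair a b | a b. a \<in> B \<and> b \<in> B} in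
        is_fun (meet_fun A) BB B \<and> is_fun (join_fun A) BB B \<and> is_fun (compl_fun A) B B \<and>
        bot_elt A \<in> B \<and> top_elt A \<in> B \<and>
        (\<forall>a \<in> B. \<forall>b \<in> B. ba_meet A a b = ba_meet A b a) \<and>
        (\<forall>a \<in> B. \<forall>b \<in> B. ba_join A a b = ba_join A b a) \<and>
        (\<forall>a \<in> B. \<forall>b \<in> B. \<forall>c \<in> B. ba_meet A (ba_meet A a b) c = ba_meet A a (ba_meet A b c)) \<and>
        (\<forall>a \<in> B. \<forall>b \<in> B. \<forall>c \<in> B. ba_join A (ba_join A a b) c = ba_join A a (ba_join A b c)) \<and>
        (\<forall>a \<in> B. \<forall>b \<in> B. \<forall>c \<in> B.
           ba_meet A a (ba_join A b c) = ba_join A (ba_meet A a b) (ba_meet A a c)) \<and>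
        (\<forall>a \<in> B. \<forall>b \<in> B. \<forall>c \<in> B.
           ba_join A a (ba_meet A b c) = ba_meet A (ba_join A a b) (ba_join A a c)) \<and>
        (\<forall>a \<in> B. ba_meet A a (top_elt A) = a) \<and>
        (\<forall>a \<in> B. ba_join A a (bot_elt A) = a) \<and>
        (\<forall>a \<in> B. ba_meet A a (ba_compl A a) = bot_elt A) \<and>
        (\<forall>a \<in> B. ba_join A a (ba_compl A a) = top_elt A))"

definition ba_in :: "'a::set_universe ba \<Rightarrow> 'a set \<Rightarrow> bool" where
  "ba_in A M \<longleftrightarrow>
     {carr A, meet_fun A, join_fun A, compl_fun A, bot_elt A, top_elt A} \<subseteq> M"

definition ba_ultrafilter :: "'a::set_universe ba \<Rightarrow> 'a \<Rightarrow> bool" where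
  "ba_ultrafilter A U \<longleftrightarrow>
     elts U \<subseteq> elts (carr A) \<and> top_elt A \<in> elts U \<and> bot_elt A \<notin> elts U \<and>
     (\<forall>a \<in> elts U. \<forall>b \<in> elts U. ba_meet A a b \<in> elts U) \<and>
     (\<forall>a \<in> elts U. \<forall>b \<in> elts (carr A). ba_meet A a b = a \<longrightarrow> b \<in> elts U) \<and>
     (\<forall>a \<in> elts (carr A). a \<in> elts U \<or> ba_compl A a \<in> elts U)"

text \<open>
  The Stone space as computed in a transitive model \<open>M\<close>: its points are the ultrafilters lying in
  \<open>M\<close>, its open sets are the elements of \<open>M\<close> that are unions of basic sets \<open>{U. a \<in> U}\<close>, and
  its sequences are those whose graph is an element of \<open>M\<close>.
\<close>

definition stone_points :: "'a::set_universe set \<Rightarrow> 'a ba \<Rightarrow> 'a set" where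
  "stone_points M A = {U \<in> M. ba_ultrafilter A U}"

definition stone_basic :: "'a::set_universe set \<Rightarrow> 'a ba \<Rightarrow> 'a \<Rightarrow> 'a set" where
  "stone_basic M A a = {U \<in> stone_points M A. a \<in> elts U}"

definition stone_open :: "'a::set_universe set \<Rightarrow> 'a ba \<Rightarrow> 'a \<Rightarrow> bool" where
  "stone_open M A S \<longleftrightarrow>
     S \<in> M \<and> elts S \<subseteq> stone_points M A \<and>
     (\<forall>U \<in> elts S. \<exists>a \<in> elts (carr A). U \<in> stone_basic M A a \<and> stone_basic M A a \<subseteq> elts S)"

definition stone_sequence :: "'a::set_universe set \<Rightarrow> 'a ba \<Rightarrow> (nat \<Rightarrow> 'a) \<Rightarrow> bool" where
  "stone_sequence M A s \<longleftrightarrow>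
     range s \<subseteq> stone_points M A \<and> (\<exists>f \<in> M. elts f = {opair (num n) (s n) | n. True})"

definition stone_tendsto :: "'a::set_universe set \<Rightarrow> 'a ba \<Rightarrow> (nat \<Rightarrow> 'a) \<Rightarrow> 'a \<Rightarrow> bool" where
  "stone_tendsto M A s u \<longleftrightarrow>
     u \<in> stone_points M A \<and>
     (\<forall>S. stone_open M A S \<and> u \<in> elts S \<longrightarrow> (\<exists>N. \<forall>n \<ge> N. s n \<in> elts S))"

definition stone_nontrivial :: "'a::set_universe set \<Rightarrow> 'a ba \<Rightarrow> (nat \<Rightarrow> 'a) \<Rightarrow> bool" where
  "stone_nontrivial M A s \<longleftrightarrow> inj s \<and> (\<forall>u. stone_tendsto M A s u \<longrightarrow> (\<forall>n. s n \<noteq> u))"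

end

theory Submission
  imports Defs
begin

text \<open>
  Call an element of the algebra infinite if there are infinitely many elements below it. If some
  infinite \<open>a\<close> is not the join of two disjoint infinite elements, then any sequence of distinct atoms
  below \<open>a\<close> converges to the ultrafilter of those \<open>b\<close> for which \<open>a - b\<close> is finite.

  Otherwise every infinite element splits into two infinite ones, and repeated splitting yields in
  \<open>V\<close> a binary tree of nonzero elements. Let \<open>I \<in> V\<close> be an ideal that is maximal among those
  containing no node. Modulo \<open>I\<close> the nodes are dense, so each element of the algebra is decided by
  densely many nodes, and the nodes along a Cohen real generate modulo \<open>I\<close> an ultrafilter. Flipping the
  \<open>n\<close>-th bit of the Cohen real gives another ultrafilter. It shares the first \<open>n\<close> nodes with the
  original one, which makes these ultrafilters converge, and it is different from it because the
  next nodes are disjoint.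

  That limits are unique requires the basic clopen sets to be elements of \<open>V[G]\<close>, hence power sets and
  separation in \<open>V[G]\<close>, which come from the forcing theorem.
\<close>

section \<open>Definability over a class of sets\<close>

text \<open>A Cohen real is only guaranteed to meet dense sets that are elements of
  \<open>V\<close>. So the splitting and the ideal \<open>I\<close> have to be found in
  \<open>V\<close>, and Zorn's lemma is proved inside \<open>V\<close>. Maximality enters as
  follows: if \<open>a\<close> is not in \<open>I\<close>, the ideal generated by \<open>I\<close>
  and \<open>a\<close> contains a node, and this node lies below \<open>a\<close> modulo
  \<open>I\<close>. Flipping a fixed bit is a change of finite conditions that is definable in
  \<open>V\<close>, so one density argument serves the Cohen real and all its flips.

  The obstacle that shapes the proof is definability: the models satisfy separation for formulas
  only, while trees, finiteness and recursion on the natural numbers are described in the ambient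
  logic. \<open>definable\<close> and \<open>dterm\<close> are therefore closed under connectives,
  bounded quantifiers, set operations and such recursion, and membership of a set in a model becomes
  a search through introduction rules. Notions defined by recursion along membership (names, forced
  equality, check names) are expressed by the existence of a set in \<open>V\<close> that witnesses
  their clauses.\<close>

primrec rename_fm :: "(nat \<Rightarrow> nat) \<Rightarrow> fm \<Rightarrow> fm" where
  "rename_fm f (Mem i j) = Mem (f i) (f j)"
| "rename_fm f (Eq i j) = Eq (f i) (f j)"
| "rename_fm f (Neg \<phi>) = Neg (rename_fm f \<phi>)"
| "rename_fm f (Conj \<phi> \<psi>) = Conj (rename_fm f \<phi>) (rename_fm f \<psi>)"
| "rename_fm f (All \<phi>) = All (rename_fm (case_nat 0 (\<lambda>n. Suc (f n))) \<phi>)"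

lemma sat_rename_fm: "sat M e (rename_fm f \<phi>) \<longleftrightarrow> sat M (\<lambda>n. e (f n)) \<phi>"
proof (induction \<phi> arbitrary: e f)
  case (All \<phi>)
  have "(\<lambda>n. case_nat x e (case_nat 0 (\<lambda>n. Suc (f n)) n)) = case_nat x (\<lambda>n. e (f n))" for x
    by (auto split: nat.split)
  then show ?case by (simp add: All)
qed simp_all

text \<open>
  The assignment \<open>k\<close> tells for each free variable of the formula whether it stands for a parameter
  from \<open>M\<close> or for an entry of the environment.
\<close>

definition definable :: "'a::set_universe set \<Rightarrow> ((nat \<Rightarrow> 'a) \<Rightarrow> bool) \<Rightarrow> bool" where
  "definable M Q \<longleftrightarrow> (\<exists>\<phi> k. (\<forall>n c. k n = Inl c \<longrightarrow> c \<in> M) \<and>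
     (\<forall>e. range e \<subseteq> M \<longrightarrow> sat M (\<lambda>n. case_sum id e (k n)) \<phi> = Q e))"

text \<open>A term is definable through its graph: the candidate value is entry \<open>0\<close> and
  the arguments are the later entries. Values in \<open>M\<close> allow a term to be replaced by a
  quantifier over \<open>M\<close>.\<close>

definition dterm :: "'a::set_universe set \<Rightarrow> ((nat \<Rightarrow> 'a) \<Rightarrow> 'a) \<Rightarrow> bool" where
  "dterm M t \<longleftrightarrow> (\<forall>e. range e \<subseteq> M \<longrightarrow> t e \<in> M) \<and> definable M (\<lambda>e. e 0 = t (\<lambda>n. e (Suc n)))"

named_theorems definable_intros

lemma definable_cong:
  assumes "definable M Q" "\<And>e. range e \<subseteq> M \<Longrightarrow> Q' e = Q e"
  shows "definable M Q'" using assms unfolding definable_def by metis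

text \<open>Only the assignment changes: composing \<open>k\<close> with \<open>g\<close> renames
  variables and inserts parameters while the formula stays the same.\<close>

lemma definable_subst:
  assumes "definable M Q" "\<And>n c. g n = Inl c \<Longrightarrow> c \<in> M"
  shows "definable M (\<lambda>e. Q (\<lambda>n. case_sum id e (g n)))"
proof -
  obtain \<phi> k where k: "\<And>n c. k n = Inl c \<Longrightarrow> c \<in> M"
    and sat: "\<And>e. range e \<subseteq> M \<Longrightarrow> sat M (\<lambda>n. case_sum id e (k n)) \<phi> = Q e"
    using assms(1) unfolding definable_def by blast
  let ?k = "\<lambda>n. case k n of Inl c \<Rightarrow> Inl c | Inr i \<Rightarrow> g i"
  have "sat M (\<lambda>n. case_sum id e (?k n)) \<phi> = Q (\<lambda>n. case_sum id e (g n))" if "range e \<subseteq> M" for e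
  proof -
    have "range (\<lambda>n. case_sum id e (g n)) \<subseteq> M"
      using that assms(2) by (fastforce split: sum.split)
    moreover have "(\<lambda>n. case_sum id e (?k n)) = (\<lambda>n. case_sum id (\<lambda>n. case_sum id e (g n)) (k n))"
      by (rule ext) (simp split: sum.split)
    ultimately show ?thesis using sat by simp
  qed
  moreover have "\<And>n c. ?k n = Inl c \<Longrightarrow> c \<in> M"
    using k assms(2) by (auto split: sum.splits)
  ultimately show ?thesis unfolding definable_def by (intro exI[of _ \<phi>] exI[of _ ?k]) simp
qed

lemma definable_rename:
  assumes "definable M Q"
  shows "definable M (\<lambda>e. Q (\<lambda>n. e (f n)))"
  using definable_subst[OF assms, of "\<lambda>n. Inr (f n)"] by simp

lemma definable_var_mem: "definable M (\<lambda>e. e i \<in> elts (e j))"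
  unfolding definable_def by (rule exI[of _ "Mem i j"], rule exI[of _ Inr]) simp

lemma definable_var_eq: "definable M (\<lambda>e. e i = e j)"
  unfolding definable_def by (rule exI[of _ "Eq i j"], rule exI[of _ Inr]) simp

lemma definable_not [definable_intros]:
  assumes "definable M Q"
  shows "definable M (\<lambda>e. \<not> Q e)"
proof -
  obtain \<phi> k where "\<And>n c. k n = Inl c \<Longrightarrow> c \<in> M"
    and "\<And>e. range e \<subseteq> M \<Longrightarrow> sat M (\<lambda>n. case_sum id e (k n)) \<phi> = Q e"
    using assms unfolding definable_def by blast
  then show ?thesis unfolding definable_def by (intro exI[of _ "Neg \<phi>"] exI[of _ k]) simp
qed

lemma definable_conj [definable_intros]:
  assumes "definable M Q" "definable M Q'"
  shows "definable M (\<lambda>e. Q e \<and> Q' e)"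
proof -
  obtain \<phi> k where k: "\<And>n c. k n = Inl c \<Longrightarrow> c \<in> M"
    and sat: "\<And>e. range e \<subseteq> M \<Longrightarrow> sat M (\<lambda>n. case_sum id e (k n)) \<phi> = Q e"
    using assms(1) unfolding definable_def by blast
  obtain \<psi> l where l: "\<And>n c. l n = Inl c \<Longrightarrow> c \<in> M"
    and sat': "\<And>e. range e \<subseteq> M \<Longrightarrow> sat M (\<lambda>n. case_sum id e (l n)) \<psi> = Q' e"
    using assms(2) unfolding definable_def by blast
  \<comment> \<open>The two assignments may clash on common variables, so the variables of
    \<open>\<phi>\<close> go to even and those of \<open>\<psi>\<close> to odd places.\<close>
  let ?h = "\<lambda>n. if even n then k (n div 2) else l (n div 2)"
  show ?thesis unfolding definable_def
    by (intro exI[of _ "Conj (rename_fm (\<lambda>n. 2 * n) \<phi>) (rename_fm (\<lambda>n. 2 * n + 1) \<psi>)"] exI[of _ ?h])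
      (use k l in \<open>auto simp: sat_rename_fm sat sat'\<close>)
qed

text \<open>
  Throughout, an additional variable is entered at position \<open>0\<close> of the environment; stating this
  with a schematic \<open>Q\<close> lets higher-order unification do the shift of the indices.
\<close>

lemma definable_sat_push:
  assumes "definable M (\<lambda>e. Q (e 0) (\<lambda>n. e (Suc n)))" "c0 \<in> M"
  obtains \<phi> k where "\<And>n c. k n = Inl c \<Longrightarrow> c \<in> M"
    "\<And>e x. range e \<subseteq> M \<Longrightarrow> x \<in> M \<Longrightarrow> sat M (case_nat x (\<lambda>n. case_sum id e (k n))) \<phi> = Q x e"
proof -
  obtain \<phi> k where k: "\<And>n c. k n = Inl c \<Longrightarrow> c \<in> M"
    and sat: "\<And>e. range e \<subseteq> M \<Longrightarrow> sat M (\<lambda>n. case_sum id e (k n)) \<phi> = Q (e 0) (\<lambda>n. e (Suc n))"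
    using assms(1) unfolding definable_def by blast
  \<comment> \<open>Several variables may stand for entry \<open>0\<close>. All of them are renamed
    by \<open>?f\<close> to variable \<open>0\<close>, which then receives \<open>x\<close>; their
    old places are filled with the default \<open>c0\<close>, out of reach of the renamed
    formula.\<close>
  let ?k = "\<lambda>n. case k n of Inl c \<Rightarrow> Inl c | Inr i \<Rightarrow> case_nat (Inl c0) Inr i"
  let ?f = "\<lambda>n. if k n = Inr 0 then 0 else Suc n"
  have "sat M (case_nat x (\<lambda>n. case_sum id e (?k n))) (rename_fm ?f \<phi>) = Q x e"
    if e: "range e \<subseteq> M" and x: "x \<in> M" for e x
  proof -
    have eq: "(\<lambda>n. case_nat x (\<lambda>n. case_sum id e (?k n)) (?f n)) = (\<lambda>n. case_sum id (case_nat x e) (k n))"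
      by (rule ext) (auto split: sum.split nat.split)
    have "range (case_nat x e) \<subseteq> M" using e x by (fastforce split: nat.split)
    from sat[OF this] show ?thesis unfolding sat_rename_fm eq by simp
  qed
  moreover have "\<And>n c. ?k n = Inl c \<Longrightarrow> c \<in> M"
    using k assms(2) by (auto split: sum.splits nat.splits)
  ultimately show thesis by (rule that[rotated])
qed

lemma definable_ball_model [definable_intros]:
  assumes "definable M (\<lambda>e. Q (e 0) (\<lambda>n. e (Suc n)))"
  shows "definable M (\<lambda>e. \<forall>x\<in>M. Q x e)"
proof (cases "M = {}")
  \<comment> \<open>No environment has its range in the empty set, so any formula will do.\<close>
  case True
  then show ?thesis unfolding definable_def by (intro exI[of _ "Eq 0 0"] exI[of _ Inr]) simp
next
  case False
  then obtain c0 where "c0 \<in> M" by blast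
  obtain \<phi> k where "\<And>n c. k n = Inl c \<Longrightarrow> c \<in> M"
    "\<And>e x. range e \<subseteq> M \<Longrightarrow> x \<in> M \<Longrightarrow> sat M (case_nat x (\<lambda>n. case_sum id e (k n))) \<phi> = Q x e"
    using definable_sat_push[where Q = Q, OF assms \<open>c0 \<in> M\<close>] by metis
  then show ?thesis unfolding definable_def by (intro exI[of _ "All \<phi>"] exI[of _ k]) auto
qed

lemma definable_disj [definable_intros]:
  assumes "definable M Q" "definable M Q'"
  shows "definable M (\<lambda>e. Q e \<or> Q' e)"
proof -
  have "definable M (\<lambda>e. \<not> (\<not> Q e \<and> \<not> Q' e))"
    by (intro definable_not definable_conj assms)
  then show ?thesis by simp
qed

lemma definable_imp [definable_intros]:
  assumes "definable M Q" "definable M Q'"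
  shows "definable M (\<lambda>e. Q e \<longrightarrow> Q' e)"
  unfolding imp_conv_disj by (intro definable_not definable_disj assms)

lemma definable_iff [definable_intros]:
  "definable M Q \<Longrightarrow> definable M Q' \<Longrightarrow> definable M (\<lambda>e. Q e \<longleftrightarrow> Q' e)"
  unfolding iff_conv_conj_imp by (intro definable_conj definable_imp)

lemma definable_bex_model [definable_intros]:
  assumes "definable M (\<lambda>e. Q (e 0) (\<lambda>n. e (Suc n)))"
  shows "definable M (\<lambda>e. \<exists>x\<in>M. Q x e)"
proof -
  have "definable M (\<lambda>e. \<not> (\<forall>x\<in>M. \<not> Q x e))"
    by (intro definable_not definable_ball_model assms)
  then show ?thesis by simp
qed

lemma dterm_in: "dterm M t \<Longrightarrow> range e \<subseteq> M \<Longrightarrow> t e \<in> M"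
  unfolding dterm_def by blast

lemma dterm_rename:
  assumes "dterm M t"
  shows "dterm M (\<lambda>e. t (\<lambda>n. e (f n)))" unfolding dterm_def
proof (intro conjI allI impI)
  fix e :: "nat \<Rightarrow> 'a" assume "range e \<subseteq> M"
  then show "t (\<lambda>n. e (f n)) \<in> M" by (intro dterm_in[OF assms]) auto
next
  show "definable M (\<lambda>e. e 0 = t (\<lambda>n. e (Suc (f n))))"
    using definable_rename[of M _ "case_nat 0 (\<lambda>n. Suc (f n))"] assms
    unfolding dterm_def by fastforce
qed

lemma dterm_var [definable_intros]: "dterm M (\<lambda>e. e i)"
  unfolding dterm_def by (auto intro: definable_var_eq)

text \<open>The value \<open>t e\<close> is introduced by a quantifier: some \<open>x\<close> in
  \<open>M\<close> equals \<open>t e\<close> and satisfies \<open>Q\<close>.\<close>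

lemma definable_dterm:
  assumes "dterm M t" "definable M (\<lambda>e. Q (e 0) (\<lambda>n. e (Suc n)))"
  shows "definable M (\<lambda>e. Q (t e) e)"
proof (rule definable_cong)
  show "definable M (\<lambda>e. \<exists>x\<in>M. x = t e \<and> Q x e)"
    using assms unfolding dterm_def by (intro definable_intros) auto
qed (use assms(1) in \<open>auto dest: dterm_in\<close>)

lemma definable_mem [definable_intros]:
  assumes "dterm M s" "dterm M t"
  shows "definable M (\<lambda>e. s e \<in> elts (t e))"
  using dterm_rename[OF assms(1)] definable_var_mem
  by (intro definable_dterm[OF assms(2), where Q = "\<lambda>y e. s e \<in> elts y"]
      definable_dterm[where Q = "\<lambda>x e. x \<in> elts (e 0)"]) auto

lemma definable_eq [definable_intros]:
  assumes "dterm M s" "dterm M t"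
  shows "definable M (\<lambda>e. s e = t e)" using dterm_rename[OF assms(1)] definable_var_eq
  by (intro definable_dterm[OF assms(2), where Q = "\<lambda>y e. s e = y"]
      definable_dterm[where Q = "\<lambda>x e. x = e 0"]) auto

lemma dterm_const [definable_intros]:
  assumes "c \<in> M"
  shows "dterm M (\<lambda>e. c)" unfolding dterm_def
proof (intro conjI allI impI)
  show "definable M (\<lambda>e. e 0 = c)"
  proof -
    have "definable M (\<lambda>e. case_sum id e (case_nat (Inr 0) (\<lambda>_. Inl c) 0)
        = case_sum id e (case_nat (Inr 0) (\<lambda>_. Inl c) 1))"
      by (rule definable_subst[OF definable_var_eq]) (use assms in \<open>auto split: nat.splits\<close>)
    then show ?thesis by simp
  qed
qed (use assms in auto)

lemma definable_const [definable_intros]: "definable M (\<lambda>e. b)"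
  using definable_not[OF definable_var_eq[of M 0 0]] definable_var_eq[of M 0 0]
  by (cases b) simp_all

section \<open>Transitive models of Zermelo set theory\<close>

text \<open>Formed in the ambient universe, where replacement makes it exist for every predicate
  \<open>Q\<close>. Whether it belongs to a model is a separate question, answered by definability
  of \<open>Q\<close>.\<close>

definition sep :: "'a::set_universe \<Rightarrow> ('a \<Rightarrow> bool) \<Rightarrow> 'a" where
  "sep X Q = set_of {x \<in> elts X. Q x}"

lemma elts_sep [simp]: "elts (sep X Q) = {x \<in> elts X. Q x}"
proof -
  obtain z where "elts z = id ` (elts X \<inter> Collect Q)" using replacement by blast
  then show ?thesis unfolding sep_def by (intro elts_set_of[of z]) auto
qed

definition pairset :: "'a::set_universe \<Rightarrow> 'a \<Rightarrow> 'a" where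
  "pairset x y = set_of {x, y}"

lemma elts_pairset [simp]: "elts (pairset x y) = {x, y}"
  unfolding pairset_def by (rule elts_set_of_pair)

definition Unions :: "'a::set_universe \<Rightarrow> 'a" where
  "Unions x = set_of (\<Union>y \<in> elts x. elts y)"

lemma elts_Unions [simp]: "elts (Unions x) = (\<Union>y \<in> elts x. elts y)"
  unfolding Unions_def using union[of x] elts_set_of by blast

definition union2 :: "'a::set_universe \<Rightarrow> 'a \<Rightarrow> 'a" where
  "union2 x y = Unions (pairset x y)"

lemma elts_union2 [simp]: "elts (union2 x y) = elts x \<union> elts y" unfolding union2_def by simp

definition ins :: "'a::set_universe \<Rightarrow> 'a \<Rightarrow> 'a" where
  "ins x y = union2 (pairset x x) y"

lemma elts_ins [simp]: "elts (ins x y) = insert x (elts y)" unfolding ins_def by simp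

lemma opair_pairset: "opair x y = pairset (pairset x x) (pairset x y)"
  unfolding opair_def pairset_def ..

lemma num_0_elts [simp]: "elts (num 0) = {}" by (simp add: elts_num del: num.simps)

lemma num_Suc_ins: "num (Suc n) = ins (num n) (num n)"
  by (rule elts_ext) (simp add: elts_num lessThan_Suc del: num.simps)

declare num.simps [simp del]

lemma mem_irrefl: "x \<notin> elts (x::'a::set_universe)" using wf_elts wf_not_refl by fastforce

lemma num_inj: "num m = (num n :: 'a::set_universe) \<longleftrightarrow> m = n"
proof -
  have "num m \<noteq> (num n :: 'a)" if "m < n" for m n
  proof -
    have "num m \<in> elts (num n :: 'a)" using that by (simp add: elts_num)
    then show ?thesis using mem_irrefl by metis
  qed
  then show ?thesis by (metis nat_neq_iff)
qed

lemma num_mem_iff [simp]: "num m \<in> elts (num n :: 'a::set_universe) \<longleftrightarrow> m < n"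
  by (auto simp: elts_num num_inj)

text \<open>Unlike \<open>app\<close>, this evaluation has a definite value also outside the domain of \<open>f\<close>.\<close>

definition ap :: "'a::set_universe \<Rightarrow> 'a \<Rightarrow> 'a" where
  "ap f x = Unions (sep (Unions (Unions f)) (\<lambda>y. opair x y \<in> elts f))"

lemma opair_in_UnionsD:
  assumes "opair x y \<in> elts f"
  shows "x \<in> elts (Unions (Unions f))" "y \<in> elts (Unions (Unions f))"
proof -
  have "pairset x y \<in> elts (Unions f)"
    using assms by (auto simp: opair_pairset intro: bexI[rotated])
  then show "x \<in> elts (Unions (Unions f))" "y \<in> elts (Unions (Unions f))"
    using elts_Unions[of "Unions f"] elts_pairset by blast+
qed

lemma ap_eqI:
  assumes "opair x y \<in> elts f" "\<And>z. opair x z \<in> elts f \<Longrightarrow> z = y"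
  shows "ap f x = y"
proof (rule elts_ext)
  have "{z \<in> elts (Unions (Unions f)). opair x z \<in> elts f} = {y}"
    using assms opair_in_UnionsD(2)[OF assms(1)] by blast
  then show "elts (ap f x) = elts y"
    unfolding ap_def by (simp del: elts_Unions add: elts_Unions[of "sep _ _"])
qed

lemma is_fun_ap:
  assumes "is_fun f X Y" "x \<in> X"
  shows "opair x (ap f x) \<in> elts f" "ap f x \<in> Y" "app f x = ap f x"
    and "opair x y \<in> elts f \<longleftrightarrow> y = ap f x"
proof -
  obtain v where y: "opair x v \<in> elts f" and uniq: "\<And>z. opair x z \<in> elts f \<Longrightarrow> z = v"
    using assms unfolding is_fun_def by metis
  have ap: "ap f x = v" using y uniq by (rule ap_eqI)
  show "opair x (ap f x) \<in> elts f" using y ap by simp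
  show "opair x y \<in> elts f \<longleftrightarrow> y = ap f x" using y uniq ap by metis
  show "ap f x \<in> Y" using assms(1) y ap unfolding is_fun_def by (metis opair_eq_iff)
  show "app f x = ap f x" unfolding app_def using y uniq ap by blast
qed

text \<open>Kept apart because in the generic extension separation comes before unions and power
  sets, whose proofs cut the desired set out of a larger one.\<close>

locale transitive_separation =
  fixes M :: "'a::set_universe set"
  assumes transitive: "x \<in> M \<Longrightarrow> y \<in> elts x \<Longrightarrow> y \<in> M"
    and sat_sep_in: "range e \<subseteq> M \<Longrightarrow> x \<in> M \<Longrightarrow> sep x (\<lambda>w. sat M (case_nat w e) \<phi>) \<in> M"
    and nonempty: "M \<noteq> {}"
begin

lemma sep_in:
  assumes "x \<in> M" "definable M (\<lambda>e. Q (e 0))"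
  shows "sep x Q \<in> M"
proof -
  obtain \<phi> and k :: "nat \<Rightarrow> 'a + nat" where k: "\<And>n c. k n = Inl c \<Longrightarrow> c \<in> M"
    and sat: "\<And>e w. range e \<subseteq> M \<Longrightarrow> w \<in> M \<Longrightarrow>
      sat M (case_nat w (\<lambda>n. case_sum id e (k n))) \<phi> = Q w"
    using definable_sat_push[where Q = "\<lambda>w e. Q w", OF assms(2,1)] by metis
  \<comment> \<open>Variables that stand for entries get the value \<open>x\<close>; any member of
    \<open>M\<close> would serve, because \<open>Q\<close> reads only \<open>w\<close>.\<close>
  let ?e = "\<lambda>n. case_sum id (\<lambda>_::nat. x) (k n)"
  have "range ?e \<subseteq> M" using k assms(1) by (auto split: sum.split)
  from sat_sep_in[OF this assms(1)] have "sep x (\<lambda>w. sat M (case_nat w ?e) \<phi>) \<in> M" .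
  also have "sep x (\<lambda>w. sat M (case_nat w ?e) \<phi>) = sep x Q"
    by (rule elts_ext) (use sat[of "\<lambda>_. x"] assms(1) transitive in auto)
  finally show ?thesis .
qed

end

locale transitive_zermelo = transitive_separation +
  assumes pairset_in [intro]: "x \<in> M \<Longrightarrow> y \<in> M \<Longrightarrow> pairset x y \<in> M"
    and Unions_in [intro]: "x \<in> M \<Longrightarrow> Unions x \<in> M"
    and power_in: "x \<in> M \<Longrightarrow> \<exists>z\<in>M. elts z = {y \<in> M. elts y \<subseteq> elts x}"
begin

text \<open>The environment is frozen into parameters from \<open>M\<close>, which turns a predicate
  with free entries into one of \<open>w\<close> alone.\<close>

lemma sep_env_in:
  assumes "x \<in> M" "definable M (\<lambda>e. Q (e 0) (\<lambda>n. e (Suc n)))" "range e \<subseteq> M"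
  shows "sep x (\<lambda>w. Q w e) \<in> M"
proof (rule sep_in[OF assms(1)])
  show "definable M (\<lambda>e'. Q (e' 0) e)"
  proof -
    have "definable M (\<lambda>e'. (\<lambda>e. Q (e 0) (\<lambda>n. e (Suc n)))
        (\<lambda>n. case_sum id e' (case_nat (Inr 0) (\<lambda>n. Inl (e n)) n)))"
      by (rule definable_subst[OF assms(2)]) (use assms(3) in \<open>auto split: nat.splits\<close>)
    then show ?thesis by simp
  qed
qed

lemma definable_ball_elts [definable_intros]:
  assumes "dterm M t" "definable M (\<lambda>e. Q (e 0) (\<lambda>n. e (Suc n)))"
  shows "definable M (\<lambda>e. \<forall>x\<in>elts (t e). Q x e)"
proof (rule definable_cong)
  show "definable M (\<lambda>e. \<forall>x\<in>M. x \<in> elts (t e) \<longrightarrow> Q x e)"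
    by (intro definable_intros assms assms(1)[THEN dterm_rename])
qed (use dterm_in[OF assms(1)] transitive in blast)

lemma definable_bex_elts [definable_intros]:
  assumes "dterm M t" "definable M (\<lambda>e. Q (e 0) (\<lambda>n. e (Suc n)))"
  shows "definable M (\<lambda>e. \<exists>x\<in>elts (t e). Q x e)"
proof -
  have "definable M (\<lambda>e. \<not> (\<forall>x\<in>elts (t e). \<not> Q x e))"
    by (intro definable_not definable_ball_elts assms)
  then show ?thesis by simp
qed

lemma definable_subset [definable_intros]:
  assumes "dterm M s" "dterm M t"
  shows "definable M (\<lambda>e. elts (s e) \<subseteq> elts (t e))"
  unfolding subset_eq by (intro definable_intros assms assms[THEN dterm_rename])

text \<open>By extensionality in the transitive class \<open>M\<close>, the graph of a set-valued
  term is definable as soon as membership in its value is.\<close>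

lemma dterm_setI:
  assumes "\<And>e. range e \<subseteq> M \<Longrightarrow> t e \<in> M"
    and "definable M (\<lambda>e. e 0 \<in> elts (t (\<lambda>n. e (Suc n))))"
  shows "dterm M t" unfolding dterm_def
proof (intro conjI allI impI assms(1))
  have "definable M (\<lambda>e. \<forall>z\<in>M. z \<in> elts (e 0) \<longleftrightarrow> z \<in> elts (t (\<lambda>n. e (Suc n))))"
    using definable_rename[OF assms(2), of "case_nat 0 (\<lambda>n. Suc (Suc n))"]
    by (intro definable_ball_model definable_iff definable_var_mem) simp
  then show "definable M (\<lambda>e. e 0 = t (\<lambda>n. e (Suc n)))"
  proof (rule definable_cong)
    fix e :: "nat \<Rightarrow> 'a" assume e: "range e \<subseteq> M"
    have "e 0 \<in> M" "t (\<lambda>n. e (Suc n)) \<in> M" using e by (auto intro!: assms(1))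
    then show "(e 0 = t (\<lambda>n. e (Suc n))) = (\<forall>z\<in>M. z \<in> elts (e 0) \<longleftrightarrow> z \<in> elts (t (\<lambda>n. e (Suc n))))"
      using transitive by (metis elts_ext set_eqI)
  qed
qed

lemma dterm_sep [definable_intros]:
  assumes "dterm M t" "definable M (\<lambda>e. Q (e 0) (\<lambda>n. e (Suc n)))"
  shows "dterm M (\<lambda>e. sep (t e) (\<lambda>x. Q x e))"
proof (rule dterm_setI)
  show "sep (t e) (\<lambda>x. Q x e) \<in> M" if "range e \<subseteq> M" for e
    by (rule sep_env_in[OF dterm_in[OF assms(1) that] assms(2) that])
  show "definable M (\<lambda>e. e 0 \<in> elts (sep (t (\<lambda>n. e (Suc n))) (\<lambda>x. Q x (\<lambda>n. e (Suc n)))))"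
    unfolding elts_sep mem_Collect_eq by (intro definable_intros assms assms(1)[THEN dterm_rename])
qed

lemma dterm_pairset [definable_intros]:
  assumes "dterm M s" "dterm M t"
  shows "dterm M (\<lambda>e. pairset (s e) (t e))"
proof (rule dterm_setI)
  show "definable M (\<lambda>e. e 0 \<in> elts (pairset (s (\<lambda>n. e (Suc n))) (t (\<lambda>n. e (Suc n)))))"
    unfolding elts_pairset insert_iff empty_iff by (intro definable_intros assms assms[THEN dterm_rename])
qed (use assms dterm_in in blast)

lemma dterm_Unions [definable_intros]:
  assumes "dterm M t"
  shows "dterm M (\<lambda>e. Unions (t e))"
proof (rule dterm_setI)
  show "definable M (\<lambda>e. e 0 \<in> elts (Unions (t (\<lambda>n. e (Suc n)))))"
    unfolding elts_Unions UN_iff by (intro definable_intros assms assms[THEN dterm_rename])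
qed (use assms dterm_in in blast)

lemma dterm_union2 [definable_intros]:
  "dterm M s \<Longrightarrow> dterm M t \<Longrightarrow> dterm M (\<lambda>e. union2 (s e) (t e))"
  unfolding union2_def by (intro definable_intros)

lemma dterm_ins [definable_intros]:
  "dterm M s \<Longrightarrow> dterm M t \<Longrightarrow> dterm M (\<lambda>e. ins (s e) (t e))"
  unfolding ins_def by (intro definable_intros)

lemma dterm_opair [definable_intros]:
  "dterm M s \<Longrightarrow> dterm M t \<Longrightarrow> dterm M (\<lambda>e. opair (s e) (t e))"
  unfolding opair_pairset by (intro definable_intros)

lemma dterm_ap [definable_intros]:
  assumes "dterm M s" "dterm M t"
  shows "dterm M (\<lambda>e. ap (s e) (t e))"
  unfolding ap_def by (intro definable_intros assms assms[THEN dterm_rename])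

lemma dterm_if [definable_intros]:
  assumes "definable M Q" "dterm M s" "dterm M t"
  shows "dterm M (\<lambda>e. if Q e then s e else t e)" unfolding dterm_def
proof (intro conjI allI impI)
  have "definable M (\<lambda>e. (Q (\<lambda>n. e (Suc n)) \<longrightarrow> e 0 = s (\<lambda>n. e (Suc n))) \<and>
      (\<not> Q (\<lambda>n. e (Suc n)) \<longrightarrow> e 0 = t (\<lambda>n. e (Suc n))))"
    by (intro definable_intros assms assms(1)[THEN definable_rename] assms(2,3)[THEN dterm_rename])
  then show "definable M (\<lambda>e. e 0 = (if Q (\<lambda>n. e (Suc n)) then s (\<lambda>n. e (Suc n)) else t (\<lambda>n. e (Suc n))))"
    by (rule definable_cong) simp
qed (use assms dterm_in in auto)

lemma union2_in [intro]: "x \<in> M \<Longrightarrow> y \<in> M \<Longrightarrow> union2 x y \<in> M"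
  unfolding union2_def by blast

lemma ins_in [intro]: "x \<in> M \<Longrightarrow> y \<in> M \<Longrightarrow> ins x y \<in> M"
  unfolding ins_def by blast

lemma opair_in [intro]: "x \<in> M \<Longrightarrow> y \<in> M \<Longrightarrow> opair x y \<in> M"
  unfolding opair_pairset by blast

lemma opair_inD:
  assumes "opair x y \<in> M"
  shows "x \<in> M" "y \<in> M"
proof -
  have "pairset x y \<in> M"
    using transitive[OF assms, of "pairset x y"] by (simp add: opair_pairset)
  then show "x \<in> M" "y \<in> M" using transitive by fastforce+
qed

definition power :: "'a \<Rightarrow> 'a" where
  "power x = set_of {y \<in> M. elts y \<subseteq> elts x}"

lemma elts_power: "x \<in> M \<Longrightarrow> elts (power x) = {y \<in> M. elts y \<subseteq> elts x}"
  unfolding power_def by (drule power_in, elim bexE, rule elts_set_of)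

lemma power_closed [intro]: "x \<in> M \<Longrightarrow> power x \<in> M"
  using power_in[of x] elts_power[of x] by (metis elts_ext)

lemma dterm_power [definable_intros]:
  assumes "dterm M t"
  shows "dterm M (\<lambda>e. power (t e))"
proof (rule dterm_setI)
  have "definable M (\<lambda>e. elts (e 0) \<subseteq> elts (t (\<lambda>n. e (Suc n))))"
    by (intro definable_intros assms assms[THEN dterm_rename])
  then show "definable M (\<lambda>e. e 0 \<in> elts (power (t (\<lambda>n. e (Suc n)))))"
  proof (rule definable_cong)
    fix e :: "nat \<Rightarrow> 'a" assume e: "range e \<subseteq> M"
    then have "t (\<lambda>n. e (Suc n)) \<in> M" "e 0 \<in> M" by (auto intro!: dterm_in[OF assms])
    then show "(e 0 \<in> elts (power (t (\<lambda>n. e (Suc n))))) = (elts (e 0) \<subseteq> elts (t (\<lambda>n. e (Suc n))))"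
      by (simp add: elts_power)
  qed
qed (use assms dterm_in in blast)

definition times :: "'a \<Rightarrow> 'a \<Rightarrow> 'a" where
  "times x y = sep (power (power (union2 x y))) (\<lambda>z. \<exists>a\<in>elts x. \<exists>b\<in>elts y. z = opair a b)"

lemma elts_times:
  assumes "x \<in> M" "y \<in> M"
  shows "elts (times x y) = {opair a b | a b. a \<in> elts x \<and> b \<in> elts y}"
proof -
  have "opair a b \<in> elts (power (power (union2 x y)))" if "a \<in> elts x" "b \<in> elts y" for a b
  proof -
    have ab: "a \<in> M" "b \<in> M" using that assms transitive by auto
    then have "pairset a a \<in> elts (power (union2 x y))" "pairset a b \<in> elts (power (union2 x y))"
      using that assms by (auto simp: elts_power union2_in)
    then show ?thesis using ab assms by (auto simp: elts_power union2_in power_closed opair_pairset)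
  qed
  then show ?thesis unfolding times_def by auto
qed

lemma times_in [intro]: "x \<in> M \<Longrightarrow> y \<in> M \<Longrightarrow> times x y \<in> M"
  unfolding times_def by (intro sep_in power_closed union2_in definable_intros)

lemma dterm_times [definable_intros]:
  assumes "dterm M s" "dterm M t"
  shows "dterm M (\<lambda>e. times (s e) (t e))"
  unfolding times_def by (intro definable_intros assms assms[THEN dterm_rename])

lemma opair_in_times [simp]:
  assumes "x \<in> M" "y \<in> M"
  shows "opair a b \<in> elts (times x y) \<longleftrightarrow> a \<in> elts x \<and> b \<in> elts y"
  using assms by (auto simp: elts_times opair_eq_iff)

lemma empty_in: "num 0 \<in> M"
proof -
  obtain x where "x \<in> M" using nonempty by blast
  then have "sep x (\<lambda>_. False) \<in> M" by (intro sep_in definable_intros)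
  moreover have "sep x (\<lambda>_. False) = num 0" by (rule elts_ext) simp
  ultimately show ?thesis by simp
qed

lemma num_in [intro]: "num n \<in> M" by (induction n) (auto simp: empty_in num_Suc_ins)

lemma finite_subset_in:
  assumes "finite X" "X \<subseteq> M"
  shows "\<exists>z\<in>M. elts z = X" using assms
proof (induction rule: finite_induct)
  case empty
  then show ?case using empty_in num_0_elts by blast
next
  case (insert x X)
  then obtain z where "z \<in> M" "elts z = X" by auto
  then show ?case using insert by (intro bexI[of _ "ins x z"]) auto
qed

end

section \<open>Natural numbers, recursion and finiteness inside a transitive model\<close>

definition omega :: "'a::set_universe" where
  "omega = set_of (range num)"

text \<open>The recursion runs on the natural numbers of the logic and is carried over to numerals;
  the value \<open>num 0\<close> elsewhere makes it total, as a term has to be.\<close>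

definition num_rec :: "'a::set_universe \<Rightarrow> ('a \<Rightarrow> 'a \<Rightarrow> 'a) \<Rightarrow> 'a \<Rightarrow> 'a" where
  "num_rec a s m = (if m \<in> range num then rec_nat a (\<lambda>k. s (num k)) (inv num m) else num 0)"

lemma num_rec_num: "num_rec a s (num n) = rec_nat a (\<lambda>k. s (num k)) n"
  unfolding num_rec_def by (simp add: inv_f_f inj_def num_inj)

lemma num_rec_0 [simp]: "num_rec a s (num 0) = a" unfolding num_rec_num by simp

lemma num_rec_Suc [simp]: "num_rec a s (num (Suc n)) = s (num n) (num_rec a s (num n))"
  unfolding num_rec_num by simp

lemma ins_self_eq_num_Suc:
  assumes "ins (num k) (num k) = (num (Suc n) :: 'a::set_universe)"
  shows "k = n" using assms unfolding num_Suc_ins[symmetric] num_inj by simp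

locale transitive_zermelo_omega = transitive_zermelo +
  assumes omega_exists: "\<exists>z\<in>M. elts z = range num"
begin

lemma elts_omega [simp]: "elts (omega :: 'a) = range num"
  using omega_exists unfolding omega_def by (elim bexE) (rule elts_set_of, assumption)

lemma omega_in [intro]: "omega \<in> M"
  proof -
  obtain z where "z \<in> M" "elts z = range num" using omega_exists by blast
  then show ?thesis using elts_ext[of z omega] by simp
qed

text \<open>The value at \<open>num n\<close> is characterized inside \<open>M\<close> by a finite
  approximation \<open>h\<close> containing the pair in question. Approximations lie in
  \<open>M\<close> because finite subsets of \<open>M\<close> do.\<close>

lemma dterm_num_rec [definable_intros]:
  assumes a: "dterm M a" and m: "dterm M m"
    and s: "dterm M (\<lambda>e. s (e 0) (e (Suc 0)) (\<lambda>n. e (Suc (Suc n))))"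
  shows "dterm M (\<lambda>e. num_rec (a e) (\<lambda>k y. s k y e) (m e))"
proof -
  \<comment> \<open>Each pair in \<open>h\<close> must be the initial one or arise by one step of
    \<open>s\<close> from a pair in \<open>h\<close>. Induction on \<open>n\<close> then shows that
    \<open>h\<close> agrees with the recursion, which is how it becomes single-valued.\<close>
  define att where "att h e \<longleftrightarrow> (\<forall>z\<in>elts h. z = opair (num 0) (a e) \<or>
    (\<exists>k\<in>elts omega. \<exists>y\<in>M. opair k y \<in> elts h \<and> z = opair (ins k k) (s k y e)))" for h e
  have s_in: "s k y e \<in> M" if "range e \<subseteq> M" "k \<in> M" "y \<in> M" for k y e
  proof -
    have "range (case_nat k (case_nat y e)) \<subseteq> M"
      using that by (fastforce split: nat.split)
    from dterm_in[OF s this] show ?thesis by simp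
  qed
  have rec_in: "num_rec (a e) (\<lambda>k y. s k y e) (num n) \<in> M" if "range e \<subseteq> M" for e n
    by (induction n) (use that dterm_in[OF a] s_in[OF that num_in] in simp_all)
  have in_M: "num_rec (a e) (\<lambda>k y. s k y e) (m e) \<in> M" if "range e \<subseteq> M" for e
    using rec_in[OF that] by (cases "m e \<in> range num") (auto simp: num_rec_def)
  have att_eq: "y = num_rec (a e) (\<lambda>k y. s k y e) (num n)"
    if "att h e" "opair (num n) y \<in> elts h" for h e n y using that(2)
  proof (induction n arbitrary: y)
    case 0
    have "num 0 \<noteq> ins k k" for k :: 'a by (metis elts_ins insert_not_empty num_0_elts)
    then show ?case using 0 that(1) unfolding att_def by (fastforce simp: opair_eq_iff)
  next
    case (Suc n)
    have "opair (num (Suc n)) y = opair (num 0) (a e) \<or> (\<exists>k\<in>elts omega. \<exists>y'\<in>M.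
        opair k y' \<in> elts h \<and> opair (num (Suc n)) y = opair (ins k k) (s k y' e))"
      using that(1) Suc.prems unfolding att_def by blast
    then obtain k y' where "opair (num k) y' \<in> elts h" "num (Suc n) = (ins (num k) (num k) :: 'a)"
      "y = s (num k) y' e" by (auto simp: opair_eq_iff num_inj)
    then show ?case using Suc.IH ins_self_eq_num_Suc by (metis num_rec_Suc)
  qed
  have att_ex: "\<exists>h\<in>M. att h e \<and> opair (num n) (num_rec (a e) (\<lambda>k y. s k y e) (num n)) \<in> elts h"
    if e: "range e \<subseteq> M" for e n
  proof -
    let ?F = "\<lambda>i. num_rec (a e) (\<lambda>k y. s k y e) (num i)"
    obtain h where h: "h \<in> M" "elts h = (\<lambda>i. opair (num i) (?F i)) ` {..n}"
      using finite_subset_in[of "(\<lambda>i. opair (num i) (?F i)) ` {..n}"] rec_in[OF e] by auto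
    have "att h e" unfolding att_def
    proof
      fix z assume "z \<in> elts h"
      then obtain i where i: "i \<le> n" "z = opair (num i) (?F i)" using h by auto
      show "z = opair (num 0) (a e) \<or>
        (\<exists>k\<in>elts omega. \<exists>y\<in>M. opair k y \<in> elts h \<and> z = opair (ins k k) (s k y e))"
      proof (cases i)
        case (Suc j)
        then have "opair (num j) (?F j) \<in> elts h" using h i by auto
        then show ?thesis using i Suc rec_in[OF e] by (auto simp: num_Suc_ins[symmetric])
      qed (use i in simp)
    qed
    then show ?thesis using h by auto
  qed
  show ?thesis unfolding dterm_def
  proof (intro conjI allI impI in_M)
    let ?sh = "\<lambda>e n. e (Suc n)"
    have "definable M (\<lambda>e. \<exists>h\<in>M. att h (?sh e) \<and> opair (m (?sh e)) (e 0) \<in> elts h)"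
      unfolding att_def
      using dterm_rename[OF s, of "case_nat 0 (case_nat (Suc 0) (\<lambda>n. n + 6))"]
        \<comment> \<open>Below the quantifiers for \<open>h\<close>, \<open>z\<close>,
          \<open>k\<close>, \<open>y\<close> the entry \<open>y\<close> is at \<open>0\<close>,
          \<open>k\<close> at \<open>1\<close>, the value of the term at \<open>4\<close>, and its
          arguments begin at \<open>5\<close>.\<close>
        dterm_rename[OF s, of "case_nat (Suc 0) (case_nat 0 (\<lambda>n. n + 5))"]
      by (intro definable_intros a[THEN dterm_rename] m[THEN dterm_rename] num_in omega_in)
        (simp_all add: numeral_eq_Suc)
    then have "definable M (\<lambda>e. (m (?sh e) \<in> elts omega \<and>
        (\<exists>h\<in>M. att h (?sh e) \<and> opair (m (?sh e)) (e 0) \<in> elts h)) \<or>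
        m (?sh e) \<notin> elts omega \<and> e 0 = num 0)"
      by (intro definable_disj definable_conj definable_not definable_mem definable_eq
          m[THEN dterm_rename] dterm_const dterm_var num_in omega_in)
    then show "definable M (\<lambda>e. e 0 = num_rec (a (?sh e)) (\<lambda>k y. s k y (?sh e)) (m (?sh e)))"
    proof (rule definable_cong)
      fix e :: "nat \<Rightarrow> 'a" assume "range e \<subseteq> M"
      then have e: "range (?sh e) \<subseteq> M" by auto
      show "(e 0 = num_rec (a (?sh e)) (\<lambda>k y. s k y (?sh e)) (m (?sh e))) =
        ((m (?sh e) \<in> elts omega \<and>
          (\<exists>h\<in>M. att h (?sh e) \<and> opair (m (?sh e)) (e 0) \<in> elts h)) \<or>
          m (?sh e) \<notin> elts omega \<and> e 0 = num 0)"
      proof (cases "m (?sh e) \<in> range num")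
        case True
        then obtain n where n: "m (?sh e) = num n" by blast
        have "e 0 = num_rec (a (?sh e)) (\<lambda>k y. s k y (?sh e)) (num n) \<longleftrightarrow>
            (\<exists>h\<in>M. att h (?sh e) \<and> opair (num n) (e 0) \<in> elts h)"
          using att_ex[OF e, of n] att_eq[of _ "?sh e" n "e 0"] by metis
        then show ?thesis unfolding n elts_omega by blast
      qed (simp add: num_rec_def)
    qed
  qed
qed

text \<open>Finiteness is absolute for \<open>M\<close>: an injection of a finite subset of
  \<open>M\<close> into a numeral is itself a finite subset of \<open>M\<close>, hence given by an
  element of \<open>M\<close>. The formula speaks of a relation \<open>f\<close> that gives each
  element a private number.\<close>

lemma definable_finite [definable_intros]:
  assumes "dterm M t"
  shows "definable M (\<lambda>e. finite (elts (t e)))"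
proof (rule definable_cong)
  show "definable M (\<lambda>e. \<exists>n\<in>elts omega. \<exists>f\<in>M. \<forall>x\<in>elts (t e). \<exists>i\<in>elts n. opair x i \<in> elts f \<and>
      (\<forall>x'\<in>elts (t e). opair x' i \<in> elts f \<longrightarrow> x' = x))"
    by (intro definable_intros assms[THEN dterm_rename] omega_in)
next
  fix e :: "nat \<Rightarrow> 'a" assume e: "range e \<subseteq> M"
  let ?X = "elts (t e)"
  show "finite ?X = (\<exists>n\<in>elts omega. \<exists>f\<in>M. \<forall>x\<in>?X. \<exists>i\<in>elts n. opair x i \<in> elts f \<and>
      (\<forall>x'\<in>?X. opair x' i \<in> elts f \<longrightarrow> x' = x))" (is "_ = ?R")
  proof
    assume "finite ?X"
    then obtain h n where h: "bij_betw h ?X {..<n::nat}"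
      using ex_bij_betw_finite_nat by (metis atLeast0LessThan)
    have "?X \<subseteq> M" using dterm_in[OF assms e] transitive by blast
    then obtain f where f: "f \<in> M" "elts f = (\<lambda>x. opair x (num (h x))) ` ?X"
      using finite_subset_in[of "(\<lambda>x. opair x (num (h x))) ` ?X"] \<open>finite ?X\<close> by auto
    have "\<exists>i\<in>elts (num n). opair x i \<in> elts f \<and> (\<forall>x'\<in>?X. opair x' i \<in> elts f \<longrightarrow> x' = x)"
      if "x \<in> ?X" for x
    proof -
      have "h x < n" "\<And>x'. x' \<in> ?X \<Longrightarrow> h x' = h x \<Longrightarrow> x' = x"
        using h that by (auto simp: bij_betw_def inj_on_def)
      then show ?thesis
        using that f by (intro bexI[of _ "num (h x)"]) (auto simp: opair_eq_iff num_inj)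
    qed
    then show ?R using f(1) by (intro bexI[of _ "num n"] bexI[of _ f]) simp_all
  next
    assume ?R
    then obtain n f where "\<forall>x\<in>?X. \<exists>i\<in>elts (num n). opair x i \<in> elts f \<and>
      (\<forall>x'\<in>?X. opair x' i \<in> elts f \<longrightarrow> x' = x)"
      by (fastforce simp only: elts_omega)
    then obtain i where i: "\<And>x. x \<in> ?X \<Longrightarrow> i x \<in> elts (num n :: 'a)"
      "\<And>x. x \<in> ?X \<Longrightarrow> opair x (i x) \<in> elts f"
      "\<And>x x'. x \<in> ?X \<Longrightarrow> x' \<in> ?X \<Longrightarrow> opair x' (i x) \<in> elts f \<Longrightarrow> x' = x"
      by metis
    have "inj_on i ?X" by (rule inj_onI) (metis i(2,3))
    moreover have "finite (elts (num n :: 'a))" by (simp add: elts_num)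
    moreover have "i ` ?X \<subseteq> elts (num n)" using i(1) by blast
    ultimately show "finite ?X" using finite_imageD finite_subset by blast
  qed
qed

end

section \<open>Transitive models of ZFC\<close>

locale transitive_zfc = transitive_zermelo_omega +
  assumes sat_replacement: "range e \<subseteq> M \<Longrightarrow> x \<in> M \<Longrightarrow>
      (\<And>u. u \<in> elts x \<Longrightarrow> \<exists>!v. v \<in> M \<and> sat M (case_nat u (case_nat v e)) \<phi>) \<Longrightarrow>
      \<exists>z\<in>M. elts z = {v \<in> M. \<exists>u\<in>elts x. sat M (case_nat u (case_nat v e)) \<phi>}"
    and choice_set: "x \<in> M \<Longrightarrow> (\<And>y. y \<in> elts x \<Longrightarrow> elts y \<noteq> {}) \<Longrightarrow>
      (\<And>y z. y \<in> elts x \<Longrightarrow> z \<in> elts x \<Longrightarrow> y \<noteq> z \<Longrightarrow> elts y \<inter> elts z = {}) \<Longrightarrow>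
      \<exists>c\<in>M. \<forall>y\<in>elts x. \<exists>!w. w \<in> elts y \<and> w \<in> elts c"
begin

lemma replacement_in:
  assumes "x \<in> M" and Q: "definable M (\<lambda>e. Q (e 0) (e (Suc 0)))"
    and ex1: "\<And>u. u \<in> elts x \<Longrightarrow> \<exists>!v. v \<in> M \<and> Q u v"
  shows "\<exists>z\<in>M. elts z = {v \<in> M. \<exists>u\<in>elts x. Q u v}"
proof -
  obtain \<phi> and k :: "nat \<Rightarrow> 'a + nat" where k: "\<And>n c. k n = Inl c \<Longrightarrow> c \<in> M"
    and sat: "\<And>e u. range e \<subseteq> M \<Longrightarrow> u \<in> M \<Longrightarrow>
      sat M (case_nat u (\<lambda>n. case_sum id e (k n))) \<phi> = Q u (e 0)"
    using definable_sat_push[where Q = "\<lambda>u e. Q u (e 0)", OF Q \<open>x \<in> M\<close>] by metis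
  define e where "e n = (case k n of Inl c \<Rightarrow> c | Inr _ \<Rightarrow> x)" for n
  \<comment> \<open>In the replacement scheme variables \<open>0\<close> and \<open>1\<close> are
    \<open>u\<close> and \<open>v\<close>. All variables of \<open>\<phi>\<close> that stand for
    entries are sent to \<open>v\<close>, since \<open>Q\<close> reads only entry \<open>0\<close>;
    the parameters are shifted by one.\<close>
  define f where "f n = (case n of 0 \<Rightarrow> 0 | Suc i \<Rightarrow> (case k i of Inl c \<Rightarrow> Suc (Suc i) | Inr _ \<Rightarrow> Suc 0))" for n
  have e: "range e \<subseteq> M"
    using k \<open>x \<in> M\<close> unfolding e_def by (fastforce split: sum.split)
  have sat': "sat M (case_nat u (case_nat v e)) (rename_fm f \<phi>) = Q u v" if "u \<in> M" "v \<in> M" for u v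
  proof -
    have "(\<lambda>n. case_nat u (case_nat v e) (f n)) = case_nat u (\<lambda>n. case_sum id (\<lambda>_::nat. v) (k n))"
      unfolding f_def e_def by (rule ext) (simp split: nat.split sum.split)
    then show ?thesis
      using sat[of "\<lambda>_. v" u] that by (simp add: sat_rename_fm image_subset_iff)
  qed
  have "\<exists>!v. v \<in> M \<and> sat M (case_nat u (case_nat v e)) (rename_fm f \<phi>)" if "u \<in> elts x" for u
    using ex1[OF that] sat'[OF transitive[OF \<open>x \<in> M\<close> that]] by metis
  from sat_replacement[OF e \<open>x \<in> M\<close> this] obtain z where "z \<in> M"
    "elts z = {v \<in> M. \<exists>u\<in>elts x. sat M (case_nat u (case_nat v e)) (rename_fm f \<phi>)}"
    by blast
  then show ?thesis using sat' transitive[OF \<open>x \<in> M\<close>] by (intro bexI[of _ z]) auto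
qed

section \<open>Transitive hulls, choice functions and Zorn's lemma inside a model\<close>

definition tset :: "'a \<Rightarrow> bool" where
  "tset T \<longleftrightarrow> (\<forall>y\<in>elts T. elts y \<subseteq> elts T)"

lemma definable_tset [definable_intros]:
  assumes "dterm M t"
  shows "definable M (\<lambda>e. tset (t e))"
  unfolding tset_def by (intro definable_intros assms assms[THEN dterm_rename])

text \<open>Induction along membership, with replacement collecting the hulls of the members. The
  result bounds later witnesses: the names below a given name all lie in one transitive set, from
  which separation cuts what is wanted.\<close>

lemma tset_exists:
  assumes "x \<in> M"
  obtains T where "T \<in> M" "x \<in> elts T" "tset T"
proof -
  \<comment> \<open>The least transitive set is meant because replacement asks for a unique
    value.\<close>
  define hull where "hull x T \<longleftrightarrow> x \<in> elts T \<and> tset T \<and>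
    (\<forall>T'\<in>M. x \<in> elts T' \<and> tset T' \<longrightarrow> elts T \<subseteq> elts T')" for x T
  have "\<exists>T\<in>M. hull x T" using wf_elts assms
  proof (induction x rule: wf_induct_rule)
    case (less x)
    have hull_ex1: "\<exists>!T. T \<in> M \<and> hull y T" if y: "y \<in> elts x" for y
    proof -
      obtain T where "T \<in> M" "hull y T"
        using less.IH[of y] y transitive[OF less.prems y] by auto
      then show ?thesis unfolding hull_def by (intro ex1I[of _ T]) (auto intro!: elts_ext)
    qed
    have "definable M (\<lambda>e. hull (e 0) (e (Suc 0)))"
      unfolding hull_def by (intro definable_intros)
    from replacement_in[OF \<open>x \<in> M\<close> this hull_ex1] obtain z where z: "z \<in> M"
      "elts z = {T \<in> M. \<exists>y\<in>elts x. hull y T}" by blast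
    have "y \<in> elts (Unions z)" if y: "y \<in> elts x" for y
    proof -
      obtain T where T: "T \<in> M" "hull y T" using hull_ex1[OF y] by blast
      then have "T \<in> elts z" using z(2) y by blast
      then show ?thesis using T(2) unfolding hull_def elts_Unions by blast
    qed
    moreover have "tset (Unions z)" unfolding tset_def
    proof
      fix w assume "w \<in> elts (Unions z)"
      then obtain T where T: "T \<in> elts z" "w \<in> elts T" by auto
      then have "tset T" unfolding z(2) hull_def by blast
      then show "elts w \<subseteq> elts (Unions z)" using T unfolding tset_def elts_Unions by blast
    qed
    moreover have "elts (Unions z) \<subseteq> elts T'" if "T' \<in> M" "x \<in> elts T'" "tset T'" for T'
    proof -
      have "y \<in> elts T'" if "y \<in> elts x" for y
        using that \<open>x \<in> elts T'\<close> \<open>tset T'\<close> unfolding tset_def by blast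
      then show ?thesis using that unfolding elts_Unions z(2) hull_def by blast
    qed
    ultimately have "hull x (ins x (Unions z))" unfolding hull_def tset_def elts_ins by blast
    then show ?case using z less.prems by blast
  qed
  then show thesis using that unfolding hull_def by blast
qed

text \<open>The axiom chooses from pairwise disjoint families. Replacing \<open>S\<close> by the
  product of \<open>{S}\<close> with \<open>S\<close> makes the nonempty subsets of \<open>X\<close>
  disjoint, and the chosen pairs form the function.\<close>

lemma choice_function:
  assumes "X \<in> M"
  obtains ch where "ch \<in> M" "\<And>S. S \<in> M \<Longrightarrow> elts S \<subseteq> elts X \<Longrightarrow> elts S \<noteq> {} \<Longrightarrow> ap ch S \<in> elts S"
proof -
  let ?P = "power X"
  define F where "F = sep (power (times ?P X)) (\<lambda>z. \<exists>S\<in>elts ?P. (\<exists>y\<in>elts S. True) \<and>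
    z = times (pairset S S) S)"
  have P: "?P \<in> M" using assms by blast
  have "F \<in> M" unfolding F_def by (intro sep_in definable_intros power_closed times_in P assms)
  have F: "elts F = {times (pairset S S) S | S. S \<in> M \<and> elts S \<subseteq> elts X \<and> elts S \<noteq> {}}" (is "_ = ?R")
  proof -
    have "times (pairset S S) S \<in> elts (power (times ?P X))" if "S \<in> M" "elts S \<subseteq> elts X" for S
      using that assms P by (auto simp: elts_power times_in elts_times pairset_in)
    then show ?thesis unfolding F_def by (auto simp: elts_power assms)
  qed
  have "\<exists>c\<in>M. \<forall>y\<in>elts F. \<exists>!w. w \<in> elts y \<and> w \<in> elts c"
  proof (rule choice_set[OF \<open>F \<in> M\<close>])
    show "elts y \<noteq> {}" if "y \<in> elts F" for y
      using that by (auto simp: F elts_times pairset_in)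
    show "elts y \<inter> elts z = {}" if "y \<in> elts F" "z \<in> elts F" "y \<noteq> z" for y z
      using that by (auto simp: F elts_times pairset_in opair_eq_iff)
  qed
  then obtain c where c: "c \<in> M" "\<forall>y\<in>elts F. \<exists>!w. w \<in> elts y \<and> w \<in> elts c"
    by (rule bexE)
  define ch where "ch = sep c (\<lambda>z. \<exists>S\<in>elts ?P. \<exists>y\<in>elts S. z = opair S y)"
  have "ch \<in> M" unfolding ch_def by (intro sep_in definable_intros c(1) P)
  moreover have "ap ch S \<in> elts S" if S: "S \<in> M" "elts S \<subseteq> elts X" "elts S \<noteq> {}" for S
  proof -
    have "times (pairset S S) S \<in> elts F" using S by (auto simp: F)
    from c(2)[rule_format, OF this] obtain w where w: "w \<in> elts (times (pairset S S) S)" "w \<in> elts c"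
      "\<And>w'. w' \<in> elts (times (pairset S S) S) \<Longrightarrow> w' \<in> elts c \<Longrightarrow> w' = w"
      by (elim ex1E) blast
    from w(1) obtain y where y: "y \<in> elts S" "w = opair S y"
      using S by (auto simp: elts_times pairset_in)
    have uniq: "y' = y" if "y' \<in> elts S" "opair S y' \<in> elts c" for y'
      using w(3)[of "opair S y'"] that S y by (simp add: pairset_in opair_eq_iff)
    have ch: "opair S y' \<in> elts ch \<longleftrightarrow> y' \<in> elts S \<and> opair S y' \<in> elts c" for y'
      unfolding ch_def using S assms by (auto simp: opair_eq_iff elts_power)
    have "ap ch S = y"
    proof (rule ap_eqI)
      show "opair S y \<in> elts ch" using y w(2) ch by simp
    qed (use uniq ch in blast)
    then show ?thesis using y by simp
  qed
  ultimately show thesis using that by blast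
qed

text \<open>
  The proof of the Bourbaki--Witt theorem goes through inside \<open>M\<close>: all families to which the
  minimality of the tower \<open>\<tau>\<close> is applied are definable.
\<close>

lemma zorn_in:
  assumes G: "\<G> \<in> M" and S0: "S0 \<in> elts \<G>"
    and chain_ub: "\<And>C. C \<in> M \<Longrightarrow> elts C \<subseteq> elts \<G> \<Longrightarrow> elts C \<noteq> {} \<Longrightarrow>
      \<forall>x\<in>elts C. \<forall>y\<in>elts C. elts x \<subseteq> elts y \<or> elts y \<subseteq> elts x \<Longrightarrow> Unions C \<in> elts \<G>"
  obtains I where "I \<in> elts \<G>" "\<And>J. J \<in> elts \<G> \<Longrightarrow> elts I \<subseteq> elts J \<Longrightarrow> J = I"
proof -
  obtain ch where ch: "ch \<in> M"
    "\<And>S. S \<in> M \<Longrightarrow> elts S \<subseteq> elts \<G> \<Longrightarrow> elts S \<noteq> {} \<Longrightarrow> ap ch S \<in> elts S"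
    using choice_function[OF G] by metis
  define above where "above x = sep \<G> (\<lambda>y. elts x \<subseteq> elts y \<and> y \<noteq> x)" for x
  \<comment> \<open>\<open>f\<close> enlarges a set whenever \<open>\<G>\<close> allows it, so its
    fixed points in \<open>\<G>\<close> are the maximal elements.\<close>
  define f where "f x = (if \<exists>y\<in>elts (above x). True then ap ch (above x) else x)" for x
  define chain where "chain C \<longleftrightarrow> (\<forall>x\<in>elts C. \<forall>y\<in>elts C. elts x \<subseteq> elts y \<or> elts y \<subseteq> elts x)" for C :: 'a
  have in_M: "x \<in> M" if "x \<in> elts \<G>" for x using transitive[OF G that] .
  have dterm_f: "dterm M (\<lambda>e. f (t e))" if "dterm M t" for t
    unfolding f_def above_def by (intro definable_intros that that[THEN dterm_rename] ch(1) G)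
  have definable_chain: "definable M (\<lambda>e. chain (t e))" if "dterm M t" for t
    unfolding chain_def by (intro definable_intros that that[THEN dterm_rename])
  have f_above: "f x \<in> elts (above x) \<or> f x = x \<and> elts (above x) = {}" if "x \<in> M" for x
  proof (cases "elts (above x) = {}")
    case False
    have "above x \<in> M" unfolding above_def by (intro sep_in definable_intros that G)
    moreover have "elts (above x) \<subseteq> elts \<G>" unfolding above_def by auto
    ultimately show ?thesis using ch(2) False unfolding f_def by auto
  qed (simp add: f_def)
  have f_in: "f x \<in> elts \<G>" if "x \<in> elts \<G>" for x
    using f_above[OF in_M[OF that]] that unfolding above_def by auto
  have f_sup: "elts x \<subseteq> elts (f x)" if "x \<in> elts \<G>" for x
    using f_above[OF in_M[OF that]] unfolding above_def by auto
  define clos where "clos T \<longleftrightarrow> S0 \<in> elts T \<and> (\<forall>x\<in>elts T. f x \<in> elts T) \<and>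
    (\<forall>C\<in>M. elts C \<subseteq> elts T \<and> (\<exists>y\<in>elts C. True) \<and> chain C \<longrightarrow> Unions C \<in> elts T)" for T
  \<comment> \<open>The intersection of all closed families that are elements of \<open>M\<close>;
    since the quantifier ranges over \<open>M\<close>, the tower is definable and itself an element
    of \<open>M\<close>.\<close>
  define \<tau> where "\<tau> = sep \<G> (\<lambda>x. \<forall>T\<in>M. elts T \<subseteq> elts \<G> \<and> clos T \<longrightarrow> x \<in> elts T)"
  have "\<tau> \<in> M" unfolding \<tau>_def clos_def
    by (intro sep_in definable_intros definable_chain dterm_f G in_M[OF S0])
  have \<tau>_sub: "elts \<tau> \<subseteq> elts \<G>" unfolding \<tau>_def by auto
  have \<tau>_least: "elts \<tau> \<subseteq> elts T" if "T \<in> M" "elts T \<subseteq> elts \<G>" "clos T" for T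
    unfolding \<tau>_def using that by auto
  have S0_\<tau>: "S0 \<in> elts \<tau>" unfolding \<tau>_def clos_def using S0 by auto
  have f_\<tau>: "f x \<in> elts \<tau>" if "x \<in> elts \<tau>" for x
    using that f_in unfolding \<tau>_def clos_def by auto
  have Unions_\<tau>: "Unions C \<in> elts \<tau>" if C: "C \<in> M" "elts C \<subseteq> elts \<tau>" "elts C \<noteq> {}" "chain C" for C
  proof -
    have "elts C \<subseteq> elts \<G>" using C \<tau>_sub by blast
    moreover have "Unions C \<in> elts T" if "T \<in> M" "elts T \<subseteq> elts \<G>" "clos T" for T
    proof -
      have "elts C \<subseteq> elts T" using C(2) that unfolding \<tau>_def by auto
      then show ?thesis using that(3) C unfolding clos_def by blast
    qed
    ultimately show ?thesis using chain_ub[of C] C unfolding \<tau>_def chain_def by simp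
  qed
  have \<tau>_induct: "Q x"
    if Q: "definable M (\<lambda>e. Q (e 0))" and x: "x \<in> elts \<tau>" and base: "Q S0"
      and step: "\<And>x. x \<in> elts \<tau> \<Longrightarrow> Q x \<Longrightarrow> Q (f x)"
      and lim: "\<And>C. C \<in> M \<Longrightarrow> elts C \<subseteq> elts \<tau> \<Longrightarrow> elts C \<noteq> {} \<Longrightarrow> chain C \<Longrightarrow>
        (\<And>x. x \<in> elts C \<Longrightarrow> Q x) \<Longrightarrow> Q (Unions C)" for Q x
  proof -
    have "sep \<tau> Q \<in> M" by (rule sep_in[OF \<open>\<tau> \<in> M\<close> Q])
    moreover have "elts (sep \<tau> Q) \<subseteq> elts \<G>" using \<tau>_sub by auto
    moreover have "clos (sep \<tau> Q)" unfolding clos_def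
    proof (intro conjI ballI impI)
      fix C assume C: "C \<in> M" "elts C \<subseteq> elts (sep \<tau> Q) \<and> (\<exists>y\<in>elts C. True) \<and> chain C"
      then have "elts C \<subseteq> elts \<tau>" "elts C \<noteq> {}" "chain C" "\<And>x. x \<in> elts C \<Longrightarrow> Q x"
        by auto
      then show "Unions C \<in> elts (sep \<tau> Q)"
        using Unions_\<tau>[of C] lim[of C] C(1) by simp
    qed (use S0_\<tau> base f_\<tau> step in auto)
    ultimately have "x \<in> elts (sep \<tau> Q)" using \<tau>_least x by blast
    then show ?thesis by simp
  qed
  have base: "elts S0 \<subseteq> elts x" if "x \<in> elts \<tau>" for x
  proof (rule \<tau>_induct[OF _ that])
    show "definable M (\<lambda>e. elts S0 \<subseteq> elts (e 0))"
      by (intro definable_intros in_M S0)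
    show "elts S0 \<subseteq> elts (f x)" if "x \<in> elts \<tau>" "elts S0 \<subseteq> elts x" for x
      using that f_sup \<tau>_sub by blast
    show "elts S0 \<subseteq> elts (Unions C)" if "elts C \<noteq> {}" "\<And>x. x \<in> elts C \<Longrightarrow> elts S0 \<subseteq> elts x" for C
      using that unfolding elts_Unions by blast
  qed simp
  \<comment> \<open>\<open>extreme c\<close> means that \<open>f\<close> cannot jump over
    \<open>c\<close> from below. Such a \<open>c\<close> is comparable with the whole tower, and
    nothing of the tower lies strictly between \<open>c\<close> and \<open>f c\<close>; this is
    \<open>split\<close>.\<close>
  define extreme where "extreme c \<longleftrightarrow> (\<forall>x\<in>elts \<tau>. elts x \<subseteq> elts c \<and> x \<noteq> c \<longrightarrow> elts (f x) \<subseteq> elts c)" for c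
  have definable_extreme: "definable M (\<lambda>e. extreme (e i))" for i
    unfolding extreme_def by (intro definable_intros dterm_f \<open>\<tau> \<in> M\<close>)
  have split: "elts x \<subseteq> elts c \<or> elts (f c) \<subseteq> elts x" if "x \<in> elts \<tau>" "c \<in> elts \<tau>" "extreme c" for x c
  proof (rule \<tau>_induct[OF _ \<open>x \<in> elts \<tau>\<close>])
    have "c \<in> M" using that \<tau>_sub in_M by blast
    then show "definable M (\<lambda>e. elts (e 0) \<subseteq> elts c \<or> elts (f c) \<subseteq> elts (e 0))"
      by (intro definable_intros dterm_f)
    show "elts S0 \<subseteq> elts c \<or> elts (f c) \<subseteq> elts S0" using base that by blast
    show "elts (f x) \<subseteq> elts c \<or> elts (f c) \<subseteq> elts (f x)"
      if x: "x \<in> elts \<tau>" "elts x \<subseteq> elts c \<or> elts (f c) \<subseteq> elts x" for x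
    proof (cases "x = c")
      case False
      then show ?thesis
        using x \<open>extreme c\<close> f_sup[of x] \<tau>_sub unfolding extreme_def by blast
    qed simp
    show "elts (Unions C) \<subseteq> elts c \<or> elts (f c) \<subseteq> elts (Unions C)"
      if "\<And>x. x \<in> elts C \<Longrightarrow> elts x \<subseteq> elts c \<or> elts (f c) \<subseteq> elts x" for C
      unfolding elts_Unions using that by blast
  qed
  have extreme: "extreme c" if "c \<in> elts \<tau>" for c
  proof (rule \<tau>_induct[OF definable_extreme that])
    show "extreme S0" unfolding extreme_def using base elts_ext by blast
    show "extreme (f c)" if c: "c \<in> elts \<tau>" "extreme c" for c unfolding extreme_def
    proof (intro ballI impI)
      fix x assume x: "x \<in> elts \<tau>" "elts x \<subseteq> elts (f c) \<and> x \<noteq> f c"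
      have "\<not> elts (f c) \<subseteq> elts x" using x elts_ext[of x "f c"] by blast
      then have "elts x \<subseteq> elts c" using split[OF x(1) c] by blast
      show "elts (f x) \<subseteq> elts (f c)"
      proof (cases "x = c")
        case False
        then have "elts (f x) \<subseteq> elts c"
          using c(2) x(1) \<open>elts x \<subseteq> elts c\<close> unfolding extreme_def by blast
        then show ?thesis using f_sup[of c] c(1) \<tau>_sub by blast
      qed simp
    qed
    show "extreme (Unions C)" if C: "C \<in> M" "elts C \<subseteq> elts \<tau>" "elts C \<noteq> {}" "chain C"
      "\<And>x. x \<in> elts C \<Longrightarrow> extreme x" for C unfolding extreme_def
    proof (intro ballI impI)
      fix x assume x: "x \<in> elts \<tau>" "elts x \<subseteq> elts (Unions C) \<and> x \<noteq> Unions C"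
      then have "\<not> elts (Unions C) \<subseteq> elts x" using elts_ext[of x "Unions C"] by blast
      then obtain c where c: "c \<in> elts C" "\<not> elts c \<subseteq> elts x"
        unfolding elts_Unions by blast
      have c': "c \<in> elts \<tau>" "extreme c" using c C by auto
      have "elts c \<subseteq> elts (f c)" using f_sup[of c] c' \<tau>_sub by blast
      then have "elts x \<subseteq> elts c" using split[OF x(1) c'] c(2) by blast
      have "x \<noteq> c" using c(2) by blast
      then have "elts (f x) \<subseteq> elts c"
        using c'(2) x(1) \<open>elts x \<subseteq> elts c\<close> unfolding extreme_def by blast
      then show "elts (f x) \<subseteq> elts (Unions C)" using c(1) unfolding elts_Unions by blast
    qed
  qed
  have "chain \<tau>" unfolding chain_def
  proof (intro ballI)
    fix x y assume xy: "x \<in> elts \<tau>" "y \<in> elts \<tau>"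
    then have "elts y \<subseteq> elts (f y)" using f_sup \<tau>_sub by blast
    then show "elts x \<subseteq> elts y \<or> elts y \<subseteq> elts x"
      using split[OF xy extreme[OF xy(2)]] by blast
  qed
  \<comment> \<open>The tower is a chain in \<open>M\<close>, hence contains its own union, and the
    union cannot be enlarged by \<open>f\<close>.\<close>
  define I where "I = Unions \<tau>"
  have I: "I \<in> elts \<tau>"
    unfolding I_def using Unions_\<tau>[OF \<open>\<tau> \<in> M\<close> _ _ \<open>chain \<tau>\<close>] S0_\<tau> by blast
  have "elts (f I) \<subseteq> elts I" using f_\<tau>[OF I] unfolding I_def elts_Unions by blast
  moreover have "elts I \<subseteq> elts (f I)" using f_sup I \<tau>_sub by blast
  ultimately have "f I = I" using elts_ext by blast
  then have "elts (above I) = {}" using f_above[of I] in_M I \<tau>_sub unfolding above_def by auto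
  then have "\<And>J. J \<in> elts \<G> \<Longrightarrow> elts I \<subseteq> elts J \<Longrightarrow> J = I"
    unfolding above_def by auto
  then show thesis using that I \<tau>_sub by blast
qed

end

text \<open>Well-foundedness of the ambient universe excludes nonstandard elements: a
  membership-minimal non-numeral of the least inductive set \<open>L\<close> is not a successor of
  an element of \<open>L\<close>, so removing it would leave a smaller inductive set.\<close>

lemma (in transitive_zermelo) omega_existsI:
  assumes X: "X \<in> M" "num 0 \<in> elts X" "\<And>y. y \<in> elts X \<Longrightarrow> ins y y \<in> elts X"
  shows "\<exists>z\<in>M. elts z = range num"
proof -
  define ind where "ind Z \<longleftrightarrow> num 0 \<in> elts Z \<and> (\<forall>y\<in>elts Z. ins y y \<in> elts Z)" for Z :: 'a
  define L where "L = sep X (\<lambda>n. \<forall>Z\<in>M. elts Z \<subseteq> elts X \<and> ind Z \<longrightarrow> n \<in> elts Z)"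
  have "L \<in> M" unfolding L_def ind_def by (intro sep_in definable_intros X num_in)
  have L_least: "elts L \<subseteq> elts Z" if "Z \<in> M" "elts Z \<subseteq> elts X" "ind Z" for Z
    unfolding L_def using that by auto
  have ind_L: "ind L" unfolding L_def ind_def using X by auto
  have "num n \<in> elts L" for n
    by (induction n) (use ind_L in \<open>auto simp: ind_def num_Suc_ins\<close>)
  moreover have "m \<in> range num" if "m \<in> elts L" for m
  proof (rule ccontr)
    assume "m \<notin> range num"
    with that have "m \<in> {m \<in> elts L. m \<notin> range num}" by blast
    then obtain m where m: "m \<in> elts L" "m \<notin> range num"
      and min: "\<And>y. y \<in> elts m \<Longrightarrow> y \<in> elts L \<Longrightarrow> y \<in> range num"
      by (rule wfE_min[OF wf_elts]) blast
    have "sep L (\<lambda>y. y \<noteq> m) \<in> M"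
      by (intro sep_in definable_intros \<open>L \<in> M\<close> transitive[OF \<open>L \<in> M\<close> m(1)])
    moreover have "ind (sep L (\<lambda>y. y \<noteq> m))"
    proof -
      have "ins y y \<noteq> m" if yL: "y \<in> elts L" for y
      proof
        assume y: "ins y y = m"
        then have "y \<in> elts m" by auto
        then obtain n where "y = num n" using min yL by blast
        then show False using y m(2) by (metis num_Suc_ins rangeI)
      qed
      then show ?thesis using ind_L m(2) unfolding ind_def by auto
    qed
    moreover have "elts (sep L (\<lambda>y. y \<noteq> m)) \<subseteq> elts X"
      unfolding L_def by auto
    ultimately have "m \<in> elts (sep L (\<lambda>y. y \<noteq> m))" using L_least m(1) by blast
    then show False by simp
  qed
  ultimately have "elts L = range num" by blast
  then show ?thesis using \<open>L \<in> M\<close> by blast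
qed

lemma transitive_zfcI:
  assumes "transitive_model_ZFC (V :: 'a::set_universe set)"
  shows "transitive_zfc V"
proof -
  have tr: "\<And>x y. x \<in> V \<Longrightarrow> y \<in> elts x \<Longrightarrow> y \<in> V" and ax: "models_ZFC V"
    using assms unfolding transitive_model_ZFC_def by auto
  note ax3 = ax[unfolded models_ZFC_def, THEN conjunct2, THEN conjunct2]
  note ax4 = ax3[THEN conjunct2] note ax5 = ax4[THEN conjunct2] note ax6 = ax5[THEN conjunct2]
  note ax7 = ax6[THEN conjunct2] note ax8 = ax7[THEN conjunct2]
  note pair = ax3[THEN conjunct1, rule_format] and un = ax4[THEN conjunct1, rule_format]
    and pow = ax5[THEN conjunct1, rule_format] and infty = ax6[THEN conjunct1]
    and cho = ax7[THEN conjunct1, rule_format] and sepa = ax8[THEN conjunct1, rule_format]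
    and repl = ax8[THEN conjunct2, rule_format]
  \<comment> \<open>The axioms speak of members in \<open>V\<close> only; transitivity turns this
    into true equality of sets.\<close>
  have eqI: "z = w" if "z \<in> V" "\<And>y. y \<in> V \<Longrightarrow> y \<in> elts z \<longleftrightarrow> y \<in> elts w" "elts w \<subseteq> V" for z w
    using that tr by (intro elts_ext) blast
  interpret transitive_zermelo V
  proof
    fix x y :: 'a
    show "y \<in> V" if "x \<in> V" "y \<in> elts x" using tr that .
    show "pairset x y \<in> V" if xy: "x \<in> V" "y \<in> V"
    proof -
      obtain z where "z \<in> V" "\<forall>w\<in>V. w \<in> elts z \<longleftrightarrow> w = x \<or> w = y"
        using pair[OF xy] by blast
      then show ?thesis using eqI[of z "pairset x y"] xy by auto
    qed
    show "Unions x \<in> V" if x: "x \<in> V"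
    proof -
      obtain z where z: "z \<in> V" "\<forall>w\<in>V. w \<in> elts z \<longleftrightarrow> (\<exists>y\<in>V. y \<in> elts x \<and> w \<in> elts y)"
        using un[OF x] by blast
      have "z = Unions x"
      proof (rule eqI[OF z(1)])
        show "elts (Unions x) \<subseteq> V" using x tr by auto
        show "w \<in> elts z \<longleftrightarrow> w \<in> elts (Unions x)" if "w \<in> V" for w
          using z(2) that tr[OF x] unfolding elts_Unions by blast
      qed
      then show ?thesis using z(1) by simp
    qed
    show "\<exists>z\<in>V. elts z = {y \<in> V. elts y \<subseteq> elts x}" if x: "x \<in> V"
    proof -
      obtain z where z: "z \<in> V" "\<forall>w\<in>V. w \<in> elts z \<longleftrightarrow> (\<forall>v\<in>V. v \<in> elts w \<longrightarrow> v \<in> elts x)"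
        using pow[OF x] by blast
      have "elts z = {y \<in> V. elts y \<subseteq> elts x}" using z tr by blast
      then show ?thesis using z by blast
    qed
    show "sep x (\<lambda>w. sat V (case_nat w e) \<phi>) \<in> V" if e: "range e \<subseteq> V" and x: "x \<in> V" for e \<phi>
    proof -
      obtain z where "z \<in> V" "\<forall>w\<in>V. w \<in> elts z \<longleftrightarrow> w \<in> elts x \<and> sat V (case_nat w e) \<phi>"
        using sepa[OF e x] by blast
      moreover have "elts (sep x (\<lambda>w. sat V (case_nat w e) \<phi>)) \<subseteq> V"
        using x tr by auto
      ultimately show ?thesis
        using eqI[of z "sep x (\<lambda>w. sat V (case_nat w e) \<phi>)"] by simp
    qed
    show "V \<noteq> {}" using infty by blast
  qed
  have omega: "\<exists>z\<in>V. elts z = range num"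
  proof -
    obtain x z where x: "x \<in> V" and z: "z \<in> V" "z \<in> elts x" "\<forall>w\<in>V. w \<notin> elts z"
      and step: "\<forall>y\<in>V. y \<in> elts x \<longrightarrow>
        (\<exists>z\<in>V. z \<in> elts x \<and> (\<forall>w\<in>V. w \<in> elts z \<longleftrightarrow> w \<in> elts y \<or> w = y))"
      using infty by blast
    have "z = num 0" using eqI[of z "num 0"] z by simp
    moreover have "ins y y \<in> elts x" if y: "y \<in> elts x" for y
    proof -
      have "y \<in> V" using tr[OF x y] .
      then obtain z where "z \<in> V" "z \<in> elts x" "\<forall>w\<in>V. w \<in> elts z \<longleftrightarrow> w \<in> elts y \<or> w = y"
        using step y by blast
      moreover have "elts (ins y y) \<subseteq> V" using \<open>y \<in> V\<close> tr[of y] by auto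
      ultimately show ?thesis using eqI[of z "ins y y"] by simp blast
    qed
    ultimately show ?thesis using omega_existsI[OF x] z by blast
  qed
  show ?thesis
  proof unfold_locales
    show "\<exists>z\<in>V. elts z = range num" by (rule omega)
    show "\<exists>z\<in>V. elts z = {v \<in> V. \<exists>u\<in>elts x. sat V (case_nat u (case_nat v e)) \<phi>}"
      if e: "range e \<subseteq> V" and x: "x \<in> V"
        and ex1: "\<And>u. u \<in> elts x \<Longrightarrow> \<exists>!v. v \<in> V \<and> sat V (case_nat u (case_nat v e)) \<phi>" for e x \<phi>
    proof -
      obtain z where "z \<in> V" "\<forall>v\<in>V. v \<in> elts z \<longleftrightarrow>
          (\<exists>u\<in>V. u \<in> elts x \<and> sat V (case_nat u (case_nat v e)) \<phi>)"
        using repl[OF e x ex1] by blast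
      then have "elts z = {v \<in> V. \<exists>u\<in>elts x. sat V (case_nat u (case_nat v e)) \<phi>}"
        using tr[of z] tr[OF x] by blast
      then show ?thesis using \<open>z \<in> V\<close> by blast
    qed
    show "\<exists>c\<in>V. \<forall>y\<in>elts x. \<exists>!w. w \<in> elts y \<and> w \<in> elts c"
      if x: "x \<in> V" and ne: "\<And>y. y \<in> elts x \<Longrightarrow> elts y \<noteq> {}"
        and disj: "\<And>y z. y \<in> elts x \<Longrightarrow> z \<in> elts x \<Longrightarrow> y \<noteq> z \<Longrightarrow> elts y \<inter> elts z = {}" for x
    proof -
      have "\<exists>c\<in>V. \<forall>y\<in>V. y \<in> elts x \<longrightarrow> (\<exists>!w. w \<in> V \<and> w \<in> elts y \<and> w \<in> elts c)"
      proof (rule cho[OF x], intro conjI ballI impI)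
        show "\<exists>w\<in>V. w \<in> elts y" if "y \<in> V" "y \<in> elts x" for y
          using ne[OF that(2)] tr[OF that(1)] by blast
        show "\<not> (\<exists>w\<in>V. w \<in> elts y \<and> w \<in> elts z)" if "y \<in> elts x \<and> z \<in> elts x \<and> y \<noteq> z" for y z
          using disj[of y z] that by blast
      qed
      then obtain c where "c \<in> V"
        and c: "\<forall>y\<in>V. y \<in> elts x \<longrightarrow> (\<exists>!w. w \<in> V \<and> w \<in> elts y \<and> w \<in> elts c)"
        by (rule bexE)
      have "\<exists>!w. w \<in> elts y \<and> w \<in> elts c" if "y \<in> elts x" for y
      proof -
        have "y \<in> V" using tr[OF x that] .
        then have "\<exists>!w. w \<in> V \<and> w \<in> elts y \<and> w \<in> elts c"
          using c that by blast
        moreover have "w \<in> V \<and> w \<in> elts y \<and> w \<in> elts c \<longleftrightarrow> w \<in> elts y \<and> w \<in> elts c" for w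
          using tr[OF \<open>y \<in> V\<close>] by blast
        ultimately show ?thesis by simp
      qed
      then show ?thesis using \<open>c \<in> V\<close> by blast
    qed
  qed
qed

section \<open>The forcing theorem\<close>

locale generic_forcing = transitive_zfc V for V :: "'a::set_universe set" +
  fixes P R :: 'a and G :: "'a set"
  assumes P_in [intro]: "P \<in> V" and R_in [intro]: "R \<in> V"
    and notion: "forcing_notion P R" and generic: "generic_filter V P R G"
begin

abbreviation le :: "'a \<Rightarrow> 'a \<Rightarrow> bool" where
  "le \<equiv> forcing_le R"

abbreviation val :: "'a \<Rightarrow> 'a" where
  "val \<equiv> name_val G"

lemma le_in:
  assumes "le q p"
  shows "q \<in> elts P" "p \<in> elts P"
  using assms notion unfolding forcing_notion_def forcing_le_def by (metis opair_eq_iff)+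

lemma le_refl: "p \<in> elts P \<Longrightarrow> le p p"
  using notion unfolding forcing_notion_def by blast

lemma le_trans: "le p q \<Longrightarrow> le q r \<Longrightarrow> le p r"
  using notion le_in unfolding forcing_notion_def by metis

lemma definable_le [definable_intros]:
  "dterm V s \<Longrightarrow> dterm V t \<Longrightarrow> definable V (\<lambda>e. le (s e) (t e))"
  unfolding forcing_le_def by (intro definable_intros R_in)

lemma filter: "forcing_filter P R G" using generic unfolding generic_filter_def by blast

lemma G_sub: "p \<in> G \<Longrightarrow> p \<in> elts P"
  using filter unfolding forcing_filter_def by blast

lemma G_up: "p \<in> G \<Longrightarrow> le p q \<Longrightarrow> q \<in> G"
  using filter le_in unfolding forcing_filter_def by metis

lemma G_directed:
  assumes "p \<in> G" "q \<in> G"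
  obtains r where "r \<in> G" "le r p" "le r q"
  using filter assms unfolding forcing_filter_def by metis

lemma G_nonempty: obtains p where "p \<in> G" using filter unfolding forcing_filter_def by blast

lemma P_elem_in: "p \<in> elts P \<Longrightarrow> p \<in> V" using transitive P_in by blast

text \<open>Adding the conditions incompatible with \<open>r\<close> turns density below
  \<open>r\<close> into density, and definability of \<open>Q\<close> puts the resulting set into
  \<open>V\<close>. A condition of \<open>G\<close> in that set is compatible with \<open>r\<close>,
  so it is of the first kind.\<close>

lemma generic_meets:
  assumes Q: "definable V (\<lambda>e. Q (e 0))" and r: "r \<in> G"
    and dense: "\<And>p. le p r \<Longrightarrow> \<exists>q. le q p \<and> Q q"
  obtains q where "q \<in> G" "le q r" "Q q"
proof -
  define D where "D = sep P (\<lambda>q. Q q \<and> le q r \<or> (\<forall>s\<in>elts P. \<not> (le s q \<and> le s r)))"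
  have "D \<in> V" unfolding D_def by (intro sep_in definable_intros P_in Q P_elem_in G_sub r)
  moreover have "forcing_dense P R (elts D)" unfolding forcing_dense_def
  proof (intro conjI ballI)
    fix p assume p: "p \<in> elts P"
    show "\<exists>q\<in>elts D. le q p"
    proof (cases "\<exists>s. le s p \<and> le s r")
      case True
      then obtain s q where "le s p" "le s r" "le q s" "Q q" using dense by blast
      then show ?thesis unfolding D_def by (intro bexI[of _ q]) (auto intro: le_trans le_in)
    next
      case False
      then show ?thesis unfolding D_def using p by (intro bexI[of _ p]) (auto intro: le_refl)
    qed
  qed (auto simp: D_def)
  ultimately obtain q where q: "q \<in> G" "q \<in> elts D"
    using generic unfolding generic_filter_def by blast
  obtain s where "s \<in> G" "le s q" "le s r" using G_directed[OF q(1) r] .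
  then have "Q q" "le q r" using q(2) le_in unfolding D_def by auto
  then show thesis using that q(1) by blast
qed

subsection \<open>Names\<close>

lemma tset_opair:
  assumes "tset T" "u \<in> elts T" "opair x y \<in> elts u"
  shows "x \<in> elts T"
proof -
  have "opair x y \<in> elts T" using assms unfolding tset_def by blast
  then have "elts (opair x y) \<subseteq> elts T" using assms(1) unfolding tset_def by blast
  then have "pairset x x \<in> elts T" unfolding opair_pairset by simp
  then have "elts (pairset x x) \<subseteq> elts T" using assms(1) unfolding tset_def by blast
  then show ?thesis by simp
qed

text \<open>
  Being a name is defined inductively outside of \<open>V\<close>. By well-foundedness the coinductive
  characterization, which is a first-order formula over \<open>V\<close>, agrees with it.
\<close>

definition name_witness :: "'a \<Rightarrow> bool" where
  "name_witness N \<longleftrightarrow> (\<forall>u\<in>elts N. \<forall>z\<in>elts u. \<exists>s\<in>elts N. \<exists>p\<in>elts P. z = opair s p)"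

lemma wf_trancl_elts: "wf ({(x, y). x \<in> elts (y::'a)}\<^sup>+)" by (rule wf_trancl[OF wf_elts])

lemma forcing_nameD:
  assumes "forcing_name P t" "opair s p \<in> elts t"
  shows "forcing_name P s" "p \<in> elts P"
  using assms by (auto elim!: forcing_name.cases simp: opair_eq_iff) (metis opair_eq_iff)+

lemma forcing_name_iff:
  assumes "t \<in> V"
  shows "forcing_name P t \<longleftrightarrow> (\<exists>N\<in>V. name_witness N \<and> t \<in> elts N)"
proof
  assume "forcing_name P t"
  then show "\<exists>N\<in>V. name_witness N \<and> t \<in> elts N" using assms
  proof (induction)
    case (1 t)
    define Q where "Q u \<longleftrightarrow> (\<exists>N\<in>V. name_witness N \<and> u \<in> elts N)" for u
    obtain T where T: "T \<in> V" "t \<in> elts T" "tset T" using tset_exists[OF 1(2)] .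
    \<comment> \<open>Taking all elements of a transitive set that have a witness avoids a choice of
      witnesses for the subnames of \<open>t\<close>.\<close>
    define N where "N = sep T Q"
    have "N \<in> V"
      unfolding N_def Q_def name_witness_def by (intro sep_in definable_intros T P_in)
    have sub: "\<exists>s\<in>elts N. \<exists>p\<in>elts P. z = opair s p" if u: "Q u" "u \<in> elts T" "z \<in> elts u" for u z
    proof -
      obtain N' where "N' \<in> V" "name_witness N'" "u \<in> elts N'"
        using u(1) unfolding Q_def by blast
      then obtain s p where s: "s \<in> elts N'" "p \<in> elts P" "z = opair s p"
        using u(3) unfolding name_witness_def by blast
      then have "Q s"
        using \<open>N' \<in> V\<close> \<open>name_witness N'\<close> unfolding Q_def by blast
      moreover have "s \<in> elts T" using tset_opair[OF T(3) u(2)] u(3) s(3) by blast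
      ultimately show ?thesis unfolding N_def using s by auto
    qed
    have "\<exists>s\<in>elts N. \<exists>p\<in>elts P. z = opair s p" if z: "z \<in> elts t" for z
    proof -
      obtain s p where s: "z = opair s p" "p \<in> elts P" "s \<in> V \<longrightarrow> Q s"
        using 1(1)[OF z] unfolding Q_def by blast
      have "s \<in> elts T" using tset_opair[OF T(3) T(2)] z s(1) by blast
      moreover have "s \<in> V" using \<open>s \<in> elts T\<close> T(1) transitive by blast
      ultimately show ?thesis unfolding N_def using s by auto
    qed
    then have "name_witness (ins t N)" using sub unfolding name_witness_def N_def by auto
    then show ?case using \<open>N \<in> V\<close> 1(2) by (intro bexI[of _ "ins t N"]) auto
  qed
next
  assume "\<exists>N\<in>V. name_witness N \<and> t \<in> elts N"
  then obtain N where N: "name_witness N" "t \<in> elts N" by blast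
  from wf_trancl_elts N(2) show "forcing_name P t"
  proof (induction t rule: wf_induct_rule)
    case (less t)
    show ?case
    proof (rule forcing_name.intros)
      fix z assume "z \<in> elts t"
      then obtain s p where s: "s \<in> elts N" "p \<in> elts P" "z = opair s p"
        using N(1) less(2) unfolding name_witness_def by blast
      then show "\<exists>s p. z = opair s p \<and> p \<in> elts P \<and> forcing_name P s"
        using less(1)[of s] opair_fst_below \<open>z \<in> elts t\<close> by blast
    qed
  qed
qed

lemma definable_forcing_name [definable_intros]:
  assumes "dterm V t"
  shows "definable V (\<lambda>e. forcing_name P (t e))"
proof (rule definable_cong)
  show "definable V (\<lambda>e. \<exists>N\<in>V. name_witness N \<and> t e \<in> elts N)"
    unfolding name_witness_def by (intro definable_intros assms[THEN dterm_rename] P_in)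
qed (use forcing_name_iff dterm_in[OF assms] in blast)

text \<open>Every name in \<open>D\<close> is paired with every condition, so that each of them
  contributes its value whatever \<open>G\<close> is.\<close>

lemma names_times:
  assumes D: "D \<in> V" "\<forall>s\<in>elts D. forcing_name P s"
  shows "forcing_name P (times D P)" "elts (val (times D P)) = val ` elts D"
proof -
  show "forcing_name P (times D P)"
    by (rule forcing_name.intros) (use D in \<open>auto simp: elts_times P_in\<close>)
  obtain p where "p \<in> G" using G_nonempty .
  then show "elts (val (times D P)) = val ` elts D" using D G_sub by (auto simp: elts_name_val P_in)
qed

subsection \<open>Forcing equality and membership\<close>

text \<open>The clause for forcing that \<open>\<sigma>\<close> is a subset of
  \<open>\<tau>\<close>. Forced equality of the subnames is the parameter \<open>E\<close>, so that
  the clause can be read both with the relation itself and with a set that approximates it.\<close>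

definition half :: "('a \<Rightarrow> 'a \<Rightarrow> 'a \<Rightarrow> bool) \<Rightarrow> 'a \<Rightarrow> 'a \<Rightarrow> 'a \<Rightarrow> bool" where
  "half E \<sigma> \<tau> p \<longleftrightarrow> (\<forall>\<rho>\<in>V. \<forall>q\<in>elts P. opair \<rho> q \<in> elts \<sigma> \<longrightarrow>
     (\<forall>r\<in>elts P. le r p \<and> le r q \<longrightarrow> (\<exists>s\<in>elts P. le s r \<and>
       (\<exists>\<pi>\<in>V. \<exists>q'\<in>elts P. opair \<pi> q' \<in> elts \<tau> \<and> le s q' \<and> E \<rho> \<pi> s))))"

text \<open>\<open>E\<close> is transposed in the second half, so its first argument is always a
  subname of \<open>\<sigma>\<close> and induction on \<open>\<sigma>\<close> alone handles both
  halves.\<close>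

definition eq_clause :: "('a \<Rightarrow> 'a \<Rightarrow> 'a \<Rightarrow> bool) \<Rightarrow> 'a \<Rightarrow> 'a \<Rightarrow> 'a \<Rightarrow> bool" where
  "eq_clause E \<sigma> \<tau> p \<longleftrightarrow> half E \<sigma> \<tau> p \<and> half (\<lambda>\<pi> \<rho>. E \<rho> \<pi>) \<tau> \<sigma> p"

text \<open>
  Forcing of equality is the largest relation satisfying the usual recursive clause; the recursion
  being well-founded, it is the only one. This avoids constructing recursive functions inside \<open>V\<close>.
\<close>

definition eq_witness :: "'a \<Rightarrow> bool" where
  "eq_witness W \<longleftrightarrow> (\<forall>z\<in>elts W. \<exists>\<sigma>\<in>V. \<exists>\<tau>\<in>V. \<exists>p\<in>elts P. z = opair \<sigma> (opair \<tau> p) \<and>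
     eq_clause (\<lambda>\<rho> \<pi> s. opair \<rho> (opair \<pi> s) \<in> elts W) \<sigma> \<tau> p)"

definition forces_eq :: "'a \<Rightarrow> 'a \<Rightarrow> 'a \<Rightarrow> bool" where
  "forces_eq \<sigma> \<tau> p \<longleftrightarrow> (\<exists>W\<in>V. eq_witness W \<and> opair \<sigma> (opair \<tau> p) \<in> elts W)"

definition forces_mem :: "'a \<Rightarrow> 'a \<Rightarrow> 'a \<Rightarrow> bool" where
  "forces_mem \<sigma> \<tau> p \<longleftrightarrow> (\<forall>r\<in>elts P. le r p \<longrightarrow> (\<exists>s\<in>elts P. le s r \<and>
     (\<exists>\<pi>\<in>V. \<exists>q\<in>elts P. opair \<pi> q \<in> elts \<tau> \<and> le s q \<and> forces_eq \<sigma> \<pi> s)))"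

lemma definable_forces_eq [definable_intros]:
  assumes "dterm V s" "dterm V t" "dterm V p"
  shows "definable V (\<lambda>e. forces_eq (s e) (t e) (p e))"
  unfolding forces_eq_def eq_witness_def eq_clause_def half_def
  by (intro definable_intros assms[THEN dterm_rename] P_in)

lemma definable_forces_mem [definable_intros]:
  assumes "dterm V s" "dterm V t" "dterm V p"
  shows "definable V (\<lambda>e. forces_mem (s e) (t e) (p e))"
  unfolding forces_mem_def by (intro definable_intros assms[THEN dterm_rename] P_in)

lemma half_mono:
  assumes "half E \<sigma> \<tau> p"
    and "\<And>\<rho> q \<pi> q' s. opair \<rho> q \<in> elts \<sigma> \<Longrightarrow> opair \<pi> q' \<in> elts \<tau> \<Longrightarrow> s \<in> elts P \<Longrightarrow> E \<rho> \<pi> s \<Longrightarrow> E' \<rho> \<pi> s"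
  shows "half E' \<sigma> \<tau> p" using assms unfolding half_def by meson

lemma eq_clause_mono:
  assumes "eq_clause E \<sigma> \<tau> p"
    and "\<And>\<rho> q \<pi> q' s. opair \<rho> q \<in> elts \<sigma> \<Longrightarrow> opair \<pi> q' \<in> elts \<tau> \<Longrightarrow> s \<in> elts P \<Longrightarrow> E \<rho> \<pi> s \<Longrightarrow> E' \<rho> \<pi> s"
  shows "eq_clause E' \<sigma> \<tau> p"
  using assms half_mono[of E \<sigma> \<tau> p E'] half_mono[of "\<lambda>\<pi> \<rho>. E \<rho> \<pi>" \<tau> \<sigma> p "\<lambda>\<pi> \<rho>. E' \<rho> \<pi>"]
  unfolding eq_clause_def by blast

text \<open>The clause is monotone in the relation. A triple that satisfies it can be joined to the
  set of all forced triples over a transitive set containing both names: the clause refers to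
  subnames only, and these stay in that set.\<close>

lemma forces_eq_unfold:
  assumes "\<sigma> \<in> V" "\<tau> \<in> V" "p \<in> elts P"
  shows "forces_eq \<sigma> \<tau> p \<longleftrightarrow> eq_clause forces_eq \<sigma> \<tau> p"
proof
  have unfold: "eq_clause forces_eq \<sigma> \<tau> p" if forces: "forces_eq \<sigma> \<tau> p" for \<sigma> \<tau> p
  proof -
    obtain W where W: "W \<in> V" "eq_witness W" "opair \<sigma> (opair \<tau> p) \<in> elts W"
      using forces unfolding forces_eq_def by blast
    have "eq_clause (\<lambda>\<rho> \<pi> s. opair \<rho> (opair \<pi> s) \<in> elts W) \<sigma> \<tau> p"
      using W(2)[unfolded eq_witness_def, THEN bspec, OF W(3)] by (auto simp: opair_eq_iff)
    then show ?thesis by (rule eq_clause_mono) (use W in \<open>auto simp: forces_eq_def\<close>)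
  qed
  show "eq_clause forces_eq \<sigma> \<tau> p" if "forces_eq \<sigma> \<tau> p" using unfold that .
  assume clause: "eq_clause forces_eq \<sigma> \<tau> p"
  obtain T where T: "T \<in> V" "opair \<sigma> \<tau> \<in> elts T" "tset T"
    using tset_exists[OF opair_in[OF assms(1,2)]] .
  have \<sigma>\<tau>: "\<sigma> \<in> elts T" "\<tau> \<in> elts T"
  proof -
    have "pairset \<sigma> \<tau> \<in> elts T"
      using T(2,3) unfolding tset_def opair_pairset by fastforce
    then show "\<sigma> \<in> elts T" "\<tau> \<in> elts T"
      using T(3) unfolding tset_def by fastforce+
  qed
  define W0 where "W0 = sep (times T (times T P))
    (\<lambda>z. \<exists>\<rho>\<in>V. \<exists>\<pi>\<in>V. \<exists>s\<in>V. z = opair \<rho> (opair \<pi> s) \<and> forces_eq \<rho> \<pi> s)"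
  have "W0 \<in> V" unfolding W0_def by (intro sep_in definable_intros times_in T P_in)
  have T_in: "x \<in> V" if "x \<in> elts T" for x using T(1) that transitive by blast
  have W0: "opair \<rho> (opair \<pi> s) \<in> elts W0 \<longleftrightarrow> \<rho> \<in> elts T \<and> \<pi> \<in> elts T \<and> s \<in> elts P \<and> forces_eq \<rho> \<pi> s"
    for \<rho> \<pi> s
    unfolding W0_def using T(1) T_in P_elem_in by (auto simp: times_in P_in opair_eq_iff)
  define W where "W = ins (opair \<sigma> (opair \<tau> p)) W0"
  have sub: "eq_clause (\<lambda>\<rho> \<pi> s. opair \<rho> (opair \<pi> s) \<in> elts W) \<sigma>' \<tau>' p'"
    if "eq_clause forces_eq \<sigma>' \<tau>' p'" "\<sigma>' \<in> elts T" "\<tau>' \<in> elts T" for \<sigma>' \<tau>' p'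
    using that(1)
  proof (rule eq_clause_mono)
    fix \<rho> q \<pi> q' s
    assume "opair \<rho> q \<in> elts \<sigma>'" "opair \<pi> q' \<in> elts \<tau>'" "s \<in> elts P" "forces_eq \<rho> \<pi> s"
    then show "opair \<rho> (opair \<pi> s) \<in> elts W"
      unfolding W_def elts_ins using W0 tset_opair[OF T(3)] that(2,3) by blast
  qed
  have "eq_witness W" unfolding eq_witness_def
  proof
    fix z assume z: "z \<in> elts W"
    show "\<exists>\<sigma>\<in>V. \<exists>\<tau>\<in>V. \<exists>p\<in>elts P. z = opair \<sigma> (opair \<tau> p) \<and>
     eq_clause (\<lambda>\<rho> \<pi> s. opair \<rho> (opair \<pi> s) \<in> elts W) \<sigma> \<tau> p"
    proof (cases "z = opair \<sigma> (opair \<tau> p)")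
      case True
      then show ?thesis using sub[OF clause \<sigma>\<tau>] assms by blast
    next
      case False
      then have "z \<in> elts W0" using z unfolding W_def by simp
      moreover from this obtain \<rho> \<pi> s where "z = opair \<rho> (opair \<pi> s)"
        unfolding W0_def elts_sep by blast
      ultimately show ?thesis using sub[OF unfold] W0 T_in by blast
    qed
  qed
  moreover have "W \<in> V" unfolding W_def using \<open>W0 \<in> V\<close> assms P_elem_in by blast
  ultimately show "forces_eq \<sigma> \<tau> p" unfolding forces_eq_def W_def by auto
qed

lemma half_le: "half E \<sigma> \<tau> p \<Longrightarrow> le q p \<Longrightarrow> half E \<sigma> \<tau> q"
  unfolding half_def using le_trans by meson

lemma half_dense:
  assumes "\<And>r. le r p \<Longrightarrow> \<exists>s. le s r \<and> half E \<sigma> \<tau> s"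
  shows "half E \<sigma> \<tau> p" unfolding half_def
proof (intro ballI impI)
  fix \<rho> q r assume \<rho>: "\<rho> \<in> V" "q \<in> elts P" "opair \<rho> q \<in> elts \<sigma>" and r: "le r p \<and> le r q"
  obtain s where s: "le s r" "half E \<sigma> \<tau> s" using assms r by blast
  then have "s \<in> elts P" "le s s" "le s q" using le_in le_refl le_trans r by blast+
  then have "\<exists>s'\<in>elts P. le s' s \<and> (\<exists>\<pi>\<in>V. \<exists>q'\<in>elts P. opair \<pi> q' \<in> elts \<tau> \<and> le s' q' \<and> E \<rho> \<pi> s')"
    using s(2) \<rho> unfolding half_def by blast
  then show "\<exists>s\<in>elts P. le s r \<and> (\<exists>\<pi>\<in>V. \<exists>q'\<in>elts P. opair \<pi> q' \<in> elts \<tau> \<and> le s q' \<and> E \<rho> \<pi> s)"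
    using le_trans s(1) by blast
qed

lemma forces_eq_le:
  assumes "\<sigma> \<in> V" "\<tau> \<in> V" "forces_eq \<sigma> \<tau> p" "le q p"
  shows "forces_eq \<sigma> \<tau> q"
  using assms forces_eq_unfold[OF assms(1,2)] le_in[OF assms(4)] half_le unfolding eq_clause_def by blast

lemma forces_eq_dense:
  assumes "\<sigma> \<in> V" "\<tau> \<in> V" "p \<in> elts P" "\<And>r. le r p \<Longrightarrow> \<exists>s. le s r \<and> forces_eq \<sigma> \<tau> s"
  shows "forces_eq \<sigma> \<tau> p"
proof -
  have "\<exists>s. le s r \<and> eq_clause forces_eq \<sigma> \<tau> s" if r: "le r p" for r
    using assms(4)[OF r] forces_eq_unfold[OF assms(1,2)] le_in(1) by blast
  then show ?thesis unfolding forces_eq_unfold[OF assms(1-3)] eq_clause_def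
    by (intro conjI half_dense) blast+
qed

lemma forces_mem_le: "forces_mem \<sigma> \<tau> p \<Longrightarrow> le q p \<Longrightarrow> forces_mem \<sigma> \<tau> q"
  unfolding forces_mem_def using le_trans by blast

lemma forces_mem_dense:
  assumes "\<And>r. le r p \<Longrightarrow> \<exists>s. le s r \<and> forces_mem \<sigma> \<tau> s"
  shows "forces_mem \<sigma> \<tau> p" unfolding forces_mem_def
proof (intro ballI impI)
  fix r assume "le r p"
  then obtain s where s: "le s r" "forces_mem \<sigma> \<tau> s" using assms by blast
  then obtain s' where "s' \<in> elts P" "le s' s"
    "\<exists>\<pi>\<in>V. \<exists>q\<in>elts P. opair \<pi> q \<in> elts \<tau> \<and> le s' q \<and> forces_eq \<sigma> \<pi> s'"
    using le_refl[OF le_in(1)[OF s(1)]] le_in(1)[OF s(1)] unfolding forces_mem_def by blast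
  then show "\<exists>s\<in>elts P. le s r \<and> (\<exists>\<pi>\<in>V. \<exists>q\<in>elts P. opair \<pi> q \<in> elts \<tau> \<and> le s q \<and> forces_eq \<sigma> \<pi> s)"
    using le_trans[OF _ s(1)] by blast
qed

lemma in_valE:
  assumes "x \<in> elts (val t)"
  obtains s p where "x = val s" "p \<in> G" "opair s p \<in> elts t"
  using assms unfolding elts_name_val by blast

lemma in_valI: "p \<in> G \<Longrightarrow> opair s p \<in> elts t \<Longrightarrow> val s \<in> elts (val t)"
  unfolding elts_name_val by blast

lemma opair_sub_in:
  assumes "t \<in> V" "opair s p \<in> elts t"
  shows "s \<in> V" using opair_inD(1) transitive[OF assms] .

text \<open>Stated for a relation \<open>E\<close> so that it can be applied to both inclusions
  behind an equality, once with forced equality and once with its transpose.\<close>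

lemma half_truth:
  assumes \<sigma>: "\<sigma> \<in> V" and \<tau>: "\<tau> \<in> V"
    and E: "\<And>i j k. definable V (\<lambda>e. E (e i) (e j) (e k))"
    and E_le: "\<And>\<rho> \<pi> s s'. \<rho> \<in> V \<Longrightarrow> \<pi> \<in> V \<Longrightarrow> E \<rho> \<pi> s \<Longrightarrow> le s' s \<Longrightarrow> E \<rho> \<pi> s'"
    and E_truth: "\<And>\<rho> q \<pi> q'. opair \<rho> q \<in> elts \<sigma> \<Longrightarrow> opair \<pi> q' \<in> elts \<tau> \<Longrightarrow>
      val \<rho> = val \<pi> \<longleftrightarrow> (\<exists>p\<in>G. E \<rho> \<pi> p)"
  shows "elts (val \<sigma>) \<subseteq> elts (val \<tau>) \<longleftrightarrow> (\<exists>p\<in>G. half E \<sigma> \<tau> p)"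
proof
  have E_const: "definable V (\<lambda>e. E c (e j) (e k))" if "c \<in> V" for c j k
    by (rule definable_dterm[OF dterm_const[OF that], where Q = "\<lambda>x e. E x (e j) (e k)"]) (rule E)
  assume "\<exists>p\<in>G. half E \<sigma> \<tau> p"
  then obtain p where p: "p \<in> G" "half E \<sigma> \<tau> p" by blast
  show "elts (val \<sigma>) \<subseteq> elts (val \<tau>)"
  proof
    fix x assume "x \<in> elts (val \<sigma>)"
    then obtain \<rho> q where \<rho>: "x = val \<rho>" "q \<in> G" "opair \<rho> q \<in> elts \<sigma>"
      by (rule in_valE)
    have "\<rho> \<in> V" using opair_sub_in[OF \<sigma> \<rho>(3)] .
    obtain r where r: "r \<in> G" "le r p" "le r q" using G_directed[OF p(1) \<rho>(2)] .
    obtain s where s: "s \<in> G" "\<exists>\<pi>\<in>V. \<exists>q'\<in>elts P. opair \<pi> q' \<in> elts \<tau> \<and> le s q' \<and> E \<rho> \<pi> s"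
    proof (rule generic_meets[OF _ r(1)])
      show "definable V (\<lambda>e. \<exists>\<pi>\<in>V. \<exists>q'\<in>elts P. opair \<pi> q' \<in> elts \<tau> \<and> le (e 0) q' \<and> E \<rho> \<pi> (e 0))"
        by (intro definable_intros P_in \<tau> E_const \<open>\<rho> \<in> V\<close>)
      fix p' assume p': "le p' r"
      then have "le p' p" "le p' q" "p' \<in> elts P" using r le_trans le_in by blast+
      then show "\<exists>s. le s p' \<and> (\<exists>\<pi>\<in>V. \<exists>q'\<in>elts P. opair \<pi> q' \<in> elts \<tau> \<and> le s q' \<and> E \<rho> \<pi> s)"
        using p(2) \<rho>(3) \<open>\<rho> \<in> V\<close> G_sub[OF \<rho>(2)] unfolding half_def by blast
    qed blast
    then obtain \<pi> q' where \<pi>: "opair \<pi> q' \<in> elts \<tau>" "le s q'" "E \<rho> \<pi> s"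
      by blast
    then have "val \<rho> = val \<pi>" using E_truth[OF \<rho>(3) \<pi>(1)] s(1) by blast
    then show "x \<in> elts (val \<tau>)"
      using in_valI[OF G_up[OF s(1) \<pi>(2)] \<pi>(1)] \<rho>(1) by simp
  qed
next
  assume sub: "elts (val \<sigma>) \<subseteq> elts (val \<tau>)"
  \<comment> \<open>\<open>miss \<rho> p\<close> says that no extension of \<open>p\<close> puts
    \<open>\<rho>\<close> into \<open>\<tau>\<close>. If \<open>p\<close> violates the clause for
    inclusion, some extension of it lies below the condition of a subname \<open>\<rho>\<close> of
    \<open>\<sigma>\<close> and misses \<open>\<tau>\<close>, so a generic filter contains a
    condition of one of the two kinds.\<close>
  define miss where "miss \<rho> p \<longleftrightarrow> (\<forall>s\<in>elts P. le s p \<longrightarrow>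
    \<not> (\<exists>\<pi>\<in>V. \<exists>q'\<in>elts P. opair \<pi> q' \<in> elts \<tau> \<and> le s q' \<and> E \<rho> \<pi> s))" for \<rho> p
  obtain r where "r \<in> G" using G_nonempty .
  then obtain p where p: "p \<in> G" "half E \<sigma> \<tau> p \<or>
    (\<exists>\<rho>\<in>V. \<exists>q\<in>elts P. opair \<rho> q \<in> elts \<sigma> \<and> le p q \<and> miss \<rho> p)"
  proof (rule generic_meets[rotated])
    show "definable V (\<lambda>e. half E \<sigma> \<tau> (e 0) \<or>
        (\<exists>\<rho>\<in>V. \<exists>q\<in>elts P. opair \<rho> q \<in> elts \<sigma> \<and> le (e 0) q \<and> miss \<rho> (e 0)))"
      unfolding half_def miss_def by (intro definable_intros P_in \<sigma> \<tau> E)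
    fix p assume "le p r"
    show "\<exists>q. le q p \<and> (half E \<sigma> \<tau> q \<or>
        (\<exists>\<rho>\<in>V. \<exists>q'\<in>elts P. opair \<rho> q' \<in> elts \<sigma> \<and> le q q' \<and> miss \<rho> q))"
    proof (cases "half E \<sigma> \<tau> p")
      case True
      then show ?thesis using le_refl le_in(1)[OF \<open>le p r\<close>] by blast
    next
      case False
      then show ?thesis unfolding half_def miss_def by blast
    qed
  qed blast
  have "\<not> miss \<rho> p" if \<rho>: "opair \<rho> q \<in> elts \<sigma>" "le p q" for \<rho> q
  proof
    assume miss: "miss \<rho> p"
    have "val \<rho> \<in> elts (val \<tau>)"
      using in_valI[OF G_up[OF p(1) \<rho>(2)] \<rho>(1)] sub by blast
    then obtain \<pi> q' where \<pi>: "val \<rho> = val \<pi>" "q' \<in> G" "opair \<pi> q' \<in> elts \<tau>"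
      by (rule in_valE)
    then obtain p1 where p1: "p1 \<in> G" "E \<rho> \<pi> p1"
      using E_truth[OF \<rho>(1) \<pi>(3)] by blast
    obtain s' where s': "s' \<in> G" "le s' p" "le s' q'" using G_directed[OF p(1) \<pi>(2)] .
    obtain s where s: "s \<in> G" "le s s'" "le s p1" using G_directed[OF s'(1) p1(1)] .
    have "E \<rho> \<pi> s"
      using E_le[OF opair_sub_in[OF \<sigma> \<rho>(1)] opair_sub_in[OF \<tau> \<pi>(3)] p1(2) s(3)] .
    moreover have "le s p" "le s q'" using le_trans s(2) s' by blast+
    ultimately show False
      using miss \<pi>(3) G_sub s(1) \<pi>(2) opair_sub_in[OF \<tau> \<pi>(3)] unfolding miss_def by blast
  qed
  then show "\<exists>p\<in>G. half E \<sigma> \<tau> p" using p by blast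
qed

lemma forces_eq_truth:
  assumes "\<sigma> \<in> V" "\<tau> \<in> V"
  shows "val \<sigma> = val \<tau> \<longleftrightarrow> (\<exists>p\<in>G. forces_eq \<sigma> \<tau> p)"
  using wf_trancl_elts assms
proof (induction \<sigma> arbitrary: \<tau> rule: wf_induct_rule)
  case (less \<sigma>)
  have IH: "val \<rho> = val \<pi> \<longleftrightarrow> (\<exists>p\<in>G. forces_eq \<rho> \<pi> p)"
    if "opair \<rho> q \<in> elts \<sigma>" "opair \<pi> q' \<in> elts \<tau>" for \<rho> q \<pi> q'
    using less.IH[of \<rho> \<pi>] opair_fst_below[OF that(1)] opair_sub_in[OF less.prems(1) that(1)]
      opair_sub_in[OF less.prems(2) that(2)] by blast
  have 1: "elts (val \<sigma>) \<subseteq> elts (val \<tau>) \<longleftrightarrow> (\<exists>p\<in>G. half forces_eq \<sigma> \<tau> p)"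
  proof (rule half_truth[OF less.prems])
    show "definable V (\<lambda>e. forces_eq (e i) (e j) (e k))" for i j k
      by (intro definable_intros)
  qed (use forces_eq_le IH in blast)+
  have 2: "elts (val \<tau>) \<subseteq> elts (val \<sigma>) \<longleftrightarrow> (\<exists>p\<in>G. half (\<lambda>\<pi> \<rho>. forces_eq \<rho> \<pi>) \<tau> \<sigma> p)"
  proof (rule half_truth[OF less.prems(2,1)])
    show "definable V (\<lambda>e. forces_eq (e j) (e i) (e k))" for i j k
      by (intro definable_intros)
    show "val \<pi> = val \<rho> \<longleftrightarrow> (\<exists>p\<in>G. forces_eq \<rho> \<pi> p)"
      if "opair \<pi> q' \<in> elts \<tau>" "opair \<rho> q \<in> elts \<sigma>" for \<rho> q \<pi> q'
      using IH[OF that(2,1)] by (simp add: eq_commute)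
  qed (use forces_eq_le in blast)
  have "val \<sigma> = val \<tau> \<longleftrightarrow> elts (val \<sigma>) \<subseteq> elts (val \<tau>) \<and> elts (val \<tau>) \<subseteq> elts (val \<sigma>)"
    using elts_ext[of "val \<sigma>" "val \<tau>"] by (auto simp: set_eq_subset)
  also have "\<dots> \<longleftrightarrow> (\<exists>p\<in>G. eq_clause forces_eq \<sigma> \<tau> p)"
    unfolding 1 2 eq_clause_def
  proof
    assume "(\<exists>p\<in>G. half forces_eq \<sigma> \<tau> p) \<and> (\<exists>p\<in>G. half (\<lambda>\<pi> \<rho>. forces_eq \<rho> \<pi>) \<tau> \<sigma> p)"
    then obtain p q where pq: "p \<in> G" "q \<in> G" "half forces_eq \<sigma> \<tau> p"
      "half (\<lambda>\<pi> \<rho>. forces_eq \<rho> \<pi>) \<tau> \<sigma> q" by blast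
    obtain r where "r \<in> G" "le r p" "le r q" using G_directed[OF pq(1,2)] .
    then show "\<exists>p\<in>G. half forces_eq \<sigma> \<tau> p \<and> half (\<lambda>\<pi> \<rho>. forces_eq \<rho> \<pi>) \<tau> \<sigma> p"
      using half_le[OF pq(3)] half_le[OF pq(4)] by blast
  qed blast
  also have "\<dots> \<longleftrightarrow> (\<exists>p\<in>G. forces_eq \<sigma> \<tau> p)"
    using forces_eq_unfold[OF less.prems] G_sub by blast
  finally show ?case .
qed

lemma forces_mem_truth:
  assumes \<sigma>: "\<sigma> \<in> V" and \<tau>: "\<tau> \<in> V"
  shows "val \<sigma> \<in> elts (val \<tau>) \<longleftrightarrow> (\<exists>p\<in>G. forces_mem \<sigma> \<tau> p)"
proof
  define hit where "hit s \<longleftrightarrow> (\<exists>\<pi>\<in>V. \<exists>q\<in>elts P. opair \<pi> q \<in> elts \<tau> \<and> le s q \<and> forces_eq \<sigma> \<pi> s)" for s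
  have hit: "definable V (\<lambda>e. hit (e i))" for i
    unfolding hit_def by (intro definable_intros P_in \<sigma> \<tau>)
  have forces_mem: "forces_mem \<sigma> \<tau> p \<longleftrightarrow> (\<forall>r. le r p \<longrightarrow> (\<exists>s. le s r \<and> hit s))" for p
    unfolding forces_mem_def hit_def using le_in by blast
  {
    assume "\<exists>p\<in>G. forces_mem \<sigma> \<tau> p"
    then obtain p where p: "p \<in> G" "forces_mem \<sigma> \<tau> p" by blast
    obtain s where s: "s \<in> G" "hit s"
      using generic_meets[OF hit p(1)] p(2) unfolding forces_mem by metis
    then obtain \<pi> q where \<pi>: "\<pi> \<in> V" "opair \<pi> q \<in> elts \<tau>" "le s q" "forces_eq \<sigma> \<pi> s"
      unfolding hit_def by blast
    then have "val \<sigma> = val \<pi>" using forces_eq_truth[OF \<sigma>] s(1) by blast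
    then show "val \<sigma> \<in> elts (val \<tau>)"
      using in_valI[OF G_up[OF s(1) \<pi>(3)] \<pi>(2)] by simp
  next
    assume "val \<sigma> \<in> elts (val \<tau>)"
    then obtain \<pi> q where \<pi>: "val \<sigma> = val \<pi>" "q \<in> G" "opair \<pi> q \<in> elts \<tau>"
      by (rule in_valE)
    have "\<pi> \<in> V" using opair_sub_in[OF \<tau> \<pi>(3)] .
    then obtain p1 where p1: "p1 \<in> G" "forces_eq \<sigma> \<pi> p1"
      using forces_eq_truth[OF \<sigma>] \<pi>(1) by blast
    obtain p where p: "p \<in> G" "le p p1" "le p q" using G_directed[OF p1(1) \<pi>(2)] .
    have "hit r" if "le r p" for r
    proof -
      have "forces_eq \<sigma> \<pi> r" "le r q"
        using forces_eq_le[OF \<sigma> \<open>\<pi> \<in> V\<close> p1(2)] le_trans[OF that] p by blast+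
      then show ?thesis
        unfolding hit_def using \<open>\<pi> \<in> V\<close> \<pi>(3) le_in(2) by blast
    qed
    then have "forces_mem \<sigma> \<tau> p" unfolding forces_mem using le_refl le_in(1) by blast
    then show "\<exists>p\<in>G. forces_mem \<sigma> \<tau> p" using p(1) by blast
  }
qed


subsection \<open>Forcing of formulas\<close>

primrec forces :: "fm \<Rightarrow> (nat \<Rightarrow> 'a) \<Rightarrow> 'a \<Rightarrow> bool" where
  "forces (Mem i j) e p \<longleftrightarrow> forces_mem (e i) (e j) p"
| "forces (Eq i j) e p \<longleftrightarrow> forces_eq (e i) (e j) p"
| "forces (Neg \<phi>) e p \<longleftrightarrow> (\<forall>q\<in>elts P. le q p \<longrightarrow> \<not> forces \<phi> e q)"
| "forces (Conj \<phi> \<psi>) e p \<longleftrightarrow> forces \<phi> e p \<and> forces \<psi> e p"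
| "forces (All \<phi>) e p \<longleftrightarrow> (\<forall>x\<in>V. forcing_name P x \<longrightarrow> forces \<phi> (case_nat x e) p)"

text \<open>Recursion on the formula takes place outside: each single formula has a definable
  forcing relation, with the condition at entry \<open>0\<close> and the names behind it.\<close>

lemma definable_forces_aux: "definable V (\<lambda>e. forces \<phi> (\<lambda>n. e (Suc n)) (e 0))"
proof (induction \<phi>)
  case (Neg \<phi>)
  have "definable V (\<lambda>e. forces \<phi> (\<lambda>n. e (Suc (Suc n))) (e 0))"
    using definable_rename[OF Neg, of "case_nat 0 (\<lambda>n. Suc (Suc n))"] by simp
  then show ?case unfolding forces.simps by (intro definable_intros P_in)
next
  case (All \<phi>)
  have "definable V (\<lambda>e. forces \<phi> (case_nat (e 0) (\<lambda>n. e (Suc (Suc n)))) (e (Suc 0)))"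
  proof -
    have eq: "(\<lambda>n. e (case_nat (Suc 0) (case_nat 0 (\<lambda>n. Suc (Suc n))) (Suc n)))
      = case_nat (e 0) (\<lambda>n. e (Suc (Suc n)))" for e :: "nat \<Rightarrow> 'a"
      by (auto split: nat.split)
    show ?thesis
      using definable_rename[OF All, of "case_nat (Suc 0) (case_nat 0 (\<lambda>n. Suc (Suc n)))"]
      unfolding eq by simp
  qed
  then show ?case unfolding forces.simps by (intro definable_intros)
qed (unfold forces.simps, (intro definable_intros; assumption)+)

lemma definable_forces:
  assumes "range e0 \<subseteq> V"
  shows "definable V (\<lambda>e. forces \<phi> e0 (e i))"
    and "definable V (\<lambda>e. forces \<phi> (case_nat (e j) e0) (e i))"
proof -
  have "definable V (\<lambda>e. (\<lambda>e. forces \<phi> (\<lambda>n. e (Suc n)) (e 0))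
      (\<lambda>n. case_sum id e (case_nat (Inr i) (\<lambda>n. Inl (e0 n)) n)))"
    by (rule definable_subst[OF definable_forces_aux]) (use assms in \<open>auto split: nat.splits\<close>)
  then show "definable V (\<lambda>e. forces \<phi> e0 (e i))" by simp
  have "definable V (\<lambda>e. (\<lambda>e. forces \<phi> (\<lambda>n. e (Suc n)) (e 0))
      (\<lambda>n. case_sum id e (case_nat (Inr i) (case_nat (Inr j) (\<lambda>n. Inl (e0 n))) n)))"
    by (rule definable_subst[OF definable_forces_aux]) (use assms in \<open>auto split: nat.splits\<close>)
  moreover have "(\<lambda>n. case_sum id e (case_nat (Inr j) (\<lambda>n. Inl (e0 n)) n)) = case_nat (e j) e0" for e
    by (auto split: nat.split)
  ultimately show "definable V (\<lambda>e. forces \<phi> (case_nat (e j) e0) (e i))" by simp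
qed

lemma range_case_nat: "range e \<subseteq> X \<Longrightarrow> x \<in> X \<Longrightarrow> range (case_nat x e) \<subseteq> X"
  by (fastforce split: nat.split)

lemma forces_le:
  assumes "range e \<subseteq> V" "forces \<phi> e p" "le q p"
  shows "forces \<phi> e q" using assms
proof (induction \<phi> arbitrary: e p q)
  case (Mem i j)
  then show ?case using forces_mem_le by simp
next
  case (Eq i j)
  then show ?case using forces_eq_le[of "e i" "e j" p q] by (auto simp: image_subset_iff)
next
  case (Neg \<phi>)
  then show ?case using le_trans by auto
next
  case (All \<phi>)
  show ?case unfolding forces.simps
  proof (intro ballI impI)
    fix x assume x: "x \<in> V" "forcing_name P x"
    then have "forces \<phi> (case_nat x e) p" using All.prems(2) by simp
    then show "forces \<phi> (case_nat x e) q"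
      using All.IH[OF range_case_nat[OF All.prems(1) x(1)]] All.prems(3) by blast
  qed
qed auto

lemma forces_dense:
  assumes "range e \<subseteq> V" "p \<in> elts P" "\<And>r. le r p \<Longrightarrow> \<exists>s. le s r \<and> forces \<phi> e s"
  shows "forces \<phi> e p" using assms
proof (induction \<phi> arbitrary: e)
  case (Mem i j)
  then show ?case using forces_mem_dense by simp
next
  case (Eq i j)
  then show ?case using forces_eq_dense[of "e i" "e j" p] by auto
next
  case (Neg \<phi>)
  show ?case unfolding forces.simps
  proof (intro ballI impI notI)
    fix q assume q: "le q p" "forces \<phi> e q"
    then obtain s where s: "le s q" "forces (Neg \<phi>) e s" using Neg.prems(3) by blast
    have "s \<in> elts P" using le_in(1)[OF s(1)] .
    then show False using forces_le[OF Neg.prems(1) q(2) s(1)] s(2) le_refl by simp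
  qed
next
  case (Conj \<phi> \<psi>)
  show ?case unfolding forces.simps
  proof
    show "forces \<phi> e p" by (rule Conj.IH(1)[OF Conj.prems(1,2)]) (use Conj.prems(3) in auto)
    show "forces \<psi> e p" by (rule Conj.IH(2)[OF Conj.prems(1,2)]) (use Conj.prems(3) in auto)
  qed
next
  case (All \<phi>)
  show ?case unfolding forces.simps
  proof (intro ballI impI)
    fix x assume x: "x \<in> V" "forcing_name P x"
    show "forces \<phi> (case_nat x e) p"
      by (rule All.IH[OF range_case_nat[OF All.prems(1) x(1)] All.prems(2)])
        (use All.prems(3) x in auto)
  qed
qed

abbreviation VG :: "'a set" where
  "VG \<equiv> generic_extension V P G"

lemma in_VGE:
  assumes "x \<in> VG"
  obtains t where "t \<in> V" "forcing_name P t" "x = val t"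
  using assms unfolding generic_extension_def by blast

lemma val_in_VG: "t \<in> V \<Longrightarrow> forcing_name P t \<Longrightarrow> val t \<in> VG"
  unfolding generic_extension_def by blast

text \<open>The environment may consist of arbitrary elements of \<open>V\<close>, since
  \<open>name_val\<close> evaluates every set; names matter for the quantifier, whose range is
  \<open>V[G]\<close>. The cases of negation and quantification use that deciding conditions are
  dense.\<close>

theorem forcing_theorem:
  assumes "range e \<subseteq> V"
  shows "sat VG (\<lambda>n. val (e n)) \<phi> \<longleftrightarrow> (\<exists>p\<in>G. forces \<phi> e p)"
  using assms
proof (induction \<phi> arbitrary: e)
  case (Mem i j)
  then show ?case using forces_mem_truth[of "e i" "e j"] by auto
next
  case (Eq i j)
  then show ?case using forces_eq_truth[of "e i" "e j"] by auto
next
  case (Neg \<phi>)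
  obtain r where r: "r \<in> G" using G_nonempty .
  obtain p where p: "p \<in> G" "forces \<phi> e p \<or> forces (Neg \<phi>) e p"
  proof (rule generic_meets[OF _ r])
    show "definable V (\<lambda>e'. forces \<phi> e (e' 0) \<or> forces (Neg \<phi>) e (e' 0))"
      by (intro definable_disj definable_forces Neg.prems)
    show "\<exists>q. le q p \<and> (forces \<phi> e q \<or> forces (Neg \<phi>) e q)" if "le p r" for p
      using le_refl le_in(1)[OF that] unfolding forces.simps by blast
  qed blast
  have "\<not> (forces \<phi> e q \<and> forces (Neg \<phi>) e q')" if qs: "q \<in> G" "q' \<in> G" for q q'
  proof
    assume forces: "forces \<phi> e q \<and> forces (Neg \<phi>) e q'"
    obtain s where s: "s \<in> G" "le s q" "le s q'" using G_directed[OF qs] .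
    then have "forces \<phi> e s" using forces_le[OF Neg.prems] forces by blast
    then show False using forces s(3) G_sub[OF s(1)] by simp
  qed
  then show ?case using Neg.IH[OF Neg.prems] p by auto
next
  case (Conj \<phi> \<psi>)
  show ?case
  proof
    assume "sat VG (\<lambda>n. val (e n)) (Conj \<phi> \<psi>)"
    then obtain p q where pq: "p \<in> G" "q \<in> G" "forces \<phi> e p" "forces \<psi> e q"
      using Conj.IH[OF Conj.prems] by auto
    obtain r where "r \<in> G" "le r p" "le r q" using G_directed[OF pq(1,2)] .
    then show "\<exists>p\<in>G. forces (Conj \<phi> \<psi>) e p"
      using forces_le[OF Conj.prems pq(3)] forces_le[OF Conj.prems pq(4)] by auto
  qed (use Conj.IH[OF Conj.prems] in auto)
next
  case (All \<phi>)
  have IH: "sat VG (case_nat (val x) (\<lambda>n. val (e n))) \<phi> \<longleftrightarrow> (\<exists>p\<in>G. forces \<phi> (case_nat x e) p)"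
    if "x \<in> V" for x
  proof -
    have "(\<lambda>n. val (case_nat x e n)) = case_nat (val x) (\<lambda>n. val (e n))"
      by (auto split: nat.split)
    then show ?thesis using All.IH[OF range_case_nat[OF All.prems that]] by simp
  qed
  show ?case
  proof
    assume "\<exists>p\<in>G. forces (All \<phi>) e p"
    then obtain p where p: "p \<in> G" "forces (All \<phi>) e p" by blast
    show "sat VG (\<lambda>n. val (e n)) (All \<phi>)" unfolding sat.simps
    proof
      fix x assume "x \<in> VG"
      then obtain t where "t \<in> V" "forcing_name P t" "x = val t" by (rule in_VGE)
      then show "sat VG (case_nat x (\<lambda>n. val (e n))) \<phi>" using IH p by auto
    qed
  next
    assume sat: "sat VG (\<lambda>n. val (e n)) (All \<phi>)"
    obtain r where r: "r \<in> G" using G_nonempty .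
    \<comment> \<open>Some condition in \<open>G\<close> forces either the universal statement or a
      counterexample with a name in \<open>V\<close>.\<close>
    obtain p where p: "p \<in> G" "forces (All \<phi>) e p \<or>
      (\<exists>x\<in>V. forcing_name P x \<and> forces (Neg \<phi>) (case_nat x e) p)"
    proof (rule generic_meets[OF _ r])
      show "definable V (\<lambda>e'. forces (All \<phi>) e (e' 0) \<or>
          (\<exists>x\<in>V. forcing_name P x \<and> forces (Neg \<phi>) (case_nat x e) (e' 0)))"
        by (intro definable_disj definable_bex_model definable_conj definable_forces
            definable_forcing_name dterm_var All.prems)
      fix p assume "le p r"
      then have p: "p \<in> elts P" using le_in by blast
      show "\<exists>q. le q p \<and> (forces (All \<phi>) e q \<or>
          (\<exists>x\<in>V. forcing_name P x \<and> forces (Neg \<phi>) (case_nat x e) q))"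
      proof (cases "forces (All \<phi>) e p")
        case True
        then show ?thesis using le_refl p by blast
      next
        case False
        then obtain x where x: "x \<in> V" "forcing_name P x" "\<not> forces \<phi> (case_nat x e) p"
          by auto
        then obtain q where q: "le q p" "\<And>s. le s q \<Longrightarrow> \<not> forces \<phi> (case_nat x e) s"
          using forces_dense[OF range_case_nat[OF All.prems x(1)] p, of \<phi>] by blast
        then have "forces (Neg \<phi>) (case_nat x e) q" by simp
        then show ?thesis using q(1) x by blast
      qed
    qed blast
    have "\<not> forces (Neg \<phi>) (case_nat x e) p" if x: "x \<in> V" "forcing_name P x" for x
    proof
      assume neg: "forces (Neg \<phi>) (case_nat x e) p"
      obtain q where q: "q \<in> G" "forces \<phi> (case_nat x e) q"
        using IH[OF x(1)] sat val_in_VG[OF x] by auto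
      obtain s where s: "s \<in> G" "le s p" "le s q" using G_directed[OF p(1) q(1)] .
      then have "forces \<phi> (case_nat x e) s"
        using forces_le[OF range_case_nat[OF All.prems x(1)] q(2)] by blast
      then show False using neg s(2) G_sub[OF s(1)] by simp
    qed
    then show "\<exists>p\<in>G. forces (All \<phi>) e p" using p by blast
  qed
qed

subsection \<open>The generic extension as a model of Zermelo set theory\<close>

definition subnames :: "'a \<Rightarrow> 'a" where
  "subnames t = sep (Unions (Unions t)) (forcing_name P)"

lemma subnames_in [intro]: "t \<in> V \<Longrightarrow> subnames t \<in> V"
  unfolding subnames_def by (intro sep_in Unions_in definable_intros)

lemma subnamesD: "\<forall>s\<in>elts (subnames t). forcing_name P s" unfolding subnames_def by simp

lemma elts_val_subnames:
  assumes "forcing_name P t" "x \<in> elts (val t)"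
  obtains s where "s \<in> elts (subnames t)" "x = val s"
proof -
  obtain s p where s: "x = val s" "p \<in> G" "opair s p \<in> elts t"
    using assms(2) by (rule in_valE)
  then have "s \<in> elts (subnames t)"
    unfolding subnames_def using forcing_nameD[OF assms(1)] opair_in_UnionsD(1)[OF s(3)] by simp
  then show thesis using that s(1) by blast
qed

lemma VG_transitive:
  assumes "x \<in> VG" "y \<in> elts x"
  shows "y \<in> VG"
proof -
  obtain t where t: "t \<in> V" "forcing_name P t" "x = val t" using in_VGE[OF assms(1)] .
  obtain s p where s: "y = val s" "opair s p \<in> elts t"
    using assms(2) unfolding t(3) by (rule in_valE)
  then show ?thesis
    using val_in_VG[OF opair_sub_in[OF t(1) s(2)] forcing_nameD(1)[OF t(2) s(2)]] by simp
qed

text \<open>The general form of a name for a subset: a name \<open>s\<close> from \<open>D\<close>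
  is paired with the conditions \<open>p\<close> for which \<open>Q s p\<close> holds. With a
  forcing relation for \<open>Q\<close>, the value is a subset defined in the extension; separation
  and power sets both use this.\<close>

lemma subname_val:
  assumes D: "D \<in> V" "\<forall>s\<in>elts D. forcing_name P s"
    and Q: "definable V (\<lambda>e. Q (e 0) (e (Suc 0)))"
  defines "u \<equiv> sep (times D P) (\<lambda>z. \<exists>s\<in>elts D. \<exists>p\<in>elts P. z = opair s p \<and> Q s p)"
  shows "u \<in> V" "forcing_name P u" "elts u \<subseteq> elts (times D P)"
    and "elts (val u) = {val s | s. s \<in> elts D \<and> (\<exists>p\<in>G. Q s p)}"
proof -
  have "definable V (\<lambda>e. Q (e (Suc 0)) (e 0))"
    using definable_rename[OF Q, of "case_nat (Suc 0) (\<lambda>_. 0)"] by simp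
  then show "u \<in> V" unfolding u_def by (intro sep_in definable_intros times_in D P_in)
  show "forcing_name P u" by (rule forcing_name.intros) (use D in \<open>auto simp: u_def\<close>)
  show "elts u \<subseteq> elts (times D P)" unfolding u_def by auto
  have "opair s p \<in> elts u \<longleftrightarrow> s \<in> elts D \<and> p \<in> elts P \<and> Q s p" for s p
    unfolding u_def using D P_in by (auto simp: opair_eq_iff)
  then show "elts (val u) = {val s | s. s \<in> elts D \<and> (\<exists>p\<in>G. Q s p)}"
    by (simp add: elts_name_val) (use G_sub in blast)
qed

lemma env_names:
  assumes "range e \<subseteq> VG"
  obtains e' where "range e' \<subseteq> V" "\<And>n. forcing_name P (e' n)" "e = (\<lambda>n. val (e' n))"
proof -
  have "\<forall>n. \<exists>t. t \<in> V \<and> forcing_name P t \<and> e n = val t"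
    using assms unfolding generic_extension_def by blast
  then obtain e' where "\<And>n. e' n \<in> V \<and> forcing_name P (e' n) \<and> e n = val (e' n)"
    by metis
  then show thesis using that[of e'] by auto
qed

lemma VG_separation:
  assumes e: "range e \<subseteq> VG" and x: "x \<in> VG"
  shows "sep x (\<lambda>w. sat VG (case_nat w e) \<phi>) \<in> VG"
proof -
  obtain t where t: "t \<in> V" "forcing_name P t" "x = val t" using in_VGE[OF x] .
  obtain e' where e': "range e' \<subseteq> V" "e = (\<lambda>n. val (e' n))"
    using env_names[OF e] .
  \<comment> \<open>Variable \<open>0\<close> is the candidate member, variable \<open>1\<close> the
    set named by \<open>t\<close>, and the parameters follow; the first conjunct restricts to
    members of \<open>x\<close>.\<close>
  define \<psi> where "\<psi> = Conj (Mem 0 (Suc 0)) (rename_fm (case_nat 0 (\<lambda>n. Suc (Suc n))) \<phi>)"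
  let ?D = "subnames t" and ?e = "\<lambda>s. case_nat s (case_nat t e')"
  have range_e: "range (case_nat t e') \<subseteq> V" by (rule range_case_nat[OF e'(1) t(1)])
  have D_in: "s \<in> V" if "s \<in> elts ?D" for s using transitive[OF subnames_in[OF t(1)] that] .
  define u where "u = sep (times ?D P) (\<lambda>z. \<exists>s\<in>elts ?D. \<exists>p\<in>elts P. z = opair s p \<and> forces \<psi> (?e s) p)"
  note u = subname_val[where Q = "\<lambda>s. forces \<psi> (?e s)",
      OF subnames_in[OF t(1)] subnamesD definable_forces(2)[OF range_e], folded u_def]
  have truth: "(\<exists>p\<in>G. forces \<psi> (?e s) p) \<longleftrightarrow> val s \<in> elts x \<and> sat VG (case_nat (val s) e) \<phi>"
    if "s \<in> elts ?D" for s
  proof -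
    have "(\<exists>p\<in>G. forces \<psi> (?e s) p) \<longleftrightarrow> sat VG (\<lambda>n. val (?e s n)) \<psi>"
      using forcing_theorem[OF range_case_nat[OF range_e D_in[OF that]]] by blast
    moreover have "(\<lambda>n. val (?e s (case_nat 0 (\<lambda>n. Suc (Suc n)) n))) = case_nat (val s) e"
      unfolding e'(2) by (auto split: nat.split)
    ultimately show ?thesis unfolding \<psi>_def t(3) by (simp add: sat_rename_fm)
  qed
  have "sep x (\<lambda>w. sat VG (case_nat w e) \<phi>) = val u"
  proof (rule elts_ext)
    have "y \<in> elts (val u) \<longleftrightarrow> y \<in> elts x \<and> sat VG (case_nat y e) \<phi>" for y
    proof
      assume "y \<in> elts (val u)"
      then obtain s where "s \<in> elts ?D" "y = val s" "\<exists>p\<in>G. forces \<psi> (?e s) p"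
        unfolding u(4) by blast
      then show "y \<in> elts x \<and> sat VG (case_nat y e) \<phi>" using truth by simp
    next
      assume y: "y \<in> elts x \<and> sat VG (case_nat y e) \<phi>"
      then have "y \<in> elts (val t)" using t(3) by simp
      then obtain s where s: "s \<in> elts ?D" "y = val s" by (rule elts_val_subnames[OF t(2)])
      then show "y \<in> elts (val u)" unfolding u(4) using truth[OF s(1)] y by blast
    qed
    then show "elts (sep x (\<lambda>w. sat VG (case_nat w e) \<phi>)) = elts (val u)"
      unfolding elts_sep by blast
  qed
  then show ?thesis using val_in_VG[OF u(1,2)] by simp
qed

lemma VG_nonempty: "VG \<noteq> {}"
proof -
  have "forcing_name P (num 0)" by (rule forcing_name.intros) simp
  then show ?thesis using val_in_VG[OF empty_in] by blast
qed

interpretation VG: transitive_separation VG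
  using VG_transitive VG_separation VG_nonempty by unfold_locales

lemma VG_pairset:
  assumes "x \<in> VG" "y \<in> VG"
  shows "pairset x y \<in> VG"
proof -
  obtain s where s: "s \<in> V" "forcing_name P s" "x = val s" using in_VGE[OF assms(1)] .
  obtain t where t: "t \<in> V" "forcing_name P t" "y = val t" using in_VGE[OF assms(2)] .
  have D: "pairset s t \<in> V" "\<forall>r\<in>elts (pairset s t). forcing_name P r"
    using s t by auto
  have "val (times (pairset s t) P) = pairset x y"
    by (rule elts_ext) (simp add: names_times(2)[OF D] s t)
  then show ?thesis using val_in_VG[OF times_in[OF D(1) P_in] names_times(1)[OF D]] by simp
qed

text \<open>All names in a transitive set around \<open>t\<close>, each with all conditions,
  evaluate to a set that covers the union; separation in the extension removes the surplus.\<close>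

lemma VG_Unions:
  assumes "x \<in> VG"
  shows "Unions x \<in> VG"
proof -
  obtain t where t: "t \<in> V" "forcing_name P t" "x = val t" using in_VGE[OF assms] .
  obtain T where T: "T \<in> V" "t \<in> elts T" "tset T" using tset_exists[OF t(1)] .
  let ?D = "sep T (forcing_name P)"
  have D: "?D \<in> V" "\<forall>r\<in>elts ?D. forcing_name P r"
    by (intro sep_in definable_intros T) simp
  let ?u = "val (times ?D P)"
  have u: "?u \<in> VG" using val_in_VG[OF times_in[OF D(1) P_in] names_times(1)[OF D]] .
  have "definable VG (\<lambda>e. \<exists>y\<in>VG. y \<in> elts x \<and> e 0 \<in> elts y)"
    by (intro definable_intros assms)
  from VG.sep_in[OF u this] have "sep ?u (\<lambda>w. \<exists>y\<in>VG. y \<in> elts x \<and> w \<in> elts y) \<in> VG" .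
  moreover have "sep ?u (\<lambda>w. \<exists>y\<in>VG. y \<in> elts x \<and> w \<in> elts y) = Unions x"
  proof (rule elts_ext)
    have "w \<in> elts ?u" if w: "w \<in> elts y" "y \<in> elts x" for w y
    proof -
      obtain s p where s: "y = val s" "opair s p \<in> elts t"
        using w(2) unfolding t(3) by (rule in_valE)
      obtain r q where r: "w = val r" "opair r q \<in> elts s"
        using w(1) unfolding s(1) by (rule in_valE)
      have "r \<in> elts T" using tset_opair[OF T(3) tset_opair[OF T(3,2) s(2)] r(2)] .
      moreover have "forcing_name P r"
        using forcing_nameD(1)[OF forcing_nameD(1)[OF t(2) s(2)] r(2)] .
      ultimately show ?thesis unfolding names_times(2)[OF D] r(1) by simp
    qed
    then show "elts (sep ?u (\<lambda>w. \<exists>y\<in>VG. y \<in> elts x \<and> w \<in> elts y)) = elts (Unions x)"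
      using VG_transitive[OF assms] unfolding elts_sep elts_Unions by blast
  qed
  ultimately show ?thesis by simp
qed

text \<open>Every subset of \<open>x\<close> in the extension has a name that is a subset of the
  product of \<open>subnames t\<close> with \<open>P\<close>. These names form a power set in
  \<open>V\<close>; paired with all conditions, they evaluate to a set that covers the desired
  one.\<close>

lemma VG_power:
  assumes "x \<in> VG"
  shows "\<exists>z\<in>VG. elts z = {y \<in> VG. elts y \<subseteq> elts x}"
proof -
  obtain t where t: "t \<in> V" "forcing_name P t" "x = val t" using in_VGE[OF assms] .
  let ?D = "subnames t"
  let ?S = "power (times ?D P)"
  have DP: "times ?D P \<in> V" using subnames_in[OF t(1)] P_in by blast
  have S: "?S \<in> V" "\<forall>s\<in>elts ?S. forcing_name P s"
  proof (safe)
    show "?S \<in> V" using DP by blast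
    fix s assume "s \<in> elts ?S"
    then have s: "elts s \<subseteq> elts (times ?D P)" using elts_power[OF DP] by blast
    show "forcing_name P s"
    proof (rule forcing_name.intros)
      fix z assume "z \<in> elts s"
      then show "\<exists>r p. z = opair r p \<and> p \<in> elts P \<and> forcing_name P r"
        using s subnamesD unfolding elts_times[OF subnames_in[OF t(1)] P_in] by blast
    qed
  qed
  let ?u = "val (times ?S P)"
  have u: "?u \<in> VG" using val_in_VG[OF times_in[OF S(1) P_in] names_times(1)[OF S]] .
  have "definable VG (\<lambda>e. \<forall>z\<in>VG. z \<in> elts (e 0) \<longrightarrow> z \<in> elts x)"
    by (intro definable_intros assms)
  from VG.sep_in[OF u this] have "sep ?u (\<lambda>y. \<forall>z\<in>VG. z \<in> elts y \<longrightarrow> z \<in> elts x) \<in> VG" .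
  moreover have "elts (sep ?u (\<lambda>y. \<forall>z\<in>VG. z \<in> elts y \<longrightarrow> z \<in> elts x)) = {y \<in> VG. elts y \<subseteq> elts x}"
  proof -
    have "y \<in> elts ?u" if y: "y \<in> VG" "elts y \<subseteq> elts x" for y
    proof -
      obtain r where r: "r \<in> V" "forcing_name P r" "y = val r" using in_VGE[OF y(1)] .
      have Q: "definable V (\<lambda>e. forces_mem (e 0) r (e (Suc 0)))"
        by (intro definable_intros r)
      \<comment> \<open>From an arbitrary name \<open>r\<close> of \<open>y\<close>, the subnames of
        \<open>t\<close> that are forced into \<open>r\<close> are retained together with the
        forcing conditions.\<close>
      let ?s = "sep (times ?D P) (\<lambda>z. \<exists>a\<in>elts ?D. \<exists>p\<in>elts P. z = opair a p \<and> forces_mem a r p)"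
      note s = subname_val[where Q = "\<lambda>a. forces_mem a r", OF subnames_in[OF t(1)] subnamesD Q]
      have "y = val ?s"
      proof (rule elts_ext)
        have vs: "elts (val ?s) = {val a | a. a \<in> elts ?D \<and> val a \<in> elts y}"
          unfolding s(4) r(3) using forces_mem_truth[OF transitive[OF subnames_in[OF t(1)]] r(1)] by blast
        have "\<exists>a\<in>elts ?D. w = val a" if "w \<in> elts y" for w
        proof -
          have "w \<in> elts (val t)" using that y(2) t(3) by blast
          then show ?thesis using elts_val_subnames[OF t(2)] by metis
        qed
        then show "elts y = elts (val ?s)" unfolding vs by blast
      qed
      moreover have "?s \<in> elts ?S" using elts_power[OF DP] s(1,3) by blast
      ultimately show ?thesis unfolding names_times(2)[OF S] by blast
    qed
    then show ?thesis using VG_transitive[OF u] VG_transitive unfolding elts_sep by blast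
  qed
  ultimately show ?thesis by blast
qed

text \<open>\<open>W\<close> is part of the graph of the map sending \<open>x\<close> to its
  canonical name, the set of all pairs of the canonical name of a \<open>y\<close> in
  \<open>x\<close> with a condition. All conditions occur since a notion of forcing comes without a
  distinguished greatest one.\<close>

definition check_witness :: "'a \<Rightarrow> bool" where
  "check_witness W \<longleftrightarrow> (\<forall>z\<in>elts W. \<exists>x\<in>V. \<exists>c\<in>V. z = opair x c \<and>
     (\<forall>y\<in>elts x. \<exists>d\<in>V. opair y d \<in> elts W \<and> (\<forall>p\<in>elts P. opair d p \<in> elts c)) \<and>
     (\<forall>w\<in>elts c. \<exists>y\<in>elts x. \<exists>d\<in>V. \<exists>p\<in>elts P. opair y d \<in> elts W \<and> w = opair d p))"

definition is_check :: "'a \<Rightarrow> 'a \<Rightarrow> bool" where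
  "is_check x c \<longleftrightarrow> (\<exists>W\<in>V. check_witness W \<and> opair x c \<in> elts W)"

lemma definable_is_check:
  assumes "dterm V s" "dterm V t"
  shows "definable V (\<lambda>e. is_check (s e) (t e))" unfolding is_check_def check_witness_def
  by (intro definable_intros P_in assms[THEN dterm_rename])

lemma is_check_down:
  assumes "is_check x c" "y \<in> elts x"
  shows "\<exists>d\<in>V. is_check y d \<and> (\<forall>p\<in>elts P. opair d p \<in> elts c)"
proof -
  obtain W where W: "W \<in> V" "check_witness W" "opair x c \<in> elts W"
    using assms(1) unfolding is_check_def by blast
  have "\<exists>d\<in>V. opair y d \<in> elts W \<and> (\<forall>p\<in>elts P. opair d p \<in> elts c)"
    using W(2)[unfolded check_witness_def, THEN bspec, OF W(3)] assms(2) by (auto simp: opair_eq_iff)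
  then show ?thesis using W(1,2) unfolding is_check_def by blast
qed

lemma is_check_up:
  assumes "is_check x c" "w \<in> elts c"
  shows "\<exists>y\<in>elts x. \<exists>d\<in>V. \<exists>p\<in>elts P. is_check y d \<and> w = opair d p"
proof -
  obtain W where W: "W \<in> V" "check_witness W" "opair x c \<in> elts W"
    using assms(1) unfolding is_check_def by blast
  have "\<exists>y\<in>elts x. \<exists>d\<in>V. \<exists>p\<in>elts P. opair y d \<in> elts W \<and> w = opair d p"
    using W(2)[unfolded check_witness_def, THEN bspec, OF W(3)] assms(2) by (auto simp: opair_eq_iff)
  then show ?thesis using W(1,2) unfolding is_check_def by blast
qed

lemma is_check_unique:
  assumes "is_check x c" "is_check x c'"
  shows "c = c'" using wf_elts assms
proof (induction x arbitrary: c c' rule: wf_induct_rule)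
  case (less x)
  have "elts c \<subseteq> elts c'" if c: "is_check x c" "is_check x c'" for c c'
  proof
    fix w assume "w \<in> elts c"
    then obtain y d p where y: "y \<in> elts x" "p \<in> elts P" "is_check y d" "w = opair d p"
      using is_check_up[OF c(1)] by blast
    obtain d' where d': "is_check y d'" "\<forall>p\<in>elts P. opair d' p \<in> elts c'"
      using is_check_down[OF c(2) y(1)] by blast
    have "d = d'" using less.IH[OF _ y(3) d'(1)] y(1) by blast
    then show "w \<in> elts c'" using y d' by blast
  qed
  then show ?case using less.prems elts_ext[of c c'] by blast
qed

lemma check_exists:
  assumes "x \<in> V"
  shows "\<exists>c\<in>V. is_check x c" using wf_elts assms
proof (induction x rule: wf_induct_rule)
  case (less x)
  obtain T where T: "T \<in> V" "x \<in> elts T" "tset T" using tset_exists[OF less.prems] .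
  \<comment> \<open>Replacement asks for a value at each argument, so it is applied to the members
    of \<open>T\<close> that have a canonical name; by the induction hypothesis the members of
    \<open>x\<close> are among them.\<close>
  let ?T' = "sep T (\<lambda>u. \<exists>d\<in>V. is_check u d)"
  have T': "?T' \<in> V" by (intro sep_in definable_intros definable_is_check T)
  have "definable V (\<lambda>e. \<exists>d\<in>V. is_check (e 0) d \<and> e (Suc 0) = opair (e 0) d)"
    by (intro definable_intros definable_is_check)
  moreover have "\<exists>!v. v \<in> V \<and> (\<exists>d\<in>V. is_check u d \<and> v = opair u d)" if u: "u \<in> elts ?T'" for u
  proof -
    obtain d where d: "d \<in> V" "is_check u d" using u by auto
    have "opair u d \<in> V" using d(1) transitive[OF T' u] by blast
    then show ?thesis using d is_check_unique[OF d(2)] by (intro ex1I[of _ "opair u d"]) blast+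
  qed
  ultimately obtain W0 where W0: "W0 \<in> V"
    "elts W0 = {v \<in> V. \<exists>u\<in>elts ?T'. \<exists>d\<in>V. is_check u d \<and> v = opair u d}"
    using replacement_in[OF T', of "\<lambda>u v. \<exists>d\<in>V. is_check u d \<and> v = opair u d"] by blast
  have T_in: "u \<in> V" if "u \<in> elts T" for u using transitive[OF T(1) that] .
  have mem_W0: "opair u d \<in> elts W0" if "u \<in> elts T" "d \<in> V" "is_check u d" for u d
    unfolding W0(2) using that T_in opair_in by auto
  define c where "c = sep (times (Unions (Unions W0)) P)
    (\<lambda>w. \<exists>y\<in>elts x. \<exists>d\<in>V. \<exists>p\<in>elts P. opair y d \<in> elts W0 \<and> w = opair d p)"
  have c_in: "c \<in> V"
    unfolding c_def by (intro sep_in definable_intros times_in Unions_in W0 P_in less.prems)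
  have c: "w \<in> elts c \<longleftrightarrow> (\<exists>y\<in>elts x. \<exists>d\<in>V. \<exists>p\<in>elts P. opair y d \<in> elts W0 \<and> w = opair d p)" for w
  proof -
    have "opair d p \<in> elts (times (Unions (Unions W0)) P)" if "opair y d \<in> elts W0" "p \<in> elts P" for y d p
      using opair_in_UnionsD(2)[OF that(1)] that(2) W0(1) by (subst opair_in_times) auto
    then show ?thesis unfolding c_def by auto
  qed
  let ?W = "ins (opair x c) W0"
  have "check_witness ?W" unfolding check_witness_def
  proof
    fix z assume z: "z \<in> elts ?W"
    show "\<exists>x\<in>V. \<exists>c\<in>V. z = opair x c \<and>
     (\<forall>y\<in>elts x. \<exists>d\<in>V. opair y d \<in> elts ?W \<and> (\<forall>p\<in>elts P. opair d p \<in> elts c)) \<and>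
     (\<forall>w\<in>elts c. \<exists>y\<in>elts x. \<exists>d\<in>V. \<exists>p\<in>elts P. opair y d \<in> elts ?W \<and> w = opair d p)"
    proof (cases "z = opair x c")
      case True
      have "\<exists>d\<in>V. opair y d \<in> elts W0 \<and> (\<forall>p\<in>elts P. opair d p \<in> elts c)" if y: "y \<in> elts x" for y
      proof -
        have "y \<in> elts T" using T(2,3) y unfolding tset_def by blast
        moreover obtain d where d: "d \<in> V" "is_check y d"
          using less.IH[of y] y T_in[OF \<open>y \<in> elts T\<close>] by blast
        ultimately have "opair y d \<in> elts W0" using mem_W0 by blast
        then show ?thesis using c y d(1) by blast
      qed
      then show ?thesis
        using True less.prems c_in c unfolding elts_ins by (intro bexI[of _ x] bexI[of _ c]) blast+
    next
      case False
      then have "z \<in> elts W0" using z by simp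
      then obtain u d where u: "u \<in> elts T" "d \<in> V" "is_check u d" "z = opair u d"
        unfolding W0(2) by auto
      have "\<exists>d'\<in>V. opair y d' \<in> elts ?W \<and> (\<forall>p\<in>elts P. opair d' p \<in> elts d)" if y: "y \<in> elts u" for y
      proof -
        have "y \<in> elts T" using T(3) u(1) y unfolding tset_def by blast
        then show ?thesis using is_check_down[OF u(3) y] mem_W0 unfolding elts_ins by blast
      qed
      moreover have "\<exists>y\<in>elts u. \<exists>d'\<in>V. \<exists>p\<in>elts P. opair y d' \<in> elts ?W \<and> w = opair d' p"
        if w: "w \<in> elts d" for w
      proof -
        obtain y d' p where y: "y \<in> elts u" "d' \<in> V" "p \<in> elts P" "is_check y d'" "w = opair d' p"
          using is_check_up[OF u(3) w] by blast
        have "y \<in> elts T" using T(3) u(1) y(1) unfolding tset_def by blast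
        then show ?thesis using y mem_W0 unfolding elts_ins by blast
      qed
      ultimately show ?thesis using u(2,4) T_in[OF u(1)] by blast
    qed
  qed
  moreover have "?W \<in> V" using W0(1) less.prems c_in by blast
  ultimately have "is_check x c" unfolding is_check_def by auto
  then show ?case using c_in by blast
qed

lemma val_check:
  assumes "is_check x c"
  shows "forcing_name P c \<and> val c = x" using wf_elts assms
proof (induction x arbitrary: c rule: wf_induct_rule)
  case (less x)
  have IH: "forcing_name P d \<and> val d = y" if "y \<in> elts x" "is_check y d" for y d
    using less.IH[OF _ that(2)] that(1) by blast
  have "forcing_name P c"
  proof (rule forcing_name.intros)
    fix w assume "w \<in> elts c"
    then show "\<exists>s p. w = opair s p \<and> p \<in> elts P \<and> forcing_name P s"
      using is_check_up[OF less.prems] IH by blast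
  qed
  moreover have "elts (val c) = elts x"
  proof
    show "elts (val c) \<subseteq> elts x"
    proof
      fix w assume "w \<in> elts (val c)"
      then obtain s p where s: "w = val s" "opair s p \<in> elts c" by (rule in_valE)
      then obtain y d where "y \<in> elts x" "is_check y d" "s = d"
        using is_check_up[OF less.prems s(2)] by (auto simp: opair_eq_iff)
      then show "w \<in> elts x" using IH s(1) by blast
    qed
    show "elts x \<subseteq> elts (val c)"
    proof
      fix y assume y: "y \<in> elts x"
      then obtain d where d: "is_check y d" "\<forall>p\<in>elts P. opair d p \<in> elts c"
        using is_check_down[OF less.prems] by blast
      obtain p where "p \<in> G" using G_nonempty .
      then show "y \<in> elts (val c)" using in_valI[of p d c] d(2) G_sub IH[OF y d(1)] by auto
    qed
  qed
  ultimately show ?case using elts_ext by blast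
qed

lemma V_sub_VG: "V \<subseteq> VG"
proof
  fix x assume "x \<in> V"
  then obtain c where "c \<in> V" "is_check x c" using check_exists by blast
  then show "x \<in> VG" using val_check val_in_VG by metis
qed

lemma VG_zermelo: "transitive_zermelo_omega VG"
proof unfold_locales
  show "\<exists>z\<in>VG. elts z = range num" using omega_in V_sub_VG elts_omega by blast
qed (use VG_pairset VG_Unions VG_power in auto)

end

section \<open>Boolean algebras\<close>

locale boolean_algebra_set =
  fixes A :: "'a::set_universe ba"
  assumes boolean: "is_boolean_algebra A"
begin

abbreviation B :: "'a set" where
  "B \<equiv> elts (carr A)"

abbreviation bt :: 'a where
  "bt \<equiv> bot_elt A"

abbreviation tp :: 'a where
  "tp \<equiv> top_elt A"

text \<open>Written with \<open>ap\<close>, which consists of unions and separation and is therefore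
  a definable term over a transitive model containing the algebra. The operations do not refer to a
  model, so \<open>V\<close> and \<open>V[G]\<close> share them.\<close>

definition mt :: "'a \<Rightarrow> 'a \<Rightarrow> 'a" where
  "mt a b = ap (meet_fun A) (opair a b)"

definition jn :: "'a \<Rightarrow> 'a \<Rightarrow> 'a" where
  "jn a b = ap (join_fun A) (opair a b)"

definition cm :: "'a \<Rightarrow> 'a" where
  "cm a = ap (compl_fun A) a"

definition lq :: "'a \<Rightarrow> 'a \<Rightarrow> bool" where
  "lq a b \<longleftrightarrow> mt a b = a"

lemma funs:
  "is_fun (meet_fun A) {opair a b | a b. a \<in> B \<and> b \<in> B} B"
  "is_fun (join_fun A) {opair a b | a b. a \<in> B \<and> b \<in> B} B"
  "is_fun (compl_fun A) B B"
  using boolean unfolding is_boolean_algebra_def by (simp_all add: Let_def)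

lemma ops:
  assumes "a \<in> B" "b \<in> B"
  shows "ba_meet A a b = mt a b" "ba_join A a b = jn a b" "ba_compl A a = cm a"
  unfolding ba_meet_def mt_def ba_join_def jn_def ba_compl_def cm_def
  by (rule is_fun_ap(3)[OF funs(1)] is_fun_ap(3)[OF funs(2)] is_fun_ap(3)[OF funs(3)]; use assms in blast)+

lemma closed [simp, intro]:
  "a \<in> B \<Longrightarrow> b \<in> B \<Longrightarrow> mt a b \<in> B"
  "a \<in> B \<Longrightarrow> b \<in> B \<Longrightarrow> jn a b \<in> B"
  "a \<in> B \<Longrightarrow> cm a \<in> B" unfolding mt_def jn_def cm_def
  by (rule is_fun_ap(2)[OF funs(1)] is_fun_ap(2)[OF funs(2)] is_fun_ap(2)[OF funs(3)]; blast)+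

lemma bt_tp_in [simp, intro]: "bt \<in> B" "tp \<in> B"
  using boolean unfolding is_boolean_algebra_def by (simp_all add: Let_def)

lemma laws:
  assumes "a \<in> B" "b \<in> B" "c \<in> B"
  shows "mt a b = mt b a" "jn a b = jn b a"
    and mt_assoc: "mt (mt a b) c = mt a (mt b c)"
    and mt_jn: "mt a (jn b c) = jn (mt a b) (mt a c)"
    and jn_mt: "jn a (mt b c) = mt (jn a b) (jn a c)"
    and "mt a tp = a" "jn a bt = a" "mt a (cm a) = bt" "jn a (cm a) = tp"
proof -
  note L = boolean[unfolded is_boolean_algebra_def Let_def, THEN conjunct2, THEN conjunct2,
      THEN conjunct2, THEN conjunct2, THEN conjunct2]
  note L' = L[THEN conjunct2, THEN conjunct2, THEN conjunct2, THEN conjunct2]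
  note L'' = L'[THEN conjunct2, THEN conjunct2]
  show "mt a b = mt b a" using L[THEN conjunct1] assms(1,2) ops(1) by metis
  show "jn a b = jn b a" using L[THEN conjunct2, THEN conjunct1] assms(1,2) ops(2) by metis
  show "mt (mt a b) c = mt a (mt b c)"
    using L[THEN conjunct2, THEN conjunct2, THEN conjunct1, rule_format, OF assms] assms
    by (simp only: ops closed)
  show "mt a (jn b c) = jn (mt a b) (mt a c)"
    using L'[THEN conjunct1, rule_format, OF assms] assms by (simp only: ops closed)
  show "jn a (mt b c) = mt (jn a b) (jn a c)"
    using L'[THEN conjunct2, THEN conjunct1, rule_format, OF assms] assms by (simp only: ops closed)
  show "mt a tp = a"
    using L''[THEN conjunct1, rule_format, OF assms(1)] assms by (simp only: ops bt_tp_in)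
  show "jn a bt = a"
    using L''[THEN conjunct2, THEN conjunct1, rule_format, OF assms(1)] assms by (simp only: ops bt_tp_in)
  show "mt a (cm a) = bt"
    using L''[THEN conjunct2, THEN conjunct2, THEN conjunct1, rule_format, OF assms(1)] assms
    by (simp only: ops closed)
  show "jn a (cm a) = tp"
    using L''[THEN conjunct2, THEN conjunct2, THEN conjunct2, rule_format, OF assms(1)] assms
    by (simp only: ops closed)
qed

lemmas mt_comm = laws(1)[OF _ _ bt_tp_in(1)] and jn_comm = laws(2)[OF _ _ bt_tp_in(1)]
  and mt_tp = laws(6)[OF _ bt_tp_in(1,1)] and jn_bt = laws(7)[OF _ bt_tp_in(1,1)]
  and mt_cm = laws(8)[OF _ bt_tp_in(1,1)] and jn_cm = laws(9)[OF _ bt_tp_in(1,1)]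

lemma jn_assoc:
  assumes "a \<in> B" "b \<in> B" "c \<in> B"
  shows "jn (jn a b) c = jn a (jn b c)"
proof -
  have "\<forall>a\<in>B. \<forall>b\<in>B. \<forall>c\<in>B. ba_join A (ba_join A a b) c = ba_join A a (ba_join A b c)"
    using boolean unfolding is_boolean_algebra_def Let_def by (elim conjE)
  from this[rule_format, OF assms] show ?thesis using assms by (simp only: ops closed)
qed

lemma mt_idem: assumes "a \<in> B" shows "mt a a = a"
proof -
  have "a = mt a (jn a (cm a))" using assms by (simp add: jn_cm mt_tp)
  also have "\<dots> = jn (mt a a) (mt a (cm a))" using assms by (intro mt_jn) auto
  also have "\<dots> = mt a a" using assms by (simp add: mt_cm jn_bt)
  finally show ?thesis ..
qed

lemma lq_refl: "a \<in> B \<Longrightarrow> lq a a" unfolding lq_def by (rule mt_idem)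

lemma lq_antisym: "a \<in> B \<Longrightarrow> b \<in> B \<Longrightarrow> lq a b \<Longrightarrow> lq b a \<Longrightarrow> a = b"
  unfolding lq_def using mt_comm by metis

lemma lq_trans: "a \<in> B \<Longrightarrow> b \<in> B \<Longrightarrow> c \<in> B \<Longrightarrow> lq a b \<Longrightarrow> lq b c \<Longrightarrow> lq a c"
  unfolding lq_def using mt_assoc by metis

lemma mt_lower1: "a \<in> B \<Longrightarrow> b \<in> B \<Longrightarrow> lq (mt a b) a"
  unfolding lq_def by (metis closed(1) mt_assoc mt_comm mt_idem)

lemma mt_lower2: "a \<in> B \<Longrightarrow> b \<in> B \<Longrightarrow> lq (mt a b) b"
  using mt_lower1 mt_comm by metis

lemma mt_greatest: "a \<in> B \<Longrightarrow> b \<in> B \<Longrightarrow> c \<in> B \<Longrightarrow> lq c a \<Longrightarrow> lq c b \<Longrightarrow> lq c (mt a b)"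
  unfolding lq_def using mt_assoc by metis

lemma mt_bt: assumes "a \<in> B" shows "mt a bt = bt"
proof -
  have "mt a bt = mt a (mt a (cm a))" using assms by (simp add: mt_cm)
  also have "\<dots> = mt (mt a a) (cm a)" using assms by (intro mt_assoc[symmetric]) auto
  finally show ?thesis using assms by (simp add: mt_idem mt_cm)
qed

lemma lq_tp: "a \<in> B \<Longrightarrow> lq a tp" unfolding lq_def by (rule mt_tp)

lemma mt_split: "a \<in> B \<Longrightarrow> b \<in> B \<Longrightarrow> jn (mt a b) (mt a (cm b)) = a"
  by (metis closed(3) jn_cm mt_jn mt_tp)

lemma lq_bt: "a \<in> B \<Longrightarrow> lq a bt \<Longrightarrow> a = bt"
  unfolding lq_def using mt_bt by metis

lemma disjoint_mono:
  assumes "a \<in> B" "b \<in> B" "c \<in> B" "d \<in> B" "lq a c" "lq b d" "mt c d = bt"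
  shows "mt a b = bt"
proof -
  have "lq (mt a b) (mt c d)" using assms mt_lower1[OF assms(1,2)] mt_lower2[OF assms(1,2)]
    by (intro mt_greatest) (auto intro: lq_trans[of _ a c] lq_trans[of _ b d])
  then show ?thesis using assms by (intro lq_bt) auto
qed

lemma lq_iff_mt_cm:
  assumes "a \<in> B" "b \<in> B"
  shows "lq a b \<longleftrightarrow> mt a (cm b) = bt"
proof
  assume "lq a b"
  then have "mt a (cm b) = mt (mt a b) (cm b)" unfolding lq_def by simp
  also have "\<dots> = mt a (mt b (cm b))" using assms by (intro mt_assoc) auto
  finally show "mt a (cm b) = bt" using assms by (simp add: mt_cm mt_bt)
next
  assume "mt a (cm b) = bt"
  then show "lq a b" using mt_split[OF assms] assms unfolding lq_def by (simp add: jn_bt)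
qed

lemma lq_cm_iff:
  assumes "a \<in> B" "b \<in> B"
  shows "lq a (cm b) \<longleftrightarrow> mt a b = bt"
proof
  assume "lq a (cm b)"
  then have "mt a b = mt (mt a (cm b)) b" unfolding lq_def by simp
  also have "\<dots> = mt a (mt (cm b) b)" using assms by (intro mt_assoc) auto
  also have "mt (cm b) b = bt" using assms mt_cm mt_comm by (metis closed(3))
  finally show "mt a b = bt" using assms by (simp add: mt_bt)
next
  assume "mt a b = bt"
  then have "jn bt (mt a (cm b)) = a" using mt_split[OF assms] by simp
  then show "lq a (cm b)"
    using assms jn_comm jn_bt unfolding lq_def by (metis bt_tp_in(1) closed(1,3))
qed

lemma jn_tp: assumes "a \<in> B" shows "jn a tp = tp"
proof -
  have "jn a tp = jn a (jn a (cm a))" using assms by (simp add: jn_cm)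
  also have "\<dots> = jn (jn a a) (cm a)" using assms by (intro jn_assoc[symmetric]) auto
  also have "jn a a = a"
  proof -
    have "jn a a = mt (jn a a) (jn a (cm a))" using assms by (simp add: jn_cm mt_tp)
    also have "\<dots> = jn a (mt a (cm a))" using assms by (intro jn_mt[symmetric]) auto
    finally show ?thesis using assms by (simp add: mt_cm jn_bt)
  qed
  finally show ?thesis using assms by (simp add: jn_cm)
qed

lemma jn_upper1:
  assumes "a \<in> B" "b \<in> B"
  shows "lq a (jn a b)"
proof -
  have "jn a (mt a b) = jn (mt a tp) (mt a b)" using assms by (simp add: mt_tp)
  also have "\<dots> = mt a (jn tp b)" using assms by (intro mt_jn[symmetric]) auto
  also have "\<dots> = a" using assms jn_tp jn_comm by (metis bt_tp_in(2) mt_tp)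
  finally show ?thesis unfolding lq_def using assms by (simp add: mt_jn mt_idem)
qed

lemma jn_upper2: "a \<in> B \<Longrightarrow> b \<in> B \<Longrightarrow> lq b (jn a b)"
  using jn_upper1 jn_comm by metis

lemma jn_least:
  assumes "a \<in> B" "b \<in> B" "c \<in> B" "lq a c" "lq b c"
  shows "lq (jn a b) c"
proof -
  have "mt (jn a b) c = mt c (jn a b)" using assms by (intro mt_comm) auto
  also have "\<dots> = jn (mt c a) (mt c b)" using assms by (intro mt_jn) auto
  also have "\<dots> = jn a b" using assms mt_comm unfolding lq_def by metis
  finally show ?thesis unfolding lq_def .
qed

lemma jn_mono:
  assumes "a \<in> B" "b \<in> B" "c \<in> B" "d \<in> B" "lq a c" "lq b d"
  shows "lq (jn a b) (jn c d)"
proof (rule jn_least)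
  show "lq a (jn c d)"
    using lq_trans[OF assms(1,3) _ assms(5) jn_upper1[OF assms(3,4)]] assms by blast
  show "lq b (jn c d)"
    using lq_trans[OF assms(2,4) _ assms(6) jn_upper2[OF assms(3,4)]] assms by blast
qed (use assms in auto)

lemma ultrafilter_iff:
  "ba_ultrafilter A U \<longleftrightarrow> elts U \<subseteq> elts (carr A) \<and> tp \<in> elts U \<and> bt \<notin> elts U \<and>
     (\<forall>a\<in>elts U. \<forall>b\<in>elts U. mt a b \<in> elts U) \<and>
     (\<forall>a\<in>elts U. \<forall>b\<in>B. lq a b \<longrightarrow> b \<in> elts U) \<and>
     (\<forall>a\<in>B. a \<in> elts U \<or> cm a \<in> elts U)"
proof (cases "elts U \<subseteq> B")
  case True
  then have "\<And>a. a \<in> elts U \<Longrightarrow> a \<in> B" by blast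
  then show ?thesis unfolding ba_ultrafilter_def lq_def by (simp add: ops cong: ball_cong)
qed (simp add: ba_ultrafilter_def)

lemma ultrafilterI:
  assumes "elts U \<subseteq> B" "tp \<in> elts U" "bt \<notin> elts U"
    and "\<And>a b. a \<in> elts U \<Longrightarrow> b \<in> elts U \<Longrightarrow> mt a b \<in> elts U"
    and "\<And>a b. a \<in> elts U \<Longrightarrow> b \<in> B \<Longrightarrow> lq a b \<Longrightarrow> b \<in> elts U"
    and "\<And>a. a \<in> B \<Longrightarrow> a \<in> elts U \<or> cm a \<in> elts U"
  shows "ba_ultrafilter A U" unfolding ultrafilter_iff using assms by blast

lemma ultrafilter_not_disjoint:
  assumes "ba_ultrafilter A U" "a \<in> elts U" "b \<in> elts U"
  shows "mt a b \<noteq> bt"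
proof -
  have "a \<in> B" "b \<in> B" "ba_meet A a b \<in> elts U" "bt \<notin> elts U"
    using assms unfolding ba_ultrafilter_def by blast+
  then show ?thesis using ops(1) by metis
qed

lemma ultrafilter_separated:
  assumes U: "ba_ultrafilter A U" and W: "ba_ultrafilter A W" and "U \<noteq> W"
  obtains a where "a \<in> B" "a \<in> elts U" "cm a \<in> elts W"
proof -
  have sub: "elts U \<subseteq> B" "elts W \<subseteq> B"
    using U W unfolding ba_ultrafilter_def by blast+
  have dec: "a \<in> elts U \<or> cm a \<in> elts U" "a \<in> elts W \<or> cm a \<in> elts W" if "a \<in> B" for a
    using U W that ops(3)[OF that that] unfolding ba_ultrafilter_def by metis+
  have excl: "\<not> (a \<in> elts W \<and> cm a \<in> elts W)" if "a \<in> B" for a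
    using ultrafilter_not_disjoint[OF W] mt_cm[OF that] that by blast
  obtain a where a: "a \<in> elts U \<and> a \<notin> elts W \<or> a \<in> elts W \<and> a \<notin> elts U"
    using \<open>U \<noteq> W\<close> elts_ext[of U W] by blast
  then have "a \<in> B" using sub by blast
  show thesis
  proof (cases "a \<in> elts U")
    case True
    then show thesis
      using that[of a] a dec(2)[OF \<open>a \<in> B\<close>] \<open>a \<in> B\<close> by blast
  next
    case False
    have "cm (cm a) \<in> elts W \<or> cm a \<in> elts W"
      using dec(2)[of "cm a"] \<open>a \<in> B\<close> by blast
    then show thesis
      using that[of "cm a"] a False dec(1)[OF \<open>a \<in> B\<close>] excl[OF \<open>a \<in> B\<close>] \<open>a \<in> B\<close> by blast
  qed
qed

definition fin :: "'a \<Rightarrow> bool" where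
  "fin a \<longleftrightarrow> finite (elts (sep (carr A) (\<lambda>b. lq b a)))"

lemma fin_mono:
  assumes "a \<in> B" "b \<in> B" "lq a b" "fin b"
  shows "fin a"
proof -
  have "elts (sep (carr A) (\<lambda>x. lq x a)) \<subseteq> elts (sep (carr A) (\<lambda>x. lq x b))"
    using lq_trans[OF _ assms(1,2) _ assms(3)] by auto
  then show ?thesis using assms(4) unfolding fin_def by (rule finite_subset)
qed

lemma fin_bt: "fin bt"
proof -
  have "elts (sep (carr A) (\<lambda>x. lq x bt)) \<subseteq> {bt}" using lq_bt by auto
  then show ?thesis unfolding fin_def by (rule finite_subset) simp
qed

text \<open>Each element below \<open>a\<close> is the join of its parts below \<open>b\<close> and
  below the complement, so the elements below \<open>a\<close> are covered by an image of a finite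
  product.\<close>

lemma fin_split:
  assumes "a \<in> B" "b \<in> B" "fin (mt a b)" "fin (mt a (cm b))"
  shows "fin a"
proof -
  let ?b = "\<lambda>a. elts (sep (carr A) (\<lambda>x. lq x a))"
  have "?b a \<subseteq> (\<lambda>(x, y). jn x y) ` (?b (mt a b) \<times> ?b (mt a (cm b)))"
  proof
    fix x assume "x \<in> ?b a"
    then have x: "x \<in> B" "lq x a" by auto
    have "lq (mt x c) (mt a c)" if "c \<in> B" for c
      using that x assms(1) mt_lower1[OF x(1) that] mt_lower2[OF x(1) that]
      by (intro mt_greatest) (auto intro: lq_trans[of _ x a])
    then have "(mt x b, mt x (cm b)) \<in> ?b (mt a b) \<times> ?b (mt a (cm b))"
      using assms x by auto
    moreover have "x = (\<lambda>(x, y). jn x y) (mt x b, mt x (cm b))"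
      using mt_split[OF x(1) assms(2)] by simp
    ultimately show "x \<in> (\<lambda>(x, y). jn x y) ` (?b (mt a b) \<times> ?b (mt a (cm b)))"
      by blast
  qed
  then show ?thesis
    using assms(3,4) unfolding fin_def by (meson finite_SigmaI finite_imageI finite_subset)
qed

lemma fin_tp: "fin tp \<longleftrightarrow> finite B"
proof -
  have "elts (sep (carr A) (\<lambda>x. lq x tp)) = B" using lq_tp by auto
  then show ?thesis unfolding fin_def by simp
qed

definition atom :: "'a \<Rightarrow> bool" where
  "atom p \<longleftrightarrow> p \<noteq> bt \<and> (\<forall>b\<in>B. lq b p \<longrightarrow> b = bt \<or> b = p)"

lemma fin_atom:
  assumes "atom p"
  shows "fin p"
proof -
  have "elts (sep (carr A) (\<lambda>x. lq x p)) \<subseteq> {bt, p}"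
    using assms unfolding atom_def by auto
  then show ?thesis unfolding fin_def by (rule finite_subset) simp
qed

lemma atom_decides:
  assumes "p \<in> B" "atom p" "b \<in> B"
  shows "lq p b \<or> lq p (cm b)"
proof (cases "mt p b = bt")
  case True
  then show ?thesis using lq_cm_iff[OF assms(1,3)] by blast
next
  case False
  then have "mt p b = p" using assms mt_lower1[OF assms(1,3)] unfolding atom_def by blast
  then show ?thesis unfolding lq_def by blast
qed

lemma fin_atom_below:
  assumes "a \<in> B" "a \<noteq> bt" "fin a"
  shows "\<exists>p\<in>B. atom p \<and> lq p a" using assms
proof (induction "card (elts (sep (carr A) (\<lambda>b. lq b a)))" arbitrary: a rule: less_induct)
  case less
  show ?case
  proof (cases "atom a")
    case True
    then show ?thesis using less.prems lq_refl by blast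
  next
    case False
    then obtain b where b: "b \<in> B" "lq b a" "b \<noteq> bt" "b \<noteq> a"
      using less.prems unfolding atom_def by blast
    have "elts (sep (carr A) (\<lambda>x. lq x b)) \<subset> elts (sep (carr A) (\<lambda>x. lq x a))"
    proof
      show "elts (sep (carr A) (\<lambda>x. lq x b)) \<subseteq> elts (sep (carr A) (\<lambda>x. lq x a))"
        using lq_trans[OF _ b(1) less.prems(1) _ b(2)] by auto
      have "a \<in> elts (sep (carr A) (\<lambda>x. lq x a))" "a \<notin> elts (sep (carr A) (\<lambda>x. lq x b))"
        using less.prems b lq_antisym lq_refl by auto
      then show "elts (sep (carr A) (\<lambda>x. lq x b)) \<noteq> elts (sep (carr A) (\<lambda>x. lq x a))"
        by blast
    qed
    then have "card (elts (sep (carr A) (\<lambda>x. lq x b))) < card (elts (sep (carr A) (\<lambda>x. lq x a)))"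
      using less.prems(3) unfolding fin_def by (intro psubset_card_mono)
    from less.hyps[OF this b(1,3)] fin_mono[OF b(1) less.prems(1) b(2) less.prems(3)]
    obtain p where "p \<in> B" "atom p" "lq p b" by blast
    then show ?thesis using lq_trans[OF _ b(1) less.prems(1) _ b(2)] by blast
  qed
qed

text \<open>An infinite \<open>c\<close> is not an atom and splits into nonzero parts
  \<open>b\<close> and \<open>c - b\<close>. One of them lies in the finite one of the two pieces
  into which \<open>b\<close> divides \<open>a\<close>, and a nonzero finite element has an atom
  below it.\<close>

lemma rank_one_atom_below:
  assumes a: "a \<in> B" "\<And>b. b \<in> B \<Longrightarrow> fin (mt a b) \<or> fin (mt a (cm b))"
    and c: "c \<in> B" "lq c a" "\<not> fin c"
  shows "\<exists>p\<in>B. atom p \<and> lq p c"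
proof -
  have "c \<noteq> bt" "\<not> atom c" using c(3) fin_bt fin_atom by blast+
  then obtain b where b: "b \<in> B" "lq b c" "b \<noteq> bt" "b \<noteq> c"
    using c(1) unfolding atom_def by blast
  have ne: "mt c (cm b) \<noteq> bt"
    using lq_iff_mt_cm[OF c(1) b(1)] b lq_antisym[OF b(1) c(1)] by blast
  show ?thesis
  proof (cases "fin (mt a b)")
    case True
    have "lq b (mt a b)"
      using mt_greatest[OF a(1) b(1,1) lq_trans[OF b(1) c(1) a(1) b(2) c(2)] lq_refl[OF b(1)]] .
    then have "fin b" using fin_mono[OF b(1) _ _ True] a b by blast
    then obtain p where "p \<in> B" "atom p" "lq p b" using fin_atom_below[OF b(1,3)] by blast
    then show ?thesis using lq_trans[OF _ b(1) c(1) _ b(2)] by blast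
  next
    case False
    then have *: "fin (mt a (cm b))" using a(2)[OF b(1)] by blast
    have in_B: "cm b \<in> B" "mt c (cm b) \<in> B" "mt a (cm b) \<in> B"
      using a(1) b(1) c(1) by auto
    have "lq (mt c (cm b)) (mt a (cm b))"
      using mt_greatest[OF a(1) in_B(1,2)] mt_lower1[OF c(1) in_B(1)] mt_lower2[OF c(1) in_B(1)]
        lq_trans[OF in_B(2) c(1) a(1) _ c(2)] by blast
    then have "fin (mt c (cm b))" using fin_mono[OF in_B(2,3) _ *] by blast
    then obtain p where "p \<in> B" "atom p" "lq p (mt c (cm b))"
      using fin_atom_below[OF in_B(2) ne] by blast
    then show ?thesis using lq_trans[OF _ in_B(2) c(1) _ mt_lower1[OF c(1) in_B(1)]] by blast
  qed
qed

subsection \<open>Binary splitting\<close>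

definition splitting :: "('a \<Rightarrow> 'a) \<Rightarrow> bool" where
  "splitting g \<longleftrightarrow> (\<forall>a\<in>B. \<not> fin a \<longrightarrow>
     g a \<in> B \<and> lq (g a) a \<and> \<not> fin (g a) \<and> \<not> fin (mt a (cm (g a))))"

text \<open>Nodes are addressed by infinite bit sequences of which only the first \<open>k\<close>
  places matter, which makes flipped sequences easy to compare.\<close>

primrec branch :: "('a \<Rightarrow> 'a) \<Rightarrow> (nat \<Rightarrow> bool) \<Rightarrow> nat \<Rightarrow> 'a" where
  "branch g X 0 = tp"
| "branch g X (Suc k) = (if X k then g (branch g X k) else mt (branch g X k) (cm (g (branch g X k))))"

lemma branch_cong: "(\<And>i. i < k \<Longrightarrow> X i = Y i) \<Longrightarrow> branch g X k = branch g Y k"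
  by (induction k) simp_all

definition ideal_avoiding :: "('a \<Rightarrow> 'a) \<Rightarrow> 'a set \<Rightarrow> bool" where
  "ideal_avoiding g I \<longleftrightarrow> I \<subseteq> B \<and> bt \<in> I \<and> (\<forall>a\<in>B. \<forall>b\<in>I. lq a b \<longrightarrow> a \<in> I) \<and>
     (\<forall>a\<in>I. \<forall>b\<in>I. jn a b \<in> I) \<and> (\<forall>X k. branch g X k \<notin> I)"

text \<open>Comparison with \<open>jn i a\<close> for some \<open>i\<close> in \<open>I\<close> is
  the order of the quotient by \<open>I\<close>; the set is the preimage of the filter generated
  there by the nodes along \<open>X\<close>.\<close>

definition branch_filter :: "('a \<Rightarrow> 'a) \<Rightarrow> 'a set \<Rightarrow> (nat \<Rightarrow> bool) \<Rightarrow> 'a set" where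
  "branch_filter g I X = {a \<in> B. \<exists>k. \<exists>i\<in>I. lq (branch g X k) (jn i a)}"

context
  fixes g
  assumes g: "splitting g" and infinite: "\<not> fin tp"
begin

lemma branch_in: "branch g X k \<in> B \<and> \<not> fin (branch g X k)"
  by (induction k) (use g infinite in \<open>auto simp: splitting_def\<close>)

lemma branch_Suc: "lq (branch g X (Suc k)) (branch g X k)"
  using g branch_in[of X k] mt_lower1[of "branch g X k" "cm (g (branch g X k))"]
  unfolding splitting_def by auto

lemma branch_mono:
  assumes "k \<le> l"
  shows "lq (branch g X l) (branch g X k)" using assms
proof (induction rule: dec_induct)
  case base
  then show ?case using branch_in lq_refl by blast
next
  case (step l)
  then show ?case using lq_trans[OF _ _ _ branch_Suc] branch_in by blast
qed

lemma branch_disjoint_Suc: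
  assumes "\<And>i. i < k \<Longrightarrow> X i = Y i" "X k \<noteq> Y k"
  shows "mt (branch g X (Suc k)) (branch g Y (Suc k)) = bt"
proof -
  define c where "c = branch g X k"
  have c: "c \<in> B" "g c \<in> B" "branch g Y k = c"
    using branch_in[of X k] g branch_cong[of k X Y g] assms(1) unfolding c_def splitting_def by auto
  have "mt (g c) (mt c (cm (g c))) = bt"
    using disjoint_mono[OF c(2) _ c(2) _ lq_refl[OF c(2)] mt_lower2[OF c(1)] mt_cm[OF c(2)]] c by blast
  then show ?thesis using assms(2) c mt_comm[of "g c" "mt c (cm (g c))"]
    by (cases "X k") (auto simp: c_def[symmetric])
qed

lemma branch_disjoint:
  assumes "j < k" "j < l" "X j \<noteq> Y j"
  shows "mt (branch g X k) (branch g Y l) = bt"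
proof -
  define i where "i = (LEAST i. X i \<noteq> Y i)"
  have i: "X i \<noteq> Y i" "\<And>j. j < i \<Longrightarrow> X j = Y j" "i \<le> j"
    unfolding i_def using LeastI[of "\<lambda>i. X i \<noteq> Y i" j] assms(3) not_less_Least
    by (auto intro: Least_le)
  have "mt (branch g X (Suc i)) (branch g Y (Suc i)) = bt"
    using i(2,1) by (rule branch_disjoint_Suc)
  moreover have "lq (branch g X k) (branch g X (Suc i))" "lq (branch g Y l) (branch g Y (Suc i))"
    using i(3) assms(1,2) by (intro branch_mono; simp)+
  ultimately show ?thesis using disjoint_mono branch_in by blast
qed

text \<open>Modulo a maximal ideal avoiding all branches, the branches are dense.\<close>

lemma branch_decides:
  assumes I: "ideal_avoiding g I"
    and maximal: "\<And>a. a \<in> B \<Longrightarrow> a \<notin> I \<Longrightarrow> \<exists>i\<in>I. \<exists>Y l. lq (branch g Y l) (jn i a)"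
    and a: "a \<in> B"
  shows "\<exists>Y l. (\<forall>i<k. Y i = X i) \<and> k \<le> l \<and>
    (\<exists>i\<in>I. lq (branch g Y l) (jn i a) \<or> lq (branch g Y l) (jn i (cm a)))"
proof -
  define c where "c = branch g X k"
  have c: "c \<in> B" "mt c a \<in> B" unfolding c_def using branch_in a by auto
  have I_sub: "I \<subseteq> B" using I unfolding ideal_avoiding_def by blast
  show ?thesis
  proof (cases "mt c a \<in> I")
    case True
    \<comment> \<open>Here the node \<open>c\<close> itself lies below the complement of
      \<open>a\<close> modulo \<open>I\<close>.\<close>
    have "lq c (jn (mt c a) (cm a))"
    proof -
      have "lq (jn (mt c a) (mt c (cm a))) (jn (mt c a) (cm a))"
        using a c by (intro jn_mono lq_refl mt_lower2) auto
      then show ?thesis using mt_split[OF c(1) a] by simp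
    qed
    then show ?thesis unfolding c_def using True c_def by (intro exI[of _ X] exI[of _ k]) auto
  next
    case False
    then obtain i Y l where i: "i \<in> I" "lq (branch g Y l) (jn i (mt c a))"
      using maximal[OF c(2)] by blast
    have iB: "i \<in> B" using i(1) I_sub by blast
    have Y: "branch g Y l \<in> B" using branch_in by blast
    have le: "lq (branch g Y l) (jn i a)"
    proof (rule lq_trans[OF Y _ _ i(2)])
      show "lq (jn i (mt c a)) (jn i a)" using a c iB by (intro jn_mono lq_refl mt_lower2) auto
    qed (use a c iB in auto)
    \<comment> \<open>A node branching off from \<open>c\<close> is disjoint from \<open>c\<close>;
      its part below \<open>mt c a\<close> would vanish, leaving it below \<open>i\<close> and hence
      in \<open>I\<close>.\<close>
    have agree: "Y j = X j" if "j < k" "j < l" for j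
    proof (rule ccontr)
      assume "Y j \<noteq> X j"
      then have "mt (branch g Y l) c = bt"
        unfolding c_def using branch_disjoint[OF that(2,1)] by blast
      then have "mt (branch g Y l) (mt c a) = bt"
        using disjoint_mono[OF Y c(2) Y c(1) lq_refl[OF Y] mt_lower1[OF c(1) a]] by blast
      then have "lq (branch g Y l) i"
        using i(2) mt_jn[OF Y iB c(2)] jn_bt[of "mt (branch g Y l) i"] Y iB unfolding lq_def by simp
      then show False using I i(1) Y unfolding ideal_avoiding_def by blast
    qed
    show ?thesis
    proof (cases "k \<le> l")
      case True
      then show ?thesis using agree le i(1) by (intro exI[of _ Y] exI[of _ l]) auto
    next
      case False
      \<comment> \<open>The node found lies above \<open>c\<close>, so \<open>c\<close> itself
        decides \<open>a\<close>.\<close>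
      then have "branch g Y l = branch g X l" using agree by (intro branch_cong) auto
      then have "lq (branch g X k) (branch g Y l)" using branch_mono[of l k X] False by simp
      then have "lq (branch g X k) (jn i a)"
        using lq_trans[OF _ Y _ _ le, of "branch g X k"] branch_in a iB by blast
      then show ?thesis using i(1) by (intro exI[of _ X] exI[of _ k]) auto
    qed
  qed
qed

lemma branch_filter_ultra:
  assumes I: "ideal_avoiding g I"
    and decides: "\<And>a. a \<in> B \<Longrightarrow> \<exists>k. \<exists>i\<in>I. lq (branch g X k) (jn i a) \<or> lq (branch g X k) (jn i (cm a))"
    and U: "elts U = branch_filter g I X"
  shows "ba_ultrafilter A U"
proof (rule ultrafilterI)
  have I_sub: "i \<in> B" if "i \<in> I" for i using I that unfolding ideal_avoiding_def by blast
  have br: "branch g X k \<in> B" for k using branch_in by blast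
  show "elts U \<subseteq> B" unfolding U branch_filter_def by blast
  have "bt \<in> I" using I unfolding ideal_avoiding_def by blast
  moreover have "lq (branch g X 0) (jn bt tp)" using jn_upper2[of bt tp] by simp
  ultimately show "tp \<in> elts U" unfolding U branch_filter_def by blast
  show "bt \<notin> elts U"
  proof
    assume "bt \<in> elts U"
    then obtain k i where "i \<in> I" "lq (branch g X k) (jn i bt)"
      unfolding U branch_filter_def by blast
    then have "branch g X k \<in> I"
      using I I_sub br jn_bt[of i] unfolding ideal_avoiding_def by auto
    then show False using I unfolding ideal_avoiding_def by blast
  qed
  show "mt a b \<in> elts U" if ab: "a \<in> elts U" "b \<in> elts U" for a b
  proof -
    obtain k i where a: "a \<in> B" "i \<in> I" "lq (branch g X k) (jn i a)"
      using ab(1) unfolding U branch_filter_def by blast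
    obtain l j where b: "b \<in> B" "j \<in> I" "lq (branch g X l) (jn j b)"
      using ab(2) unfolding U branch_filter_def by blast
    \<comment> \<open>The later of the two nodes and the join of the two ideal elements serve for
      both \<open>a\<close> and \<open>b\<close>.\<close>
    define n where "n = max k l"
    have ij: "i \<in> B" "j \<in> B" "jn i j \<in> I" "jn i j \<in> B"
      using a b I I_sub unfolding ideal_avoiding_def by auto
    have "lq (branch g X n) (jn i a)"
      using lq_trans[OF br br _ branch_mono a(3), of n] ij a unfolding n_def by auto
    then have "lq (branch g X n) (jn (jn i j) a)"
      using lq_trans[OF br _ _ _ jn_mono[OF ij(1) a(1) ij(4) a(1) jn_upper1[OF ij(1,2)] lq_refl[OF a(1)]]]
        ij a by blast
    moreover have "lq (branch g X n) (jn j b)"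
      using lq_trans[OF br br _ branch_mono b(3), of n] ij b unfolding n_def by auto
    then have "lq (branch g X n) (jn (jn i j) b)"
      using lq_trans[OF br _ _ _ jn_mono[OF ij(2) b(1) ij(4) b(1) jn_upper2[OF ij(1,2)] lq_refl[OF b(1)]]]
        ij b by blast
    ultimately have "lq (branch g X n) (jn (jn i j) (mt a b))"
      unfolding jn_mt[OF ij(4) a(1) b(1)] using br ij a b by (intro mt_greatest) auto
    then show ?thesis unfolding U branch_filter_def using ij a b by blast
  qed
  show "b \<in> elts U" if ab: "a \<in> elts U" "b \<in> B" "lq a b" for a b
  proof -
    obtain k i where a: "a \<in> B" "i \<in> I" "lq (branch g X k) (jn i a)"
      using ab(1) unfolding U branch_filter_def by blast
    have "lq (jn i a) (jn i b)" using a ab I_sub by (intro jn_mono lq_refl) auto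
    then have "lq (branch g X k) (jn i b)"
      using lq_trans[OF br _ _ a(3)] a(1,2) ab(2) I_sub by blast
    then show ?thesis unfolding U branch_filter_def using ab a by blast
  qed
  show "a \<in> elts U \<or> cm a \<in> elts U" if "a \<in> B" for a
    unfolding U branch_filter_def using decides[OF that] that by blast
qed

lemma branch_in_filter: "ideal_avoiding g I \<Longrightarrow> branch g X k \<in> branch_filter g I X"
  unfolding branch_filter_def ideal_avoiding_def using branch_in jn_upper2[of bt "branch g X k"] by blast

end

section \<open>Convergent sequences of ultrafilters\<close>

text \<open>Choices are made through a set \<open>ch\<close>, taken from \<open>V\<close> later on,
  so that they are definable terms with a parameter and come out the same in \<open>V\<close> and in
  \<open>V[G]\<close>.\<close>

definition atom_of :: "'a \<Rightarrow> 'a \<Rightarrow> 'a" where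
  "atom_of ch a = ap ch (sep (carr A) (\<lambda>p. atom p \<and> lq p a))"

definition split_of :: "'a \<Rightarrow> 'a \<Rightarrow> 'a" where
  "split_of ch a = ap ch (sep (carr A) (\<lambda>b. lq b a \<and> \<not> fin b \<and> \<not> fin (mt a (cm b))))"

text \<open>
  The branch along \<open>p\<close> with the bit at place \<open>n\<close> flipped; for \<open>n = omega\<close> no bit is flipped.
\<close>

definition coded_branch :: "'a \<Rightarrow> 'a \<Rightarrow> 'a \<Rightarrow> 'a \<Rightarrow> 'a" where
  "coded_branch ch n p k = num_rec tp (\<lambda>i y. if \<not> (opair i (num 1) \<in> elts p \<longleftrightarrow> i = n)
     then split_of ch y else mt y (cm (split_of ch y))) k"

text \<open>The bit of \<open>p\<close> at \<open>i\<close> is whether it contains the pair of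
  \<open>i\<close> and \<open>1\<close>. Any set can thus be read as a bit sequence, in particular
  the Cohen real and its finite parts; an undefined place counts as \<open>0\<close>.\<close>

definition flipped_bits :: "'a \<Rightarrow> 'a \<Rightarrow> nat \<Rightarrow> bool" where
  "flipped_bits n p i \<longleftrightarrow> \<not> (opair (num i) (num 1) \<in> elts p \<longleftrightarrow> num i = n)"

lemma coded_branch: "coded_branch ch n p (num k) = branch (split_of ch) (flipped_bits n p) k"
  by (induction k) (simp_all add: coded_branch_def flipped_bits_def)

end

section \<open>Ultrafilters and sequences inside a model containing the algebra\<close>

locale boolean_algebra_in = transitive_zermelo_omega M + boolean_algebra_set A
  for M :: "'a::set_universe set" and A :: "'a ba" +
  assumes ba_in: "ba_in A M"
begin

lemma ba_in_model [intro]: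
  "carr A \<in> M" "meet_fun A \<in> M" "join_fun A \<in> M" "compl_fun A \<in> M" "bt \<in> M" "tp \<in> M"
  using ba_in unfolding ba_in_def by auto

lemma dterm_mt [definable_intros]: "dterm M s \<Longrightarrow> dterm M t \<Longrightarrow> dterm M (\<lambda>e. mt (s e) (t e))"
  unfolding mt_def by (intro definable_intros ba_in_model)

lemma dterm_jn [definable_intros]: "dterm M s \<Longrightarrow> dterm M t \<Longrightarrow> dterm M (\<lambda>e. jn (s e) (t e))"
  unfolding jn_def by (intro definable_intros ba_in_model)

lemma dterm_cm [definable_intros]: "dterm M t \<Longrightarrow> dterm M (\<lambda>e. cm (t e))"
  unfolding cm_def by (intro definable_intros ba_in_model)

lemma definable_lq [definable_intros]:
  "dterm M s \<Longrightarrow> dterm M t \<Longrightarrow> definable M (\<lambda>e. lq (s e) (t e))"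
  unfolding lq_def by (intro definable_intros)

lemma definable_fin [definable_intros]:
  assumes "dterm M t"
  shows "definable M (\<lambda>e. fin (t e))"
  unfolding fin_def by (intro definable_intros assms[THEN dterm_rename] ba_in_model)

lemma definable_atom [definable_intros]:
  assumes "dterm M t"
  shows "definable M (\<lambda>e. atom (t e))"
  unfolding atom_def by (intro definable_intros assms assms[THEN dterm_rename] ba_in_model)

lemma dterm_atom_of [definable_intros]:
  assumes "dterm M s" "dterm M t"
  shows "dterm M (\<lambda>e. atom_of (s e) (t e))"
  unfolding atom_of_def by (intro definable_intros assms assms[THEN dterm_rename] ba_in_model)

lemma dterm_split_of [definable_intros]:
  assumes "dterm M s" "dterm M t"
  shows "dterm M (\<lambda>e. split_of (s e) (t e))"
  unfolding split_of_def by (intro definable_intros assms assms[THEN dterm_rename] ba_in_model)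

lemma dterm_coded_branch [definable_intros]:
  assumes "dterm M ch" "dterm M n" "dterm M p" "dterm M k"
  shows "dterm M (\<lambda>e. coded_branch (ch e) (n e) (p e) (k e))" unfolding coded_branch_def
  by (intro definable_intros assms assms[THEN dterm_rename] ba_in_model num_in)

lemma definable_ultrafilter [definable_intros]:
  assumes "dterm M t"
  shows "definable M (\<lambda>e. ba_ultrafilter A (t e))" unfolding ultrafilter_iff
  by (intro definable_intros assms assms[THEN dterm_rename] ba_in_model)

text \<open>Both cases end here. The graph of the sequence is separated out of a product by means of
  the term \<open>S\<close>. Uniqueness of the limit is what makes the sequence non-trivial: two
  limits are separated by some \<open>a\<close>, and the basic set of its complement is an open set
  belonging to \<open>M\<close>.\<close>

lemma convergent_sequenceI:
  assumes S: "dterm M (\<lambda>e. S (e 0))" and S_ultra: "\<And>n. ba_ultrafilter A (S (num n))"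
    and u: "u \<in> M" "ba_ultrafilter A u"
    and S_inj: "\<And>m n. S (num m) = S (num n) \<Longrightarrow> m = n" and S_ne: "\<And>n. S (num n) \<noteq> u"
    and conv: "\<And>a. a \<in> elts u \<Longrightarrow> \<exists>N. \<forall>n\<ge>N. a \<in> elts (S (num n))"
  shows "\<exists>s. stone_sequence M A s \<and> stone_nontrivial M A s \<and> (\<exists>u. stone_tendsto M A s u)"
proof -
  define s where "s n = S (num n)" for n
  have s_in: "s n \<in> M" for n
    unfolding s_def using dterm_in[OF S, of "\<lambda>_. num n"] by auto
  have s_point: "s n \<in> stone_points M A" for n
    unfolding stone_points_def using s_in S_ultra by (simp add: s_def)
  have ultra_sub: "elts U \<subseteq> B" if "ba_ultrafilter A U" for U
    using that unfolding ultrafilter_iff by blast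
  have "stone_sequence M A s" unfolding stone_sequence_def
  proof
    let ?f = "sep (times omega (power (carr A))) (\<lambda>z. \<exists>n\<in>elts omega. z = opair n (S n))"
    have "?f \<in> M"
      by (intro sep_in definable_intros times_in omega_in power_closed ba_in_model S[THEN dterm_rename])
    moreover have "elts ?f = {opair (num n) (s n) | n. True}"
    proof -
      have "opair (num n) (s n) \<in> elts (times omega (power (carr A)))" for n
        using s_in S_ultra[THEN ultra_sub] omega_in ba_in_model(1)
        by (subst opair_in_times) (auto simp: elts_power s_def)
      then show ?thesis unfolding elts_sep elts_omega s_def by auto
    qed
    ultimately show "\<exists>f\<in>M. elts f = {opair (num n) (s n) | n. True}" by blast
  qed (use s_point in blast)
  moreover have "stone_tendsto M A s u" unfolding stone_tendsto_def
  proof (intro conjI allI impI)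
    show "u \<in> stone_points M A" using u unfolding stone_points_def by blast
    fix Z assume "stone_open M A Z \<and> u \<in> elts Z"
    then obtain a where a: "u \<in> stone_basic M A a" "stone_basic M A a \<subseteq> elts Z"
      unfolding stone_open_def by blast
    then obtain N where "\<forall>n\<ge>N. a \<in> elts (s n)"
      using conv[of a] unfolding stone_basic_def s_def by blast
    then show "\<exists>N. \<forall>n\<ge>N. s n \<in> elts Z"
      using a(2) s_point unfolding stone_basic_def by blast
  qed
  moreover have "stone_nontrivial M A s" unfolding stone_nontrivial_def
  proof (intro conjI allI impI)
    show "inj s" unfolding s_def using S_inj by (rule injI)
    fix u' n assume u': "stone_tendsto M A s u'"
    have "u' = u"
    proof (rule ccontr)
      assume "u' \<noteq> u"
      have u'_point: "u' \<in> M" "ba_ultrafilter A u'"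
        using u' unfolding stone_tendsto_def stone_points_def by blast+
      obtain a where a: "a \<in> B" "a \<in> elts u" "cm a \<in> elts u'"
        using ultrafilter_separated[OF u(2) u'_point(2)] \<open>u' \<noteq> u\<close> by blast
      \<comment> \<open>Openness concerns elements of \<open>M\<close>; the ultrafilters containing
        \<open>cm a\<close> form one, by separation from the power set of the algebra.\<close>
      let ?Z = "sep (power (carr A)) (\<lambda>U. ba_ultrafilter A U \<and> cm a \<in> elts U)"
      have "a \<in> M" using transitive[OF ba_in_model(1) a(1)] .
      then have "?Z \<in> M" by (intro sep_in definable_intros power_closed ba_in_model)
      moreover have elts_Z: "elts ?Z = stone_basic M A (cm a)"
        unfolding elts_sep stone_basic_def stone_points_def elts_power[OF ba_in_model(1)]
        using ultra_sub by blast
      ultimately have "stone_open M A ?Z"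
        unfolding stone_open_def elts_Z using a(1) unfolding stone_basic_def by blast
      moreover have "u' \<in> elts ?Z"
        unfolding elts_Z stone_basic_def stone_points_def using u'_point a(3) by blast
      ultimately obtain N where N: "\<forall>n\<ge>N. s n \<in> elts ?Z"
        using u' unfolding stone_tendsto_def by blast
      obtain N' where N': "\<forall>n\<ge>N'. a \<in> elts (s n)"
        using conv[OF a(2)] unfolding s_def by blast
      have "a \<in> elts (s (max N N'))" "cm a \<in> elts (s (max N N'))"
        using N N' unfolding elts_Z stone_basic_def by auto
      then show False
        using ultrafilter_not_disjoint[OF S_ultra, of a "max N N'" "cm a"] mt_cm[OF a(1)]
        unfolding s_def by blast
    qed
    then show "s n \<noteq> u'" using S_ne unfolding s_def by blast
  qed
  ultimately show ?thesis by blast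
qed

text \<open>Removing a single atom leaves an infinite element infinite, so atoms can be picked below
  the successive remainders of \<open>a\<close>. By the assumption on \<open>a\<close>, for each
  \<open>b\<close> almost all of these atoms lie below \<open>b\<close> or almost all below its
  complement.\<close>

lemma rank_one_sequence:
  assumes ch: "ch \<in> M" and a: "a \<in> B" "\<not> fin a" "\<And>b. b \<in> B \<Longrightarrow> fin (mt a b) \<or> fin (mt a (cm b))"
    and atom_of: "\<And>c. c \<in> B \<Longrightarrow> \<exists>p\<in>B. atom p \<and> lq p c \<Longrightarrow>
      atom_of ch c \<in> B \<and> atom (atom_of ch c) \<and> lq (atom_of ch c) c"
  shows "\<exists>s. stone_sequence M A s \<and> stone_nontrivial M A s \<and> (\<exists>u. stone_tendsto M A s u)"
proof -
  \<comment> \<open>\<open>r (num k)\<close> is what remains of \<open>a\<close> after the removal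
    of the first \<open>k\<close> atoms.\<close>
  define r where "r k = num_rec a (\<lambda>i y. mt y (cm (atom_of ch y))) k" for k
  define p where "p n = atom_of ch (r (num n))" for n
  have a_in: "a \<in> M" using transitive[OF ba_in_model(1) a(1)] .
  have atom_of': "atom_of ch c \<in> B \<and> atom (atom_of ch c) \<and> lq (atom_of ch c) c"
    if "c \<in> B" "lq c a" "\<not> fin c" for c
    using atom_of[OF that(1) rank_one_atom_below[OF a(1,3) that]] .
  have r: "r (num k) \<in> B \<and> lq (r (num k)) a \<and> \<not> fin (r (num k))" for k
  proof (induction k)
    case 0
    then show ?case using a lq_refl unfolding r_def by simp
  next
    case (Suc k)
    let ?c = "r (num k)" and ?p = "atom_of ch (r (num k))"
    have p: "?p \<in> B" "atom ?p" "lq ?p ?c" using atom_of' Suc by blast+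
    have eq: "r (num (Suc k)) = mt ?c (cm ?p)" unfolding r_def by simp
    have "mt ?c ?p = ?p" using p(1,3) Suc mt_comm unfolding lq_def by metis
    then have "\<not> fin (mt ?c (cm ?p))"
      using fin_split[of ?c ?p] fin_atom[OF p(2)] Suc p(1) by auto
    moreover have "lq (mt ?c (cm ?p)) a"
      using lq_trans[of "mt ?c (cm ?p)" ?c a] mt_lower1[of ?c "cm ?p"] Suc p(1) a(1) by blast
    ultimately show ?case unfolding eq using Suc p(1) by auto
  qed
  have p: "p n \<in> B" "atom (p n)" "lq (p n) (r (num n))" for n
    unfolding p_def using atom_of' r by blast+
  have r_mono: "lq (r (num l)) (r (num k))" if "k \<le> l" for k l using that
  proof (induction rule: dec_induct)
    case base
    then show ?case using r lq_refl by blast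
  next
    case (step l)
    have "r (num (Suc l)) = mt (r (num l)) (cm (p l))" unfolding r_def p_def by simp
    then have "lq (r (num (Suc l))) (r (num l))"
      using mt_lower1[of "r (num l)" "cm (p l)"] r p(1) by simp
    then show ?case using lq_trans step.IH r by blast
  qed
  have p_lt: "lq (p l) (cm (p k))" if "k < l" for k l
  proof -
    have "r (num (Suc k)) = mt (r (num k)) (cm (p k))" unfolding r_def p_def by simp
    then have "lq (r (num (Suc k))) (cm (p k))"
      using mt_lower2[of "r (num k)" "cm (p k)"] r p(1) by simp
    moreover have "lq (p l) (r (num (Suc k)))"
      using lq_trans[of "p l" "r (num l)" "r (num (Suc k))"] p r r_mono[of "Suc k" l] that by auto
    ultimately show ?thesis using lq_trans[of "p l" "r (num (Suc k))" "cm (p k)"] p(1) r by blast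
  qed
  have p_excl: "\<not> (lq (p n) b \<and> lq (p n) (cm b))" if "b \<in> B" for n b
  proof
    assume "lq (p n) b \<and> lq (p n) (cm b)"
    then have "p n = mt (p n) (cm b)" "mt (p n) (cm b) = bt"
      using lq_iff_mt_cm[OF p(1) that] unfolding lq_def by auto
    then show False using p(2) unfolding atom_def by metis
  qed
  have p_inj: "k = l" if "p k = p l" for k l
  proof -
    have "\<not> k < l" if "p k = p l" for k l
      using p_lt[of k l] p_excl[of "p k" k] lq_refl[OF p(1)] that p(1) by metis
    then show ?thesis using that by (metis nat_neq_iff)
  qed
  have atom_le: "p m = p n" if "lq (p m) (p n)" for m n using p that unfolding atom_def by blast
  \<comment> \<open>Distinct atoms of the sequence below \<open>b\<close> are distinct elements
    below the finite \<open>mt a b\<close>.\<close>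
  have ev_not: "\<exists>N. \<forall>n\<ge>N. \<not> lq (p n) b" if b: "b \<in> B" "fin (mt a b)" for b
  proof -
    have "p ` {n. lq (p n) b} \<subseteq> elts (sep (carr A) (\<lambda>x. lq x (mt a b)))"
    proof
      fix x assume "x \<in> p ` {n. lq (p n) b}"
      then obtain n where n: "x = p n" "lq (p n) b" by blast
      have "lq (p n) a" using lq_trans[OF p(1) _ a(1) p(3)] r by blast
      then show "x \<in> elts (sep (carr A) (\<lambda>x. lq x (mt a b)))"
        using n mt_greatest[OF a(1) b(1) p(1)] p(1) by simp
    qed
    then have "finite (p ` {n. lq (p n) b})" using b(2) unfolding fin_def by (rule finite_subset)
    moreover have "inj_on p {n. lq (p n) b}" using p_inj by (rule inj_onI)
    ultimately have "finite {n. lq (p n) b}" by (rule finite_imageD)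
    then obtain N where "\<forall>n\<in>{n. lq (p n) b}. n < N"
      using finite_nat_set_iff_bounded by blast
    then show ?thesis by (metis linorder_not_less mem_Collect_eq)
  qed
  define S where "S n = sep (carr A) (\<lambda>b. lq (atom_of ch (r n)) b)" for n
  \<comment> \<open>Among numerals \<open>n \<in> elts N\<close> means \<open>n < N\<close>, so this
    is the filter of all \<open>b\<close> above almost every chosen atom, in a form that is
    definable over \<open>M\<close>.\<close>
  define u where "u = sep (carr A) (\<lambda>b. \<exists>N\<in>elts omega. \<forall>n\<in>elts omega.
    n \<in> elts N \<or> lq (atom_of ch (r n)) b)"
  have S: "b \<in> elts (S (num n)) \<longleftrightarrow> b \<in> B \<and> lq (p n) b" for b n
    unfolding S_def p_def by simp
  have u: "b \<in> elts u \<longleftrightarrow> b \<in> B \<and> (\<exists>N. \<forall>n\<ge>N. lq (p n) b)" for b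
    unfolding u_def p_def by (auto simp: not_less[symmetric])
  show ?thesis
  proof (rule convergent_sequenceI)
    show "dterm M (\<lambda>e. S (e 0))"
      unfolding S_def r_def by (intro definable_intros ba_in_model ch a_in)
    show "u \<in> M"
      unfolding u_def r_def by (intro sep_in definable_intros ba_in_model ch a_in omega_in)
    show "ba_ultrafilter A (S (num n))" for n unfolding ultrafilter_iff
    proof (intro conjI ballI impI)
      show "tp \<in> elts (S (num n))" using S lq_tp[OF p(1)] by simp
      show "bt \<notin> elts (S (num n))" using S lq_bt[OF p(1)] p(2) unfolding atom_def by blast
      show "mt b c \<in> elts (S (num n))" if "b \<in> elts (S (num n))" "c \<in> elts (S (num n))" for b c
        using that mt_greatest[OF _ _ p(1)] unfolding S by blast
      show "c \<in> elts (S (num n))" if "b \<in> elts (S (num n))" "c \<in> B" "lq b c" for b c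
        using that lq_trans[OF p(1)] unfolding S by blast
      show "b \<in> elts (S (num n)) \<or> cm b \<in> elts (S (num n))" if "b \<in> B" for b
        using that atom_decides[OF p(1,2)] unfolding S by blast
    qed (use S in blast)
    show "ba_ultrafilter A u" unfolding ultrafilter_iff
    proof (intro conjI ballI impI)
      show "tp \<in> elts u" using u lq_tp[OF p(1)] by simp
      show "bt \<notin> elts u" using u lq_bt[OF p(1)] p(2) unfolding atom_def by blast
      show "mt b c \<in> elts u" if bc: "b \<in> elts u" "c \<in> elts u" for b c
      proof -
        obtain N N' where "b \<in> B" "c \<in> B" "\<forall>n\<ge>N. lq (p n) b" "\<forall>n\<ge>N'. lq (p n) c"
          using bc unfolding u by blast
        then have "\<forall>n\<ge>max N N'. lq (p n) (mt b c)"
          using mt_greatest[OF _ _ p(1)] by simp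
        then show ?thesis
          unfolding u using \<open>b \<in> B\<close> \<open>c \<in> B\<close> by blast
      qed
      show "c \<in> elts u" if "b \<in> elts u" "c \<in> B" "lq b c" for b c
        using that lq_trans[OF p(1)] unfolding u by blast
      show "b \<in> elts u \<or> cm b \<in> elts u" if b: "b \<in> B" for b using a(3)[OF b]
      proof
        assume "fin (mt a b)"
        then show ?thesis using ev_not[OF b] atom_decides[OF p(1,2) b] b unfolding u by blast
      next
        assume "fin (mt a (cm b))"
        then show ?thesis using ev_not[of "cm b"] atom_decides[OF p(1,2) b] b unfolding u by blast
      qed
    qed (use u in blast)
    show "m = n" if "S (num m) = S (num n)" for m n
    proof -
      have "lq (p m) (p n)" using S[of "p n" n] S[of "p n" m] that lq_refl[OF p(1)] p(1) by simp
      then show ?thesis using atom_le p_inj by blast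
    qed
    show "S (num n) \<noteq> u" for n
    proof
      assume "S (num n) = u"
      then have "p n \<in> elts u" using S[of "p n" n] lq_refl[OF p(1)] p(1) by simp
      then obtain N where "\<forall>m\<ge>N. lq (p m) (p n)" unfolding u by blast
      then have "p (max N (Suc n)) = p n" using atom_le by simp
      then show False using p_inj by fastforce
    qed
    show "\<exists>N. \<forall>n\<ge>N. b \<in> elts (S (num n))" if "b \<in> elts u" for b
      using that unfolding u S by blast
  qed
qed

text \<open>Genericity enters through the hypothesis \<open>decides\<close>, for every flipped
  sequence and, with \<open>n = omega\<close>, for the unflipped one, whose ultrafilter is the
  limit.\<close>

lemma branch_sequence:
  assumes ch: "ch \<in> M" and x: "x \<in> M" and I: "I \<in> M" and inf: "\<not> fin tp"
    and g: "splitting (split_of ch)" and avoid: "ideal_avoiding (split_of ch) (elts I)"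
    and decides: "\<And>n a. n \<in> insert omega (elts omega) \<Longrightarrow> a \<in> B \<Longrightarrow> \<exists>k. \<exists>i\<in>elts I.
      lq (branch (split_of ch) (flipped_bits n x) k) (jn i a) \<or>
      lq (branch (split_of ch) (flipped_bits n x) k) (jn i (cm a))"
  shows "\<exists>s. stone_sequence M A s \<and> stone_nontrivial M A s \<and> (\<exists>u. stone_tendsto M A s u)"
proof -
  let ?g = "split_of ch" and ?X = "\<lambda>n. flipped_bits n x"
  define S where "S n = sep (carr A) (\<lambda>a. \<exists>k\<in>elts omega. \<exists>i\<in>elts I.
    lq (coded_branch ch n x k) (jn i a))" for n
  have elts_S: "elts (S n) = branch_filter ?g (elts I) (?X n)" for n
    unfolding S_def branch_filter_def by (auto simp: coded_branch)
  have S: "dterm M (\<lambda>e. S (e 0))"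
    unfolding S_def by (intro definable_intros ba_in_model omega_in ch x I)
  have ultra: "ba_ultrafilter A (S n)" if "n \<in> insert omega (elts omega)" for n
    using branch_filter_ultra[OF g inf avoid decides[OF that] elts_S] .
  have ultra_num: "ba_ultrafilter A (S (num n))" for n using ultra by simp
  have distinct: "S n \<noteq> S m" if "n \<in> insert omega (elts omega)" "?X n j \<noteq> ?X m j" for n m j
  proof
    assume "S n = S m"
    then have "branch ?g (?X n) (Suc j) \<in> elts (S n)" "branch ?g (?X m) (Suc j) \<in> elts (S n)"
      using branch_in_filter[OF g inf avoid] elts_S by metis+
    then show False using ultrafilter_not_disjoint[OF ultra[OF that(1)]]
        branch_disjoint[OF g inf, of j "Suc j" "Suc j" "?X n" "?X m"] that(2) by blast
  qed
  have omega_ne: "num n \<noteq> (omega :: 'a)" for n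
    using mem_irrefl[of omega] by (metis elts_omega rangeI)
  have bits: "?X (num n) j = ?X omega j \<longleftrightarrow> j \<noteq> n" for n j
    unfolding flipped_bits_def using omega_ne by (auto simp: num_inj)
  show ?thesis
  proof (rule convergent_sequenceI[OF S ultra_num])
    show "S omega \<in> M" using dterm_in[OF S, of "\<lambda>_. omega"] omega_in by auto
    show "ba_ultrafilter A (S omega)" using ultra by simp
    show "S (num n) \<noteq> S omega" for n using distinct[of "num n" n omega] bits by simp
    show "m = n" if eq: "S (num m) = S (num n)" for m n
    proof (rule ccontr)
      assume "m \<noteq> n"
      then have "?X (num m) m \<noteq> ?X (num n) m" using bits[of m m] bits[of n m] by blast
      then show False using distinct[of "num m" m "num n"] eq by simp
    qed
    show "\<exists>N. \<forall>n\<ge>N. a \<in> elts (S (num n))" if a_u: "a \<in> elts (S omega)" for a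
    proof -
      obtain k i where a: "a \<in> B" "i \<in> elts I" "lq (branch ?g (?X omega) k) (jn i a)"
        using a_u unfolding elts_S branch_filter_def by blast
      have "branch ?g (?X (num n)) k = branch ?g (?X omega) k" if "n \<ge> k" for n
        using bits that by (intro branch_cong) auto
      then have "\<forall>n\<ge>k. lq (branch ?g (?X (num n)) k) (jn i a)" using a(3) by simp
      then have "\<forall>n\<ge>k. a \<in> elts (S (num n))"
        unfolding elts_S branch_filter_def using a(1,2) by blast
      then show ?thesis by blast
    qed
  qed
qed

text \<open>A node depends on finitely many bits, which a finite set in \<open>M\<close> records.
  This replaces quantification over bit sequences of the logic by quantification over
  \<open>M\<close>, so that avoiding all nodes becomes a first-order condition.\<close>

lemma branch_coded:
  "\<exists>p\<in>M. branch (split_of ch) X k = coded_branch ch omega p (num k)"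
proof -
  obtain p where p: "p \<in> M" "elts p = (\<lambda>i. opair (num i) (num 1)) ` {i. i < k \<and> X i}"
    using finite_subset_in[of "(\<lambda>i. opair (num i) (num 1)) ` {i. i < k \<and> X i}"] by auto
  have "num i \<noteq> (omega :: 'a)" for i using mem_irrefl[of omega] by (metis elts_omega rangeI)
  then have "flipped_bits omega p i = X i" if "i < k" for i
    unfolding flipped_bits_def p(2) using that by (auto simp: opair_eq_iff num_inj)
  then have "branch (split_of ch) (flipped_bits omega p) k = branch (split_of ch) X k"
    by (intro branch_cong) auto
  then show ?thesis using p(1) by (intro bexI[of _ p]) (simp_all add: coded_branch)
qed

end

section \<open>The ideal in the ground model and the density argument for Cohen reals\<close>

locale generic_boolean = generic_forcing V P R G + boolean_algebra_in V A
  for V :: "'a::set_universe set" and P R G A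
begin

lemma VG_boolean: "boolean_algebra_in VG A"
proof -
  have "ba_in A VG" using ba_in V_sub_VG unfolding ba_in_def by blast
  then show ?thesis
    by (intro boolean_algebra_in.intro VG_zermelo boolean_algebra_set_axioms boolean_algebra_in_axioms.intro)
qed

text \<open>A choice function in \<open>V\<close> chooses from sets that lie in \<open>V\<close>;
  the sets of candidates do, being definable over \<open>V\<close>.\<close>

lemma choice_on_algebra:
  obtains ch where "ch \<in> V"
    "\<And>c. c \<in> B \<Longrightarrow> \<exists>p\<in>B. atom p \<and> lq p c \<Longrightarrow>
      atom_of ch c \<in> B \<and> atom (atom_of ch c) \<and> lq (atom_of ch c) c"
    "(\<And>a. a \<in> B \<Longrightarrow> \<not> fin a \<Longrightarrow> \<exists>b\<in>B. lq b a \<and> \<not> fin b \<and> \<not> fin (mt a (cm b))) \<Longrightarrow>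
      splitting (split_of ch)"
proof -
  obtain ch where ch: "ch \<in> V"
    "\<And>S. S \<in> V \<Longrightarrow> elts S \<subseteq> B \<Longrightarrow> elts S \<noteq> {} \<Longrightarrow> ap ch S \<in> elts S"
    using choice_function[OF ba_in_model(1)] by metis
  have choose: "ap ch (sep (carr A) Q) \<in> B \<and> Q (ap ch (sep (carr A) Q))"
    if Q: "definable V (\<lambda>e. Q (e 0))" and ex: "\<exists>b\<in>B. Q b" for Q
  proof -
    have "sep (carr A) Q \<in> V" using sep_in[OF ba_in_model(1) Q] .
    then show ?thesis using ch(2)[of "sep (carr A) Q"] ex by auto
  qed
  have in_V: "c \<in> V" if "c \<in> B" for c using transitive[OF ba_in_model(1) that] .
  have "atom_of ch c \<in> B \<and> atom (atom_of ch c) \<and> lq (atom_of ch c) c"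
    if "c \<in> B" "\<exists>p\<in>B. atom p \<and> lq p c" for c unfolding atom_of_def
    by (rule choose[OF _ that(2)]) (intro definable_intros in_V that(1))
  moreover have "splitting (split_of ch)"
    if split: "\<And>a. a \<in> B \<Longrightarrow> \<not> fin a \<Longrightarrow> \<exists>b\<in>B. lq b a \<and> \<not> fin b \<and> \<not> fin (mt a (cm b))"
    unfolding splitting_def
  proof (intro ballI impI)
    fix a assume a: "a \<in> B" "\<not> fin a"
    show "split_of ch a \<in> B \<and> lq (split_of ch a) a \<and> \<not> fin (split_of ch a) \<and>
        \<not> fin (mt a (cm (split_of ch a)))" unfolding split_of_def
      by (rule choose[OF _ split[OF a]]) (intro definable_intros in_V a(1))
  qed
  ultimately show thesis using that ch(1) by blast
qed

text \<open>Zorn's lemma in \<open>V\<close>, applied to the ideals that avoid the nodes. The zero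
  ideal is a start because nodes are infinite, hence nonzero.\<close>

lemma maximal_ideal:
  assumes ch: "ch \<in> V" and g: "splitting (split_of ch)" and inf: "\<not> fin tp"
  obtains I where "I \<in> V" "ideal_avoiding (split_of ch) (elts I)"
    "\<And>a. a \<in> B \<Longrightarrow> a \<notin> elts I \<Longrightarrow> \<exists>i\<in>elts I. \<exists>Y l. lq (branch (split_of ch) Y l) (jn i a)"
proof -
  define good where "good I \<longleftrightarrow> elts I \<subseteq> elts (carr A) \<and> bt \<in> elts I \<and>
    (\<forall>a\<in>elts (carr A). \<forall>b\<in>elts I. lq a b \<longrightarrow> a \<in> elts I) \<and>
    (\<forall>a\<in>elts I. \<forall>b\<in>elts I. jn a b \<in> elts I)" for I
  define avoids where "avoids I \<longleftrightarrow> (\<forall>p\<in>V. \<forall>k\<in>elts omega. coded_branch ch omega p k \<notin> elts I)" for I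
  have avoids_iff: "avoids I \<longleftrightarrow> (\<forall>X k. branch (split_of ch) X k \<notin> elts I)" for I
  proof
    assume avoids: "avoids I"
    show "\<forall>X k. branch (split_of ch) X k \<notin> elts I"
    proof (intro allI)
      fix X k
      obtain p where "p \<in> V" "branch (split_of ch) X k = coded_branch ch omega p (num k)"
        using branch_coded by blast
      then show "branch (split_of ch) X k \<notin> elts I" using avoids unfolding avoids_def by simp
    qed
  next
    assume "\<forall>X k. branch (split_of ch) X k \<notin> elts I"
    then show "avoids I" unfolding avoids_def by (auto simp: coded_branch)
  qed
  let ?\<G> = "sep (power (carr A)) (\<lambda>I. good I \<and> avoids I)"
  have G_in: "?\<G> \<in> V" unfolding good_def avoids_def
    by (intro sep_in definable_intros power_closed ba_in_model ch omega_in)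
  have mem_G: "I \<in> elts ?\<G> \<longleftrightarrow> I \<in> V \<and> good I \<and> avoids I" for I
    unfolding elts_sep elts_power[OF ba_in_model(1)] good_def by blast
  have base: "pairset bt bt \<in> elts ?\<G>" unfolding mem_G
  proof (intro conjI)
    show "pairset bt bt \<in> V" using ba_in_model by blast
    show "good (pairset bt bt)" unfolding good_def using lq_bt jn_bt by auto
    show "avoids (pairset bt bt)"
      unfolding avoids_iff elts_pairset using branch_in[OF g inf] fin_bt by (metis insertE singletonD)
  qed
  have chain: "Unions C \<in> elts ?\<G>"
    if C: "C \<in> V" "elts C \<subseteq> elts ?\<G>" "elts C \<noteq> {}"
      "\<forall>x\<in>elts C. \<forall>y\<in>elts C. elts x \<subseteq> elts y \<or> elts y \<subseteq> elts x" for C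
    unfolding mem_G
  proof (intro conjI)
    have good: "good I" "avoids I" if "I \<in> elts C" for I using C(2) that mem_G by blast+
    show "Unions C \<in> V" using C(1) by blast
    show "good (Unions C)" unfolding good_def
    proof (intro conjI ballI impI)
      show "elts (Unions C) \<subseteq> B" using good(1) unfolding good_def elts_Unions by blast
      show "bt \<in> elts (Unions C)" using good(1) C(3) unfolding good_def elts_Unions by blast
      show "a \<in> elts (Unions C)" if "a \<in> B" "b \<in> elts (Unions C)" "lq a b" for a b
        using that good(1) unfolding good_def elts_Unions by blast
      show "jn a b \<in> elts (Unions C)" if ab: "a \<in> elts (Unions C)" "b \<in> elts (Unions C)" for a b
      proof -
        obtain I J where "I \<in> elts C" "J \<in> elts C" "a \<in> elts I" "b \<in> elts J"
          using ab by auto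
        then obtain K where K: "K \<in> elts C" "a \<in> elts K" "b \<in> elts K"
          using C(4) by blast
        then have "jn a b \<in> elts K" using good(1)[OF K(1)] unfolding good_def by blast
        then show ?thesis using K(1) unfolding elts_Unions by blast
      qed
    qed
    show "avoids (Unions C)" using good(2) unfolding avoids_iff elts_Unions by blast
  qed
  obtain I where I: "I \<in> elts ?\<G>" and
    maximal: "\<And>J. J \<in> elts ?\<G> \<Longrightarrow> elts I \<subseteq> elts J \<Longrightarrow> J = I"
    by (rule zorn_in[OF G_in base], erule (3) chain, rule that)
  have I': "I \<in> V" "good I" "avoids I" using I unfolding mem_G by blast+
  have I_B: "i \<in> B" if "i \<in> elts I" for i using I'(2) that unfolding good_def by blast
  have "\<exists>i\<in>elts I. \<exists>Y l. lq (branch (split_of ch) Y l) (jn i a)" if a: "a \<in> B" "a \<notin> elts I" for a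
  proof -
    \<comment> \<open>\<open>J\<close> is the ideal generated by \<open>I\<close> and
      \<open>a\<close>. It is strictly larger than \<open>I\<close>, so by maximality it has to
      contain a node.\<close>
    define J where "J = sep (carr A) (\<lambda>b. \<exists>i\<in>elts I. lq b (jn i a))"
    have "a \<in> V" using transitive[OF ba_in_model(1) a(1)] .
    then have "J \<in> V" unfolding J_def by (intro sep_in definable_intros ba_in_model I')
    have bt_I: "bt \<in> elts I" using I'(2) unfolding good_def by blast
    have "elts I \<subseteq> elts J" unfolding J_def using jn_upper1[OF _ a(1)] I_B by auto
    moreover have "a \<in> elts J" unfolding J_def using a(1) bt_I jn_upper2[of bt a] by auto
    ultimately have "J \<notin> elts ?\<G>" using maximal[of J] a(2) by blast
    moreover have "good J" unfolding good_def
    proof (intro conjI ballI impI)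
      show "bt \<in> elts J" using \<open>elts I \<subseteq> elts J\<close> bt_I by blast
      show "b \<in> elts J" if b: "b \<in> B" "c \<in> elts J" "lq b c" for b c
      proof -
        obtain i where i: "c \<in> B" "i \<in> elts I" "lq c (jn i a)"
          using b(2) unfolding J_def by auto
        then have "lq b (jn i a)" using lq_trans[OF b(1) i(1) _ b(3)] I_B a(1) by blast
        then show ?thesis unfolding J_def using b(1) i(2) by auto
      qed
      show "jn b c \<in> elts J" if bc: "b \<in> elts J" "c \<in> elts J" for b c
      proof -
        obtain i where i: "b \<in> B" "i \<in> elts I" "lq b (jn i a)"
          using bc(1) unfolding J_def by auto
        obtain j where j: "c \<in> B" "j \<in> elts I" "lq c (jn j a)"
          using bc(2) unfolding J_def by auto
        have ij: "i \<in> B" "j \<in> B" "jn i j \<in> elts I" "jn i j \<in> B"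
          using i j I_B I'(2) unfolding good_def by auto
        have "lq b (jn (jn i j) a)"
          using lq_trans[OF i(1) _ _ i(3) jn_mono[OF ij(1) a(1) ij(4) a(1) jn_upper1[OF ij(1,2)] lq_refl[OF a(1)]]]
            ij a(1) by blast
        moreover have "lq c (jn (jn i j) a)"
          using lq_trans[OF j(1) _ _ j(3) jn_mono[OF ij(2) a(1) ij(4) a(1) jn_upper2[OF ij(1,2)] lq_refl[OF a(1)]]]
            ij a(1) by blast
        ultimately have "lq (jn b c) (jn (jn i j) a)" using jn_least[OF i(1) j(1)] ij a(1) by blast
        then show ?thesis unfolding J_def using ij(3) i(1) j(1) by auto
      qed
    qed (simp add: J_def)
    ultimately have "\<not> avoids J" using mem_G \<open>J \<in> V\<close> by blast
    then obtain Y l where "branch (split_of ch) Y l \<in> elts J" unfolding avoids_iff by blast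
    then show ?thesis unfolding J_def by auto
  qed
  moreover have "ideal_avoiding (split_of ch) (elts I)"
    using I' unfolding ideal_avoiding_def good_def avoids_iff by blast
  ultimately show thesis using that I'(1) by blast
qed

text \<open>For fixed \<open>n\<close> and \<open>a\<close>, the finite sequences whose node, after
  the flip at \<open>n\<close>, decides \<open>a\<close> modulo \<open>I\<close> form a set in
  \<open>V\<close>, and by density of the nodes every condition extends to one of them. The Cohen
  real extends such a sequence and shares its node.\<close>

lemma Cohen_real_decides:
  assumes ch: "ch \<in> V" and g: "splitting (split_of ch)" and inf: "\<not> fin tp"
    and I: "I \<in> V" "ideal_avoiding (split_of ch) (elts I)"
    and maximal: "\<And>a. a \<in> B \<Longrightarrow> a \<notin> elts I \<Longrightarrow>
      \<exists>i\<in>elts I. \<exists>Y l. lq (branch (split_of ch) Y l) (jn i a)"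
    and x: "Cohen_real V x" and n: "n \<in> V" and a: "a \<in> B"
  shows "\<exists>k. \<exists>i\<in>elts I. lq (branch (split_of ch) (flipped_bits n x) k) (jn i a) \<or>
    lq (branch (split_of ch) (flipped_bits n x) k) (jn i (cm a))"
proof -
  let ?two = "pairset (num 0) (num 1)"
  \<comment> \<open>\<open>graph p k\<close> says that \<open>p\<close> is a function from
    \<open>k\<close> to \<open>2\<close>. Domains that are initial segments make the node of
    \<open>p\<close> depend only on defined bits.\<close>
  define graph where "graph p k \<longleftrightarrow>
    (\<forall>z\<in>elts p. \<exists>i\<in>elts k. z = opair i (num 0) \<or> z = opair i (num 1)) \<and>
    (\<forall>i\<in>elts k. \<not> (opair i (num 0) \<in> elts p \<longleftrightarrow> opair i (num 1) \<in> elts p))" for p k :: 'a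
  define decided where "decided c \<longleftrightarrow> (\<exists>i\<in>elts I. lq c (jn i a) \<or> lq c (jn i (cm a)))" for c
  define D where "D = sep (power (times omega ?two))
    (\<lambda>p. \<exists>k\<in>elts omega. graph p k \<and> decided (coded_branch ch n p k))"
  have "a \<in> V" using transitive[OF ba_in_model(1) a] .
  then have D_in: "D \<in> V" unfolding D_def graph_def decided_def
    by (intro sep_in definable_intros power_closed times_in omega_in pairset_in num_in I ch n)
  have "elts D \<subseteq> Fn_omega_2"
  proof
    fix p assume "p \<in> elts D"
    then obtain k where graph: "graph p (num k)" unfolding D_def by auto
    have "elts p \<subseteq> (\<lambda>(i, j). opair (num i) (num j)) ` ({..<k} \<times> {0, 1})"
      using graph unfolding graph_def elts_num by fastforce
    then have "finite (elts p)" by (rule finite_subset) simp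
    moreover have "is_fun p (elts (num k)) {num 0, num 1}" unfolding is_fun_def
    proof (intro conjI ballI)
      show "\<exists>i\<in>elts (num k). \<exists>y\<in>{num 0, num 1}. z = opair i y" if "z \<in> elts p" for z
        using graph that unfolding graph_def by blast
      fix i assume i: "i \<in> elts (num k :: 'a)"
      have "y = num 0 \<or> y = num 1" if "opair i y \<in> elts p" for y
        using graph that unfolding graph_def by (metis opair_eq_iff)
      then show "\<exists>!y. opair i y \<in> elts p" using graph i unfolding graph_def by metis
    qed
    moreover have "elts (num k) \<subseteq> range (num :: nat \<Rightarrow> 'a)"
      unfolding elts_num by blast
    ultimately show "p \<in> Fn_omega_2" unfolding Fn_omega_2_def by blast
  qed
  moreover have "\<exists>q\<in>elts D. elts p \<subseteq> elts q" if "p \<in> Fn_omega_2" for p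
  proof -
    obtain X where fin_p: "finite (elts p)" and X: "X \<subseteq> range num" and fun_p: "is_fun p X {num 0, num 1}"
      using \<open>p \<in> Fn_omega_2\<close> unfolding Fn_omega_2_def by blast
    \<comment> \<open>The domain of a finite function is finite, hence bounded by some
      \<open>k\<close>.\<close>
    obtain k where k: "\<And>i. num i \<in> X \<Longrightarrow> i < k"
    proof -
      have "(\<lambda>i. opair (num i) (ap p (num i))) ` {i. num i \<in> X} \<subseteq> elts p"
        using is_fun_ap(1)[OF fun_p] by blast
      then have "finite ((\<lambda>i. opair (num i) (ap p (num i))) ` {i. num i \<in> X})"
        using fin_p by (rule finite_subset)
      moreover have "inj_on (\<lambda>i. opair (num i) (ap p (num i))) {i. num i \<in> X}"
        by (rule inj_onI) (simp add: opair_eq_iff num_inj)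
      ultimately have "finite {i. (num i :: 'a) \<in> X}" by (rule finite_imageD)
      then have "\<exists>m. \<forall>i\<in>{i. (num i :: 'a) \<in> X}. i < m"
        by (simp only: finite_nat_set_iff_bounded)
      then show thesis using that by blast
    qed
    \<comment> \<open>The node prescribed by the first \<open>k\<close> bits of \<open>p\<close>,
      with undefined places read as \<open>0\<close> and the flip applied, is followed further down
      the tree to a deciding node.\<close>
    have "\<exists>Y l. (\<forall>i<k. Y i = flipped_bits n p i) \<and> k \<le> l \<and> decided (branch (split_of ch) Y l)"
      unfolding decided_def by (rule branch_decides[OF g inf I(2) _ a]) (erule (1) maximal)
    then obtain Y l where Y: "\<forall>i<k. Y i = flipped_bits n p i" "k \<le> l"
      "decided (branch (split_of ch) Y l)" by blast
    \<comment> \<open>The flip at \<open>n\<close> is undone here, so that the flipped bits of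
      \<open>q\<close> are those of \<open>Y\<close>.\<close>
    define bit where "bit i = (num (if Y i \<longleftrightarrow> num i = n then 0 else 1) :: 'a)" for i
    obtain q where q: "q \<in> V" "elts q = (\<lambda>i. opair (num i) (bit i)) ` {..<l}"
      using finite_subset_in[of "(\<lambda>i. opair (num i) (bit i)) ` {..<l}"] unfolding bit_def by auto
    have q_iff: "opair (num i) y \<in> elts q \<longleftrightarrow> i < l \<and> y = bit i" for i y
      unfolding q(2) by (auto simp: opair_eq_iff num_inj)
    have bit: "bit i = num 1 \<longleftrightarrow> \<not> (Y i \<longleftrightarrow> num i = n)" "bit i = num 0 \<longleftrightarrow> (Y i \<longleftrightarrow> num i = n)" for i
      unfolding bit_def by (auto simp: num_inj)
    have "elts q \<subseteq> elts (times omega ?two)"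
    proof
      fix z assume "z \<in> elts q"
      then obtain i where i: "z = opair (num i) (bit i)" unfolding q(2) by blast
      show "z \<in> elts (times omega ?two)"
        unfolding i by (subst opair_in_times) (auto simp: bit_def)
    qed
    moreover have "graph q (num l)" unfolding graph_def
    proof (intro conjI ballI)
      fix z assume "z \<in> elts q"
      then obtain i where "i < l" "z = opair (num i) (bit i)" unfolding q(2) by blast
      then show "\<exists>i\<in>elts (num l). z = opair i (num 0) \<or> z = opair i (num 1)"
        by (intro bexI[of _ "num i"]) (auto simp: bit_def)
    next
      fix i assume "i \<in> elts (num l :: 'a)"
      then obtain j where "j < l" "i = num j" unfolding elts_num by blast
      then show "\<not> (opair i (num 0) \<in> elts q \<longleftrightarrow> opair i (num 1) \<in> elts q)"
        using q_iff bit[of j] by metis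
    qed
    moreover have "coded_branch ch n q (num l) = branch (split_of ch) Y l" unfolding coded_branch
    proof (rule branch_cong)
      fix i assume "i < l"
      then show "flipped_bits n q i = Y i"
        unfolding flipped_bits_def q_iff using bit(1)[of i] by metis
    qed
    moreover have "times omega ?two \<in> V" by (intro times_in omega_in pairset_in num_in)
    ultimately have "q \<in> elts D"
      unfolding D_def using q(1) Y(3) by (auto simp: elts_power intro!: exI[of _ l])
    moreover have "elts p \<subseteq> elts q"
    proof
      fix z assume z: "z \<in> elts p"
      then obtain w y where w: "w \<in> X" "y \<in> {num 0, num 1}" "z = opair w y"
        using fun_p unfolding is_fun_def by blast
      obtain i where i: "w = num i" using w(1) X by blast
      then have "i < k" using k w(1) by blast
      have y: "opair (num i) y' \<in> elts p \<longleftrightarrow> y' = y" for y'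
        using is_fun_ap(4)[OF fun_p w(1)] z w(3) i by metis
      have "Y i \<longleftrightarrow> \<not> (y = num 1 \<longleftrightarrow> num i = n)"
        using Y(1) \<open>i < k\<close> y[of "num 1"] unfolding flipped_bits_def by auto
      then have "bit i = y" using w(2) unfolding bit_def by (auto simp: num_inj)
      then show "z \<in> elts q" unfolding w(3) i using q_iff \<open>i < k\<close> Y(2) by simp
    qed
    ultimately show ?thesis by blast
  qed
  ultimately obtain p where p: "p \<in> elts D" "elts p \<subseteq> elts x"
    using x D_in unfolding Cohen_real_def by blast
  have fun_x: "is_fun x (range num) {num 0, num 1}" using x unfolding Cohen_real_def by blast
  obtain k where k: "graph p (num k)" "decided (coded_branch ch n p (num k))"
    using p(1) unfolding D_def by auto
  have "coded_branch ch n p (num k) = branch (split_of ch) (flipped_bits n x) k"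
    unfolding coded_branch
  proof (rule branch_cong)
    fix i assume "i < k"
    then have "\<not> (opair (num i) (num 0) \<in> elts p \<longleftrightarrow> opair (num i) (num 1) \<in> elts p)"
      using k(1) unfolding graph_def by simp
    \<comment> \<open>If \<open>p\<close> has value \<open>0\<close> at \<open>i\<close>, so has
      \<open>x\<close>, and then \<open>x\<close> cannot have value \<open>1\<close>; thus both have
      the same bit.\<close>
    moreover have "\<not> (opair (num i) (num 0) \<in> elts x \<and> opair (num i) (num 1) \<in> elts x)"
      using is_fun_ap(4)[OF fun_x, of "num i"] num_inj[of 0 1] by (metis rangeI zero_neq_one)
    ultimately have "opair (num i) (num 1) \<in> elts p \<longleftrightarrow> opair (num i) (num 1) \<in> elts x"
      using p(2) by blast
    then show "flipped_bits n p i = flipped_bits n x i" unfolding flipped_bits_def by simp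
  qed
  then show ?thesis using k(2) unfolding decided_def by auto
qed

end

theorem theorem3p2:
  fixes V :: "'a::set_universe set"
    and P R :: 'a
    and A :: "'a ba"
  assumes "transitive_model_ZFC V"
    and "P \<in> V" and "R \<in> V" and "forcing_notion P R"
    and "adds_Cohen_real V P R"
    and "ba_in A V" and "is_boolean_algebra A" and "infinite (elts (carr A))"
  shows "\<forall>G. generic_filter V P R G \<longrightarrow>
           (\<exists>s. stone_sequence (generic_extension V P G) A s \<and>
                stone_nontrivial (generic_extension V P G) A s \<and>
                (\<exists>u. stone_tendsto (generic_extension V P G) A s u))"
proof (intro allI impI)
  fix G assume G: "generic_filter V P R G"
  interpret V: transitive_zfc V using transitive_zfcI[OF assms(1)] .
  interpret generic_boolean V P R G A by unfold_locales (use assms G in auto)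
  \<comment> \<open>The algebra is viewed in \<open>V\<close> and in \<open>V[G]\<close>;
    \<open>fin\<close>, \<open>atom_of\<close> and \<open>branch\<close> are the same in
    both.\<close>
  interpret VG: boolean_algebra_in VG A by (rule VG_boolean)
  have inf: "\<not> fin tp" using fin_tp assms(8) by blast
  obtain ch where ch: "ch \<in> V"
    and atom_of: "\<And>c. c \<in> B \<Longrightarrow> \<exists>p\<in>B. atom p \<and> lq p c \<Longrightarrow>
      atom_of ch c \<in> B \<and> atom (atom_of ch c) \<and> lq (atom_of ch c) c"
    and split_of: "(\<And>a. a \<in> B \<Longrightarrow> \<not> fin a \<Longrightarrow> \<exists>b\<in>B. lq b a \<and> \<not> fin b \<and> \<not> fin (mt a (cm b))) \<Longrightarrow>
      splitting (split_of ch)" using choice_on_algebra by blast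
  have ch': "ch \<in> VG" using ch V_sub_VG by blast
  show "\<exists>s. stone_sequence VG A s \<and> stone_nontrivial VG A s \<and> (\<exists>u. stone_tendsto VG A s u)"
  proof (cases "\<exists>a\<in>B. \<not> fin a \<and> (\<forall>b\<in>B. fin (mt a b) \<or> fin (mt a (cm b)))")
    case True
    then obtain a where "a \<in> B" "\<not> fin a" "\<And>b. b \<in> B \<Longrightarrow> fin (mt a b) \<or> fin (mt a (cm b))"
      by blast
    then show ?thesis using VG.rank_one_sequence[OF ch' _ _ _ atom_of] by blast
  next
    case False
    have g: "splitting (split_of ch)"
    proof (rule split_of)
      fix a assume a: "a \<in> B" "\<not> fin a"
      then obtain b where b: "b \<in> B" "\<not> fin (mt a b)" "\<not> fin (mt a (cm b))"
        using False by blast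
      \<comment> \<open>The failure of the first case yields some \<open>b\<close> in the algebra,
        while a splitting has to lie below \<open>a\<close>. So \<open>b\<close> is replaced by
        \<open>mt a b\<close>; the complement becomes larger, and its part in \<open>a\<close> stays
        infinite.\<close>
      have "lq (mt a (cm b)) (mt a (cm (mt a b)))"
      proof (rule mt_greatest)
        have "lq (cm b) (cm (mt a b))"
        proof -
          have "mt (cm b) (mt a b) = bt"
            using disjoint_mono[OF _ _ _ b(1) lq_refl mt_lower2] a b mt_cm[OF b(1)] mt_comm[of b "cm b"]
            by simp
          then show ?thesis using lq_cm_iff a(1) b(1) by blast
        qed
        then show "lq (mt a (cm b)) (cm (mt a b))"
          using lq_trans[OF _ _ _ mt_lower2] a(1) b(1) by blast
      qed (use a b mt_lower1 in auto)
      then have "\<not> fin (mt a (cm (mt a b)))"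
        using fin_mono[of "mt a (cm b)" "mt a (cm (mt a b))"] a b by blast
      then show "\<exists>b\<in>B. lq b a \<and> \<not> fin b \<and> \<not> fin (mt a (cm b))"
        using a b mt_lower1 by (intro bexI[of _ "mt a b"]) auto
    qed
    obtain I where I: "I \<in> V" "ideal_avoiding (split_of ch) (elts I)"
      and maximal: "\<And>a. a \<in> B \<Longrightarrow> a \<notin> elts I \<Longrightarrow>
        \<exists>i\<in>elts I. \<exists>Y l. lq (branch (split_of ch) Y l) (jn i a)"
      using maximal_ideal[OF ch g inf] by blast
    obtain x where x: "x \<in> VG" "Cohen_real V x"
      using assms(5) G unfolding adds_Cohen_real_def by blast
    have "I \<in> VG" using I(1) V_sub_VG by blast
    then show ?thesis
    proof (rule VG.branch_sequence[OF ch' x(1) _ inf g I(2)])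
      \<comment> \<open>Each \<open>n\<close> that occurs is a numeral or \<open>omega\<close> and
        hence an element of \<open>V\<close>, as the dense set in \<open>V\<close> requires.\<close>
      fix n a :: 'a assume "n \<in> insert omega (elts omega)" "a \<in> B"
      then show "\<exists>k. \<exists>i\<in>elts I. lq (branch (split_of ch) (flipped_bits n x) k) (jn i a) \<or>
          lq (branch (split_of ch) (flipped_bits n x) k) (jn i (cm a))"
        using Cohen_real_decides[OF ch g inf I maximal x(2)] V.omega_in V.num_in by auto
    qed
  qed
qed

end
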